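(* Let $0<\alpha<1$, $1<p<1/\alpha$ and $1/q=1/p-\alpha$. If $w\in A_{p,q}^+$, then for all $f\in L^p(w^p)$, $$\lim_{\varepsilon\to0^+}(D_{\rm right})^\alpha_\varepsilon(W_\alpha f)(x)=f(x),$$ both for almost every $x\in\mathbb{R}$ and in the norm of $L^p(w^p)$; that is, $f=(D_{\rm right})^\alpha(W_\alpha f)$ in the almost everywhere sense and in the $L^p(w^p)$-norm.
   Context: A weight is a measurable function $w$ on $\mathbb{R}$ with $0<w<\infty$, and $L^p(w^p)=L^p(\mathbb{R},w(x)^p\,dx)$. For $1<p,q<\infty$, $w\in A_{p,q}^+$ means that there is a constant $C>0$ such that $$\Big(\frac1h\int_{a-h}^a w^q\Big)^{1/q}\Big(\frac1h\int_a^{a+h}w^{-p'}\Big)^{1/p'}\le C\quad\text{for all }a\in\mathbb{R},\ h>0,$$ where $p'=p/(p-1)$. The fractional integral is $W_\alpha f(x)=\frac{1}{\Gamma(\alpha)}\int_x^\infty\frac{f(t)}{(t-x)^{1-\alpha}}\,dt$. For $\varepsilon>0$ the truncated fractional derivative from the right is $$(D_{\rm right})^\alpha_\varepsilon u(x)=\frac{1}{\Gamma(-\alpha)}\int_{x+\varepsilon}^\infty\frac{u(t)-u(x)}{(t-x)^{1+\alpha}}\,dt,$$ and $(D_{\rm right})^\alpha u=\lim_{\varepsilon\to0^+}(D_{\rm right})^\alpha_\varepsilon u$. *)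

theory Defs
  imports "HOL-Analysis.Analysis"
begin

definition weight :: "(real \<Rightarrow> real) \<Rightarrow> bool" where
  "weight w \<longleftrightarrow> w \<in> borel_measurable lebesgue \<and> (\<forall>x. 0 < w x)"

definition conj_exponent :: "real \<Rightarrow> real" where
  "conj_exponent p = p / (p - 1)"

(* Meant for 1 < p and 1 < q. A positive weight has a strictly positive integral over
   each interval, so a finite bound on the product forces both integrals to be finite.
   The Bochner integral of a non-integrable function is 0, so this finiteness has to be
   stated explicitly. *)
definition A_plus :: "real \<Rightarrow> real \<Rightarrow> (real \<Rightarrow> real) set" where
  "A_plus p q = {w. weight w \<and>
     (\<exists>C>0. \<forall>a. \<forall>h>0.
        set_integrable lebesgue {a-h..a} (\<lambda>x. w x powr q) \<and>
        set_integrable lebesgue {a..a+h} (\<lambda>x. w x powr (- conj_exponent p)) \<and>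
        (1/h * (LINT x:{a-h..a}|lebesgue. w x powr q)) powr (1/q) *
        (1/h * (LINT x:{a..a+h}|lebesgue. w x powr (- conj_exponent p))) powr (1 / conj_exponent p)
          \<le> C)}"

text \<open>The space \<open>L\<^sup>p(w\<^sup>p)\<close> of real functions (not identified up to null sets) and its norm.\<close>

definition Lp_weighted :: "real \<Rightarrow> (real \<Rightarrow> real) \<Rightarrow> (real \<Rightarrow> real) set" where
  "Lp_weighted p w = {f. f \<in> borel_measurable lebesgue \<and>
     integrable lebesgue (\<lambda>x. \<bar>f x\<bar> powr p * w x powr p)}"

definition Lp_weighted_norm :: "real \<Rightarrow> (real \<Rightarrow> real) \<Rightarrow> (real \<Rightarrow> real) \<Rightarrow> real" where
  "Lp_weighted_norm p w f = (LINT x|lebesgue. \<bar>f x\<bar> powr p * w x powr p) powr (1/p)"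

(* The "exists" predicates state absolute convergence of the defining integral. Where it
   fails, the corresponding operator takes the value 0 by the convention of the library. *)

definition frac_int_exists :: "real \<Rightarrow> (real \<Rightarrow> real) \<Rightarrow> real \<Rightarrow> bool" where
  "frac_int_exists \<alpha> f x \<longleftrightarrow>
     set_integrable lebesgue {x<..} (\<lambda>t. f t / (t - x) powr (1 - \<alpha>))"

definition frac_int :: "real \<Rightarrow> (real \<Rightarrow> real) \<Rightarrow> real \<Rightarrow> real" where
  "frac_int \<alpha> f x = 1 / Gamma \<alpha> * (LINT t:{x<..}|lebesgue. f t / (t - x) powr (1 - \<alpha>))"

definition trunc_frac_deriv_exists :: "real \<Rightarrow> real \<Rightarrow> (real \<Rightarrow> real) \<Rightarrow> real \<Rightarrow> bool" where
  "trunc_frac_deriv_exists \<alpha> \<epsilon> u x \<longleftrightarrow>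
     set_integrable lebesgue {x+\<epsilon><..} (\<lambda>t. (u t - u x) / (t - x) powr (1 + \<alpha>))"

definition trunc_frac_deriv :: "real \<Rightarrow> real \<Rightarrow> (real \<Rightarrow> real) \<Rightarrow> real \<Rightarrow> real" where
  "trunc_frac_deriv \<alpha> \<epsilon> u x =
     1 / Gamma (- \<alpha>) * (LINT t:{x+\<epsilon><..}|lebesgue. (u t - u x) / (t - x) powr (1 + \<alpha>))"

end

theory Submission
  imports Defs
begin

text \<open>
  Let \<open>W\<close> be the fractional integral and \<open>D\<^sub>\<epsilon>\<close> the truncated derivative. Fubini's theorem gives
  \<open>D\<^sub>\<epsilon>(W f)(x) = \<integral>\<^sub>0\<^sup>\<infinity> K\<^sub>\<epsilon>(s) f(x+s) ds\<close> with
  \<open>K\<^sub>\<epsilon>(s) = ((s/\<epsilon>)\<^sup>\<alpha> - (s/\<epsilon>-1)\<^sub>+\<^sup>\<alpha>) / (\<Gamma>(\<alpha>) \<Gamma>(1-\<alpha>) s)\<close>, a nonnegative kernel of integral 1 bounded by a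
  multiple of \<open>m(s/\<epsilon>)/\<epsilon>\<close>, where \<open>m(u) = min (u\<^sup>\<alpha>\<^sup>-\<^sup>1) (u\<^sup>\<alpha>\<^sup>-\<^sup>2)\<close> is decreasing and integrable on \<open>(0,\<infinity>)\<close>.
  Such a kernel is a superposition, with total weight \<open>O(1)\<close>, of averages over the shells \<open>l < s < 2l\<close>.
  The shell does not touch the base point, so a single average is bounded on \<open>L\<^sup>p(w\<^sup>p)\<close> uniformly in \<open>l\<close>
  by Hoelder's inequality, Tonelli's theorem and the one-sided \<open>A\<^sub>p\<^sup>+\<close> condition alone; no maximal
  function is needed. This gives the uniform bound in norm, hence norm convergence by density of
  bounded functions with bounded support. Pointwise convergence holds at right Lebesgue points.

  The integral defining \<open>W f\<close> converges near the base point by Tonelli's theorem; at infinity the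
  condition \<open>A\<^sub>p\<^sub>,\<^sub>q\<^sup>+\<close> bounds its \<open>k\<close>-th dyadic piece by a constant times
  \<open>V\<^sub>k powr (-1/q)\<close>, where \<open>V\<^sub>k\<close> is the integral of \<open>w\<^sup>q\<close> over \<open>[x, x + 2^k]\<close>; this
  decays geometrically because \<open>w\<^sup>q\<close> is one-sidedly doubling.
\<close>

text \<open>For averages over (x, x+l), Hoelder's inequality and Tonelli's theorem would pair the
  mass of w^p with the dual mass of w^(-p') over overlapping intervals, and about these a one-sided
  condition says nothing. The gap of length l between x and its shell makes the two intervals
  adjacent. The price is that a decreasing kernel has to be rebuilt from shells, which costs only a
  constant factor.

  The hypothesis is used in two strengths. Since p < q, Jensen's inequality weakens it to A_p^+,
  which governs the operators D_\<epsilon> W on L^p(w^p). The full strength, with the relation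
  between p, q and \<alpha>, is spent on the convergence of W f at infinity.

  Each of the two terms of K_\<epsilon> alone decays like s^(\<alpha>-1), which is not integrable at
  infinity; only their difference gains the missing power.

  Estimates are carried out in ennreal, where Hoelder and Tonelli carry no integrability conditions.
  The passage to Bochner integrals takes place at points where W|f| is finite, and this set of full
  measure does not depend on \<epsilon>.\<close>

section \<open>Powers of extended nonnegative reals and the inequality of Hoelder\<close>

text \<open>Meant for \<open>0 < r\<close>: the value at \<open>\<infinity>\<close> is \<open>\<infinity>\<close> and the value at \<open>0\<close> is \<open>0\<close> for every \<open>r\<close>.\<close>

definition epowr :: "ennreal \<Rightarrow> real \<Rightarrow> ennreal" where
  "epowr x r = (if x = top then top else ennreal (enn2real x powr r))"

lemma epowr_top [simp]: "epowr top r = top"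
  by (simp add: epowr_def)

lemma epowr_ennreal [simp]: "0 \<le> x \<Longrightarrow> epowr (ennreal x) r = ennreal (x powr r)"
  by (simp add: epowr_def)

lemma epowr_0 [simp]: "epowr 0 r = 0"
  by (simp add: epowr_def)

lemma epowr_one [simp]: "epowr 1 r = 1"
  using epowr_ennreal[of 1 r] by simp

lemma epowr_1 [simp]: "epowr x 1 = x"
  by (cases x rule: ennreal_cases) auto

lemma epowr_indicator: "epowr (indicator A x) s = indicator A x"
  by (auto simp: indicator_def epowr_def)

lemma epowr_eq_0_iff [simp]: "epowr x r = 0 \<longleftrightarrow> x = 0"
  by (cases x rule: ennreal_cases) (auto simp: ennreal_eq_0_iff)

lemma epowr_eq_top_iff [simp]: "epowr x r = top \<longleftrightarrow> x = top"
  by (simp add: epowr_def)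

lemma epowr_less_top_iff [simp]: "epowr x r < top \<longleftrightarrow> x < top"
  using epowr_eq_top_iff[of x r] by (simp add: less_top[symmetric] del: epowr_eq_top_iff)

lemma epowr_mono: "x \<le> y \<Longrightarrow> 0 \<le> r \<Longrightarrow> epowr x r \<le> epowr y r"
  by (cases x rule: ennreal_cases; cases y rule: ennreal_cases)
     (auto simp: top_unique intro!: ennreal_leI powr_mono2)

lemma epowr_mult: "0 < r \<Longrightarrow> epowr (x * y) r = epowr x r * epowr y r"
  by (cases x rule: ennreal_cases; cases y rule: ennreal_cases; cases "x = 0"; cases "y = 0")
     (auto simp: ennreal_mult[symmetric] powr_mult ennreal_mult_top ennreal_top_mult ennreal_eq_0_iff)

lemma epowr_epowr: "epowr (epowr x r) s = epowr x (r * s)"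
  by (cases x rule: ennreal_cases) (auto simp: powr_powr)

lemma epowr_measurable [measurable]:
  assumes [measurable]: "f \<in> borel_measurable M"
  shows "(\<lambda>x. epowr (f x) r) \<in> borel_measurable M"
  unfolding epowr_def by measurable

lemma epowr_le_D: "epowr x r \<le> epowr y r \<Longrightarrow> 0 < r \<Longrightarrow> x \<le> y"
  using epowr_mono[of "epowr x r" "epowr y r" "1/r"] by (simp add: epowr_epowr)

lemma ennreal_Young:
  fixes p :: real
  assumes p: "1 < p"
  shows "a * b \<le> ennreal (1/p) * epowr a p + ennreal (1 - 1/p) * epowr b (p/(p-1))"
proof (cases "a = 0 \<or> b = 0")
  case False
  show ?thesis
  proof (cases "a = top \<or> b = top")
    case True
    then have "ennreal (1/p) * epowr a p + ennreal (1 - 1/p) * epowr b (p/(p-1)) = top"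
      using p by (auto simp: ennreal_mult_top ennreal_eq_0_iff)
    then show ?thesis by (metis top_greatest)
  next
    case False
    then obtain x y where xy: "a = ennreal x" "b = ennreal y" "0 \<le> x" "0 \<le> y"
      by (cases a rule: ennreal_cases; cases b rule: ennreal_cases) auto
    have "x * y \<le> x powr p / p + y powr (p/(p-1)) / (p/(p-1))"
      using p xy by (intro Youngs_inequality) (auto simp: field_simps)
    also have "\<dots> = (1/p) * x powr p + (1 - 1/p) * y powr (p/(p-1))"
      using p by (simp add: field_simps)
    finally have "ennreal (x * y) \<le> ennreal ((1/p) * x powr p + (1 - 1/p) * y powr (p/(p-1)))"
      by (rule ennreal_leI)
    also have "\<dots> = ennreal (1/p) * ennreal (x powr p) + ennreal (1 - 1/p) * ennreal (y powr (p/(p-1)))"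
      using p by (subst ennreal_plus) (auto simp: ennreal_mult[symmetric])
    finally show ?thesis using p xy
      by (simp add: ennreal_mult)
  qed
qed auto

text \<open>After division by the two norms, Young's inequality bounds the integral by 1/p + (1 -
  1/p) = 1. Taking p-th powers leaves the first factor without a root. Since 0 * top = 0 in ennreal,
  a vanishing factor has to be treated before an infinite one.\<close>

lemma nn_integral_Hoelder:
  fixes p :: real
  assumes p: "1 < p" and [measurable]: "f \<in> borel_measurable M" "g \<in> borel_measurable M"
  shows "epowr (\<integral>\<^sup>+x. f x * g x \<partial>M) p
          \<le> (\<integral>\<^sup>+x. epowr (f x) p \<partial>M) * epowr (\<integral>\<^sup>+x. epowr (g x) (p/(p-1)) \<partial>M) (p-1)"
    (is "_ \<le> ?A * epowr ?B _")
proof -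
  consider "?A = 0" | "?B = 0" | "?A \<noteq> 0" "?B \<noteq> 0" "?A = top \<or> ?B = top"
    | "?A \<noteq> 0" "?B \<noteq> 0" "?A \<noteq> top" "?B \<noteq> top" by blast
  then show ?thesis
  proof cases
    case 1
    then have "AE x in M. f x = 0" by (subst (asm) nn_integral_0_iff_AE) auto
    then have "(\<integral>\<^sup>+x. f x * g x \<partial>M) = 0" by (subst nn_integral_0_iff_AE) auto
    then show ?thesis by simp
  next
    case 2
    then have "AE x in M. g x = 0" by (subst (asm) nn_integral_0_iff_AE) auto
    then have "(\<integral>\<^sup>+x. f x * g x \<partial>M) = 0" by (subst nn_integral_0_iff_AE) auto
    then show ?thesis by simp
  next
    case 3
    then have "?A * epowr ?B (p-1) = top"
      by (auto simp: ennreal_top_mult ennreal_mult_top)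
    then show ?thesis by simp
  next
    case 4
    obtain A where A: "?A = ennreal A" "0 < A"
      using 4 by (cases ?A rule: ennreal_cases) (auto simp: less_le)
    obtain B where B: "?B = ennreal B" "0 < B"
      using 4 by (cases ?B rule: ennreal_cases) (auto simp: less_le)
    \<comment> \<open>\<open>a\<close> and \<open>b\<close> are the norms of \<open>f\<close> and
      \<open>g\<close> in the two dual spaces, because 1 - 1/p is the reciprocal of p/(p-1).\<close>
    define a where "a = A powr (1/p)"
    define b where "b = B powr (1 - 1/p)"
    have ab: "0 < a" "0 < b" using A B by (auto simp: a_def b_def)
    have f': "epowr (f x / ennreal a) p = epowr (f x) p / ennreal A" for x
    proof -
      have "f x / ennreal a = f x * ennreal (1/a)"
        using ab by (simp add: divide_ennreal_def inverse_ennreal inverse_eq_divide)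
      then have "epowr (f x / ennreal a) p = epowr (f x) p * ennreal ((1/a) powr p)"
        using p ab by (simp add: epowr_mult)
      also have "(1/a) powr p = 1/A" using A p by (simp add: a_def powr_divide powr_powr)
      finally show ?thesis using A by (simp add: divide_ennreal_def inverse_ennreal inverse_eq_divide)
    qed
    have g': "epowr (g x / ennreal b) (p/(p-1)) = epowr (g x) (p/(p-1)) / ennreal B" for x
    proof -
      have "g x / ennreal b = g x * ennreal (1/b)"
        using ab by (simp add: divide_ennreal_def inverse_ennreal inverse_eq_divide)
      then have "epowr (g x / ennreal b) (p/(p-1)) = epowr (g x) (p/(p-1)) * ennreal ((1/b) powr (p/(p-1)))"
        using p ab by (simp add: epowr_mult)
      also have "(1/b) powr (p/(p-1)) = 1/B"
      proof -
        have "(1 - 1/p) * (p/(p-1)) = 1" using p by (simp add: field_simps)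
        then have "B powr ((1 - 1/p) * (p/(p-1))) = B" using B by (metis powr_one less_imp_le)
        then show ?thesis using B unfolding b_def by (simp only: powr_divide powr_powr powr_one_eq_one)
      qed
      finally show ?thesis using B by (simp add: divide_ennreal_def inverse_ennreal inverse_eq_divide)
    qed
    have "(\<integral>\<^sup>+x. f x * g x \<partial>M) = (\<integral>\<^sup>+x. ennreal (a*b) * ((f x / ennreal a) * (g x / ennreal b)) \<partial>M)"
    proof (intro nn_integral_cong)
      fix x
      have "ennreal a * (f x / ennreal a) = f x" "ennreal b * (g x / ennreal b) = g x"
        using ab by (simp_all add: ennreal_times_divide ennreal_mult_divide_eq mult.commute[of "ennreal _"])
      then have "f x * g x = (ennreal a * (f x / ennreal a)) * (ennreal b * (g x / ennreal b))"
        by simp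
      also have "\<dots> = ennreal (a*b) * ((f x / ennreal a) * (g x / ennreal b))"
        using ab by (simp add: ennreal_mult mult_ac)
      finally show "f x * g x = ennreal (a*b) * ((f x / ennreal a) * (g x / ennreal b))" .
    qed
    also have "\<dots> \<le> (\<integral>\<^sup>+x. ennreal (a*b) * (ennreal (1/p) * (epowr (f x) p / ennreal A)
                  + ennreal (1 - 1/p) * (epowr (g x) (p/(p-1)) / ennreal B)) \<partial>M)"
      using ennreal_Young[OF p] unfolding f'[symmetric] g'[symmetric]
      by (intro nn_integral_mono mult_left_mono) auto
    also have "\<dots> = ennreal (a*b) * (ennreal (1/p) * (?A / ennreal A) + ennreal (1 - 1/p) * (?B / ennreal B))"
      by (simp add: nn_integral_cmult nn_integral_add nn_integral_divide)
    also have "\<dots> = ennreal (a*b) * (ennreal (1/p) + ennreal (1 - 1/p))"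
      using A B by (simp add: divide_ennreal)
    also have "\<dots> = ennreal (a*b)"
      using p by (simp flip: ennreal_plus)
    finally have "epowr (\<integral>\<^sup>+x. f x * g x \<partial>M) p \<le> epowr (ennreal (a*b)) p"
      using p by (intro epowr_mono) auto
    also have "\<dots> = ennreal (A * B powr (p-1))"
    proof -
      have "(1 - 1/p) * p = p - 1" using p by (simp add: field_simps)
      then have "(a*b) powr p = A * B powr (p-1)"
        using A B p by (simp add: a_def b_def powr_mult powr_powr)
      then show ?thesis using ab by simp
    qed
    also have "\<dots> = ?A * epowr ?B (p-1)"
      using A B by (simp add: ennreal_mult)
    finally show ?thesis .
  qed
qed

section \<open>One-sided weights\<close>

text \<open>The constant \<open>D\<close> is the \<open>q\<close>-th power of the constant in the definition of \<open>A\<^sub>p\<^sub>,\<^sub>q\<^sup>+\<close>.\<close>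

locale one_sided_weight =
  fixes \<alpha> p q D :: real and w :: "real \<Rightarrow> real" and mass :: "real \<Rightarrow> real \<Rightarrow> real \<Rightarrow> ennreal"
  defines "mass s a b \<equiv> (\<integral>\<^sup>+x. ennreal (w x powr s) * indicator {a..b} x \<partial>lborel)"
  assumes alpha: "0 < \<alpha>" "\<alpha> < 1" and p: "1 < p" and q: "0 < q" "1/q = 1/p - \<alpha>" and D: "0 < D"
    and w_borel [measurable]: "w \<in> borel_measurable borel"
    and w_pos: "\<And>x. 0 < w x"
    and mass_q_finite: "\<And>a b. mass q a b < top"
    and mass_dual_finite: "\<And>a b. mass (- (p/(p-1))) a b < top"
    and Apq: "\<And>a h. 0 < h \<Longrightarrow>
      mass q (a-h) a * epowr (mass (- (p/(p-1))) a (a+h)) (q*(p-1)/p) \<le> ennreal (D * h powr (1 + q*(p-1)/p))"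
begin

lemma p_less_q: "p < q"
proof -
  have "1/q < 1/p" using q alpha by simp
  then show ?thesis using p q(1) by (simp add: field_simps)
qed

lemma w_nonzero [simp]: "w x \<noteq> 0"
  using w_pos[of x] by simp

lemma mass_pos: "a < b \<Longrightarrow> 0 < mass s a b"
proof -
  assume "a < b"
  have "mass s a b \<noteq> 0"
  proof
    assume "mass s a b = 0"
    then have "AE x in lborel. ennreal (w x powr s) * indicator {a..b} x = 0"
      unfolding mass_def by (subst (asm) nn_integral_0_iff_AE) auto
    then have "AE x in lborel. x \<notin> {a..b}"
      by eventually_elim (auto simp: indicator_def ennreal_eq_0_iff split: if_splits)
    then have "emeasure lborel {a..b} = 0"
      by (subst (asm) AE_iff_null_sets[symmetric]) auto
    with \<open>a < b\<close> show False by simp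
  qed
  then show ?thesis by (simp add: zero_less_iff_neq_zero)
qed

lemma mass_mono: "a' \<le> a \<Longrightarrow> b \<le> b' \<Longrightarrow> mass s a b \<le> mass s a' b'"
  unfolding mass_def by (intro nn_integral_mono) (auto simp: indicator_def)

lemma mass_add:
  assumes "a \<le> b" "b \<le> c"
  shows "mass s a c = mass s a b + mass s b c"
proof -
  have "mass s a b + mass s b c
      = (\<integral>\<^sup>+x. ennreal (w x powr s) * indicator {a..b} x + ennreal (w x powr s) * indicator {b..c} x \<partial>lborel)"
    unfolding mass_def by (rule nn_integral_add[symmetric]) auto
  also have "\<dots> = mass s a c"
    unfolding mass_def
  proof (rule nn_integral_cong_AE)
    show "AE x in lborel. ennreal (w x powr s) * indicator {a..b} x + ennreal (w x powr s) * indicator {b..c} x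
        = ennreal (w x powr s) * indicator {a..c} x"
      using AE_lborel_singleton[of b] by eventually_elim (use assms in \<open>auto simp: indicator_def\<close>)
  qed
  finally show ?thesis ..
qed

text \<open>Hoelder's inequality with exponent q/p > 1; the second factor is the constant 1 on the
  interval, which produces the power of the length. It is used to pass from w^q to w^p.\<close>

lemma mass_Jensen:
  assumes "a \<le> b"
  shows "epowr (mass p a b) (q/p) \<le> mass q a b * ennreal ((b-a) powr (q/p-1))"
proof -
  have s: "1 < q/p" using p p_less_q by simp
  have "epowr (mass p a b) (q/p) = epowr (\<integral>\<^sup>+x. (ennreal (w x powr p) * indicator {a..b} x) * indicator {a..b} x \<partial>lborel) (q/p)"
    unfolding mass_def by (intro arg_cong2[where f=epowr] nn_integral_cong) (auto simp: indicator_def)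
  also have "\<dots> \<le> (\<integral>\<^sup>+x. epowr (ennreal (w x powr p) * indicator {a..b} x) (q/p) \<partial>lborel) *
       epowr (\<integral>\<^sup>+x. epowr (indicator {a..b} x) (q/p/(q/p-1)) \<partial>lborel) (q/p-1)"
    by (rule nn_integral_Hoelder[OF s]) auto
  also have "(\<integral>\<^sup>+x. epowr (ennreal (w x powr p) * indicator {a..b} x) (q/p) \<partial>lborel) = mass q a b"
    unfolding mass_def using p s
    by (intro nn_integral_cong) (auto simp: indicator_def powr_powr)
  also have "epowr (\<integral>\<^sup>+x. epowr (indicator {a..b} x) (q/p/(q/p-1)) \<partial>lborel) (q/p-1) = ennreal ((b-a) powr (q/p-1))"
    using assms by (simp add: epowr_indicator)
  finally show ?thesis .
qed

text \<open>Both sides are raised to the power q/p. Then \<open>mass_Jensen\<close> replaces w^p by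
  w^q at the price of h^(q/p-1), and \<open>Apq\<close> bounds the rest. The powers of h add up to q
  = p * (q/p).\<close>

lemma Ap:
  assumes h: "0 < h"
  shows "mass p (a-h) a * epowr (mass (- (p/(p-1))) a (a+h)) (p-1) \<le> ennreal (D powr (p/q) * h powr p)"
proof (rule epowr_le_D)
  show s: "0 < q/p" using p q by simp
  have e: "(p-1) * (q/p) = q*(p-1)/p" by simp
  have "epowr (mass p (a-h) a * epowr (mass (- (p/(p-1))) a (a+h)) (p-1)) (q/p)
      = epowr (mass p (a-h) a) (q/p) * epowr (mass (- (p/(p-1))) a (a+h)) (q*(p-1)/p)"
    using s by (simp only: epowr_mult epowr_epowr e)
  also have "\<dots> \<le> (mass q (a-h) a * ennreal (h powr (q/p-1))) * epowr (mass (- (p/(p-1))) a (a+h)) (q*(p-1)/p)"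
    using mass_Jensen[of "a-h" a] h by (intro mult_right_mono) auto
  also have "\<dots> = ennreal (h powr (q/p-1)) * (mass q (a-h) a * epowr (mass (- (p/(p-1))) a (a+h)) (q*(p-1)/p))"
    by (simp add: mult_ac)
  also have "\<dots> \<le> ennreal (h powr (q/p-1)) * ennreal (D * h powr (1 + q*(p-1)/p))"
    by (intro mult_left_mono Apq h) auto
  also have "\<dots> = ennreal ((D powr (p/q) * h powr p) powr (q/p))"
  proof -
    have "q/p-1 + (1 + q*(p-1)/p) = p * (q/p)" using p by (simp add: field_simps)
    then have "h powr (q/p-1) * h powr (1 + q*(p-1)/p) = h powr (p * (q/p))"
      by (simp only: powr_add[symmetric])
    moreover have "(D powr (p/q) * h powr p) powr (q/p) = D * h powr (p * (q/p))"
      using D p q h by (simp add: powr_mult powr_powr)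
    ultimately show ?thesis using D by (simp add: ennreal_mult[symmetric] mult_ac)
  qed
  finally show "epowr (mass p (a-h) a * epowr (mass (- (p/(p-1))) a (a+h)) (p-1)) (q/p)
      \<le> epowr (ennreal (D powr (p/q) * h powr p)) (q/p)"
    using D h by simp
qed

text \<open>With \<open>r = 1 + q(p-1)/p\<close> the hypothesis says that \<open>w\<^sup>q\<close> belongs to \<open>A\<^sub>r\<^sup>+\<close>.\<close>

lemma mass_doubling:
  assumes h: "0 < h"
  shows "mass q (a-h) a \<le> ennreal D * mass q a (a+h)"
proof -
  define r where "r = 1 + q*(p-1)/p"
  have r: "1 < r" using p q by (simp add: r_def)
  have rp: "q / (r - 1) = p/(p-1)" using p q by (simp add: r_def)
  let ?S = "mass (- (p/(p-1))) a (a+h)"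
  have "ennreal (h powr r) = epowr (\<integral>\<^sup>+x. indicator {a..a+h} x \<partial>lborel) r"
    using h by simp
  \<comment> \<open>Hoelder's inequality with exponents r and r/(r-1) for 1 = w^(q/r) * w^(-q/r); by
    \<open>rp\<close> the second factor is the dual mass.\<close>
  also have "(\<integral>\<^sup>+x. indicator {a..a+h} x \<partial>lborel)
    = (\<integral>\<^sup>+x. (ennreal (w x powr (q/r)) * indicator {a..a+h} x) * (ennreal (w x powr (-(q/r))) * indicator {a..a+h} x) \<partial>lborel)"
    by (intro nn_integral_cong)
       (auto simp: indicator_def ennreal_mult[symmetric] powr_add[symmetric])
  also have "epowr \<dots> r \<le> (\<integral>\<^sup>+x. epowr (ennreal (w x powr (q/r)) * indicator {a..a+h} x) r \<partial>lborel) *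
      epowr (\<integral>\<^sup>+x. epowr (ennreal (w x powr (-(q/r))) * indicator {a..a+h} x) (r/(r-1)) \<partial>lborel) (r-1)"
    by (rule nn_integral_Hoelder[OF r]) auto
  also have "(\<integral>\<^sup>+x. epowr (ennreal (w x powr (q/r)) * indicator {a..a+h} x) r \<partial>lborel) = mass q a (a+h)"
    unfolding mass_def using r
    by (intro nn_integral_cong) (auto simp: indicator_def powr_powr)
  also have "(\<integral>\<^sup>+x. epowr (ennreal (w x powr (-(q/r))) * indicator {a..a+h} x) (r/(r-1)) \<partial>lborel) = ?S"
    unfolding mass_def rp[symmetric] using r
    by (intro nn_integral_cong) (auto simp: indicator_def powr_powr)
  finally have H: "ennreal (h powr r) \<le> mass q a (a+h) * epowr ?S (r-1)" .
  \<comment> \<open>The dual mass is carried along until \<open>Apq\<close> absorbs it; only the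
    positive real number \<open>h powr r\<close> is cancelled.\<close>
  have "mass q (a-h) a * ennreal (h powr r) \<le> mass q (a-h) a * (mass q a (a+h) * epowr ?S (r-1))"
    by (intro mult_left_mono H) auto
  also have "\<dots> = mass q a (a+h) * (mass q (a-h) a * epowr ?S (q*(p-1)/p))"
    by (simp add: mult_ac r_def)
  also have "\<dots> \<le> mass q a (a+h) * ennreal (D * h powr r)"
    unfolding r_def by (intro mult_left_mono Apq h) auto
  also have "\<dots> = (ennreal D * mass q a (a+h)) * ennreal (h powr r)"
    using D by (simp add: ennreal_mult mult_ac)
  finally have "ennreal (h powr r) * mass q (a-h) a \<le> ennreal (h powr r) * (ennreal D * mass q a (a+h))"
    by (simp only: mult.commute)
  moreover have "ennreal (h powr r) \<noteq> 0" "ennreal (h powr r) < top"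
    using h by (auto simp: ennreal_eq_0_iff)
  ultimately show ?thesis
    by (metis ennreal_mult_le_mult_iff less_top)
qed

text \<open>By \<open>mass_doubling\<close> at x + 2^k, the right half of [x, x + 2^(k+1)] carries
  at least 1/D of the mass of the left half. So each doubling of the length multiplies the mass by
  at least 1 + 1/D.\<close>

lemma mass_growth: "ennreal ((1 + 1/D)^k) * mass q x (x+1) \<le> mass q x (x+2^k)"
proof (induction k)
  case 0
  then show ?case by simp
next
  case (Suc k)
  let ?V = "mass q x (x+2^k)"
  have "?V \<le> ennreal D * mass q (x+2^k) (x+2^Suc k)"
    using mass_doubling[of "2^k" "x+2^k"] by (simp add: add.assoc)
  then have "ennreal (1/D) * ?V \<le> ennreal (1/D) * (ennreal D * mass q (x+2^k) (x+2^Suc k))"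
    by (rule mult_left_mono) auto
  also have "\<dots> = mass q (x+2^k) (x+2^Suc k)"
    using D by (simp add: mult.assoc[symmetric] ennreal_mult[symmetric])
  finally have *: "ennreal (1/D) * ?V \<le> mass q (x+2^k) (x+2^Suc k)" .
  have "ennreal ((1 + 1/D)^Suc k) * mass q x (x+1) = ennreal (1 + 1/D) * (ennreal ((1 + 1/D)^k) * mass q x (x+1))"
    using D by (simp add: ennreal_mult mult_ac)
  also have "\<dots> \<le> ennreal (1 + 1/D) * ?V"
    by (intro mult_left_mono Suc.IH) auto
  also have "\<dots> = ?V + ennreal (1/D) * ?V"
    using D by (simp add: distrib_right)
  also have "\<dots> \<le> ?V + mass q (x+2^k) (x+2^Suc k)"
    by (intro add_left_mono *)
  also have "\<dots> = mass q x (x+2^Suc k)"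
    by (rule mass_add[symmetric]) auto
  finally show ?case .
qed

text \<open>This is \<open>Apq\<close> at x+h, raised to the power 1/q. The exponent of h becomes
  1/q + 1 - 1/p = 1 - \<alpha>, which is opposite to that of the kernel s^(\<alpha>-1) of the
  fractional integral on the shell [h, 2h].\<close>

lemma dual_mass_bound:
  assumes h: "0 < h"
  shows "epowr (mass (- (p/(p-1))) (x+h) (x+h+h)) ((p-1)/p) * epowr (mass q x (x+h)) (1/q)
      \<le> ennreal (D powr (1/q) * h powr (1-\<alpha>))"
proof -
  have e: "q*(p-1)/p * (1/q) = (p-1)/p" using q(1) by simp
  have "mass q x (x+h) * epowr (mass (- (p/(p-1))) (x+h) (x+h+h)) (q*(p-1)/p)
      \<le> ennreal (D * h powr (1 + q*(p-1)/p))"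
    using Apq[OF h, of "x+h"] by simp
  then have "epowr (mass q x (x+h) * epowr (mass (- (p/(p-1))) (x+h) (x+h+h)) (q*(p-1)/p)) (1/q)
     \<le> epowr (ennreal (D * h powr (1 + q*(p-1)/p))) (1/q)"
    using q(1) by (intro epowr_mono) auto
  also have "\<dots> = ennreal (D powr (1/q) * h powr (1-\<alpha>))"
  proof -
    have "(1 + q*(p-1)/p) * (1/q) = 1/q + (p-1)/p" using q(1) by (simp add: add_divide_distrib)
    also have "\<dots> = 1 - \<alpha>" using q p by (simp add: diff_divide_distrib)
    finally have "(1 + q*(p-1)/p) * (1/q) = 1 - \<alpha>" .
    then show ?thesis using D h by (simp add: powr_mult powr_powr)
  qed
  also have "epowr (mass q x (x+h) * epowr (mass (- (p/(p-1))) (x+h) (x+h+h)) (q*(p-1)/p)) (1/q)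
     = epowr (mass q x (x+h)) (1/q) * epowr (mass (- (p/(p-1))) (x+h) (x+h+h)) ((p-1)/p)"
    using q(1) by (simp only: epowr_mult epowr_epowr e zero_less_divide_1_iff)
  finally show ?thesis
    by (simp only: mult.commute)
qed

end

section \<open>Averages over dyadic shells\<close>

definition shell_avg :: "(real \<Rightarrow> ennreal) \<Rightarrow> real \<Rightarrow> real \<Rightarrow> ennreal" where
  "shell_avg g l x = ennreal (1/l) * (\<integral>\<^sup>+s. (if l < s \<and> s < 2*l then g (x+s) else 0) \<partial>lborel)"

lemma shell_avg_measurable [measurable]:
  assumes [measurable]: "g \<in> borel_measurable borel" "f \<in> borel_measurable M" "h \<in> borel_measurable M"
  shows "(\<lambda>z. shell_avg g (f z) (h z)) \<in> borel_measurable M"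
  unfolding shell_avg_def by measurable

lemma nn_integral_shift:
  fixes x :: real
  assumes "f \<in> borel_measurable borel"
  shows "(\<integral>\<^sup>+s. f (x+s) \<partial>lborel) = (\<integral>\<^sup>+y. f y \<partial>lborel)"
  using nn_integral_real_affine[OF assms, of 1 x] by simp

context one_sided_weight
begin

text \<open>The \<open>p\<close>-th power of the norm of \<open>L\<^sup>p(w\<^sup>p)\<close>.\<close>

definition wnorm :: "(real \<Rightarrow> ennreal) \<Rightarrow> ennreal" where
  "wnorm g = (\<integral>\<^sup>+x. epowr (g x) p * ennreal (w x powr p) \<partial>lborel)"

lemma mass_eq_if: "mass s a b = (\<integral>\<^sup>+x. (if a \<le> x \<and> x \<le> b then ennreal (w x powr s) else 0) \<partial>lborel)"
  unfolding mass_def by (intro nn_integral_cong) (auto simp: indicator_def)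

text \<open>For intervals that move with the variable of integration, such as the one in the factor
  \<open>S\<close> of \<open>shell_avg_bound\<close>.\<close>

lemma mass_measurable [measurable]:
  assumes [measurable]: "f \<in> borel_measurable M" "g \<in> borel_measurable M"
  shows "(\<lambda>z. mass s (f z) (g z)) \<in> borel_measurable M"
  unfolding mass_eq_if by measurable

text \<open>Hoelder's inequality for the factorization g = (g * w) * (1/w); the second factor
  produces the exponent -p/(p-1) of the dual mass.\<close>

lemma interval_Hoelder:
  assumes [measurable]: "g \<in> borel_measurable borel"
  shows "epowr (\<integral>\<^sup>+y. (if a < y \<and> y < b then g y else 0) \<partial>lborel) p
    \<le> (\<integral>\<^sup>+y. (if a < y \<and> y < b then epowr (g y) p * ennreal (w y powr p) else 0) \<partial>lborel)
      * epowr (mass (- (p/(p-1))) a b) (p-1)"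
proof -
  have w1: "ennreal (w y) * ennreal (1 / w y) = 1" for y
    using w_pos[of y] by (simp add: ennreal_mult[symmetric])
  have "epowr (\<integral>\<^sup>+y. (if a < y \<and> y < b then g y else 0) \<partial>lborel) p
      = epowr (\<integral>\<^sup>+y. (if a < y \<and> y < b then g y * ennreal (w y) else 0) * (if a < y \<and> y < b then ennreal (1 / w y) else 0) \<partial>lborel) p"
    by (intro arg_cong2[where f=epowr] nn_integral_cong) (auto simp: mult.assoc w1)
  also have "\<dots> \<le> (\<integral>\<^sup>+y. epowr (if a < y \<and> y < b then g y * ennreal (w y) else 0) p \<partial>lborel) *
      epowr (\<integral>\<^sup>+y. epowr (if a < y \<and> y < b then ennreal (1 / w y) else 0) (p/(p-1)) \<partial>lborel) (p-1)"
    by (rule nn_integral_Hoelder[OF p]) auto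
  also have "\<dots> \<le> (\<integral>\<^sup>+y. epowr (if a < y \<and> y < b then g y * ennreal (w y) else 0) p \<partial>lborel)
      * epowr (mass (- (p/(p-1))) a b) (p-1)"
  proof (intro mult_left_mono epowr_mono)
    show "(\<integral>\<^sup>+y. epowr (if a < y \<and> y < b then ennreal (1 / w y) else 0) (p/(p-1)) \<partial>lborel)
      \<le> mass (- (p/(p-1))) a b"
      unfolding mass_eq_if using less_imp_le[OF w_pos]
      by (intro nn_integral_mono) (auto simp: powr_divide powr_minus inverse_eq_divide)
  qed (use p in auto)
  also have "(\<integral>\<^sup>+y. epowr (if a < y \<and> y < b then g y * ennreal (w y) else 0) p \<partial>lborel)
      = (\<integral>\<^sup>+y. (if a < y \<and> y < b then epowr (g y) p * ennreal (w y powr p) else 0) \<partial>lborel)"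
    using p less_imp_le[OF w_pos] by (intro nn_integral_cong) (auto simp: epowr_mult)
  finally show ?thesis .
qed

text \<open>
  After interchanging the integrals, \<open>x\<close> runs through \<open>(y-2l, y-l)\<close> and \<open>(x+l, x+2l)\<close> is contained in
  \<open>(y-l, y+l)\<close>: these two intervals meet at \<open>y-l\<close>, where the \<open>A\<^sub>p\<^sup>+\<close> condition applies.
\<close>

lemma shell_avg_bound:
  assumes l: "0 < l" and [measurable]: "g \<in> borel_measurable borel"
  shows "wnorm (shell_avg g l) \<le> ennreal (2 powr p * D powr (p/q)) * wnorm g"
proof -
  define G where "G y = epowr (g y) p * ennreal (w y powr p)" for y
  \<comment> \<open>The interval (x+l, x+2l) is replaced by one that depends on y alone and contains
    it for every x that sees y. Thus \<open>S y\<close> leaves the integral over x after the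
    interchange.\<close>
  define S where "S y = epowr (mass (- (p/(p-1))) (y-l) (y+l)) (p-1)" for y
  have [measurable]: "G \<in> borel_measurable borel" "S \<in> borel_measurable borel"
    unfolding G_def S_def by measurable
  have pw: "epowr (shell_avg g l x) p
     \<le> ennreal (1 / l powr p) * (\<integral>\<^sup>+y. (if x+l < y \<and> y < x+2*l then G y * S y else 0) \<partial>lborel)" for x
  proof -
    have "(\<integral>\<^sup>+s. (if l < s \<and> s < 2*l then g (x+s) else 0) \<partial>lborel)
      = (\<integral>\<^sup>+y. (if x+l < y \<and> y < x+2*l then g y else 0) \<partial>lborel)"
      by (subst nn_integral_shift[of "\<lambda>y. if x+l < y \<and> y < x+2*l then g y else 0" x, symmetric]) auto
    then have "epowr (shell_avg g l x) p
      = ennreal (1 / l powr p) * epowr (\<integral>\<^sup>+y. (if x+l < y \<and> y < x+2*l then g y else 0) \<partial>lborel) p"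
      using p l by (simp add: shell_avg_def epowr_mult powr_divide)
    also have "\<dots> \<le> ennreal (1 / l powr p) * ((\<integral>\<^sup>+y. (if x+l < y \<and> y < x+2*l then G y else 0) \<partial>lborel)
      * epowr (mass (- (p/(p-1))) (x+l) (x+2*l)) (p-1))"
      unfolding G_def by (intro mult_left_mono interval_Hoelder) auto
    also have "(\<integral>\<^sup>+y. (if x+l < y \<and> y < x+2*l then G y else 0) \<partial>lborel) * epowr (mass (- (p/(p-1))) (x+l) (x+2*l)) (p-1)
      = (\<integral>\<^sup>+y. (if x+l < y \<and> y < x+2*l then G y else 0) * epowr (mass (- (p/(p-1))) (x+l) (x+2*l)) (p-1) \<partial>lborel)"
      by (rule nn_integral_multc[symmetric]) auto
    also have "\<dots> \<le> (\<integral>\<^sup>+y. (if x+l < y \<and> y < x+2*l then G y * S y else 0) \<partial>lborel)"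
      unfolding S_def using p
      by (intro nn_integral_mono) (auto intro!: mult_left_mono epowr_mono mass_mono)
    finally show ?thesis by (simp add: mult_left_mono)
  qed
  have inner: "(\<integral>\<^sup>+x. (if x+l < y \<and> y < x+2*l then G y * S y * ennreal (w x powr p) else 0) \<partial>lborel)
     \<le> G y * ennreal (D powr (p/q) * (2*l) powr p)" for y
  proof -
    \<comment> \<open>The range (y-2l, y-l) of x is enlarged to [y-3l, y-l], so that both intervals
      at y-l have the same length 2l, as \<open>Ap\<close> requires. This gives the factor 2 powr
      p.\<close>
    have "(\<integral>\<^sup>+x. (if x+l < y \<and> y < x+2*l then G y * S y * ennreal (w x powr p) else 0) \<partial>lborel)
      \<le> (\<integral>\<^sup>+x. (G y * S y) * (if (y-l)-2*l \<le> x \<and> x \<le> y-l then ennreal (w x powr p) else 0) \<partial>lborel)"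
      by (intro nn_integral_mono) auto
    also have "\<dots> = (G y * S y) * mass p ((y-l)-2*l) (y-l)"
      unfolding mass_eq_if by (rule nn_integral_cmult) auto
    also have "\<dots> = G y * (mass p ((y-l)-2*l) (y-l) * epowr (mass (- (p/(p-1))) (y-l) ((y-l)+2*l)) (p-1))"
      by (simp add: S_def mult_ac add.commute)
    also have "\<dots> \<le> G y * ennreal (D powr (p/q) * (2*l) powr p)"
      using l by (intro mult_left_mono Ap) auto
    finally show ?thesis .
  qed
  have "wnorm (shell_avg g l)
     \<le> (\<integral>\<^sup>+x. (ennreal (1 / l powr p) * (\<integral>\<^sup>+y. (if x+l < y \<and> y < x+2*l then G y * S y else 0) \<partial>lborel)) * ennreal (w x powr p) \<partial>lborel)"
    unfolding wnorm_def by (intro nn_integral_mono mult_right_mono pw) auto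
  also have "\<dots> = ennreal (1 / l powr p) * (\<integral>\<^sup>+x. (\<integral>\<^sup>+y. (if x+l < y \<and> y < x+2*l then G y * S y * ennreal (w x powr p) else 0) \<partial>lborel) \<partial>lborel)"
  proof -
    have "(\<integral>\<^sup>+y. (if x+l < y \<and> y < x+2*l then G y * S y * ennreal (w x powr p) else 0) \<partial>lborel)
      = (\<integral>\<^sup>+y. (if x+l < y \<and> y < x+2*l then G y * S y else 0) \<partial>lborel) * ennreal (w x powr p)" for x
      by (subst nn_integral_multc[symmetric]) (auto intro!: nn_integral_cong)
    then show ?thesis
      by (subst nn_integral_cmult[symmetric]) (auto simp: mult.assoc)
  qed
  also have "(\<integral>\<^sup>+x. (\<integral>\<^sup>+y. (if x+l < y \<and> y < x+2*l then G y * S y * ennreal (w x powr p) else 0) \<partial>lborel) \<partial>lborel)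
     = (\<integral>\<^sup>+y. (\<integral>\<^sup>+x. (if x+l < y \<and> y < x+2*l then G y * S y * ennreal (w x powr p) else 0) \<partial>lborel) \<partial>lborel)"
    by (rule lborel_pair.Fubini') measurable
  also have "\<dots> \<le> (\<integral>\<^sup>+y. G y * ennreal (D powr (p/q) * (2*l) powr p) \<partial>lborel)"
    by (intro nn_integral_mono inner)
  also have "\<dots> = wnorm g * ennreal (D powr (p/q) * (2*l) powr p)"
    unfolding wnorm_def G_def[symmetric] by (rule nn_integral_multc) auto
  also have "ennreal (1 / l powr p) * (wnorm g * ennreal (D powr (p/q) * (2*l) powr p))
     = ennreal (2 powr p * D powr (p/q)) * wnorm g"
  proof -
    have "1 / l powr p * (D powr (p/q) * (2*l) powr p) = 2 powr p * D powr (p/q)"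
      using l by (simp add: powr_mult)
    then have "ennreal (1 / l powr p) * ennreal (D powr (p/q) * (2*l) powr p) = ennreal (2 powr p * D powr (p/q))"
      using l by (subst ennreal_mult[symmetric]) auto
    then show ?thesis
      by (metis mult.assoc mult.commute)
  qed
  finally show ?thesis by (simp add: mult_left_mono)
qed

end

section \<open>The majorant of the approximate identity\<close>

context one_sided_weight
begin

definition major :: "real \<Rightarrow> real" where
  "major u = (if 0 < u then min (u powr (\<alpha>-1)) (u powr (\<alpha>-2)) else 0)"

text \<open>The integral of \<open>major\<close>: 1/\<alpha> comes from (0,1) and 1/(1-\<alpha>)
  from (1,\<infinity>).\<close>

definition major_mass :: real where
  "major_mass = 1/\<alpha> + 1/(1-\<alpha>)"

definition major_avg :: "(real \<Rightarrow> ennreal) \<Rightarrow> real \<Rightarrow> real \<Rightarrow> ennreal" where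
  "major_avg g e x = (\<integral>\<^sup>+s. ennreal (major (s/e) / e) * g (x+s) \<partial>lborel)"

lemma major_measurable [measurable]: "major \<in> borel_measurable borel"
  unfolding major_def by measurable

lemma major_nonneg [simp]: "0 \<le> major u"
  by (simp add: major_def)

lemma major_mass_pos: "0 < major_mass"
  using alpha by (simp add: major_mass_def add_pos_pos)

lemma major_avg_measurable [measurable]:
  assumes [measurable]: "g \<in> borel_measurable borel"
  shows "major_avg g e \<in> borel_measurable borel"
  unfolding major_avg_def by measurable

lemma major_antimono: "0 < u \<Longrightarrow> u \<le> v \<Longrightarrow> major v \<le> major u"
  using alpha powr_mono2'[of "\<alpha>-1" u v] powr_mono2'[of "\<alpha>-2" u v]
  by (auto simp: major_def min_le_iff_disj)

lemma nn_integral_major: "(\<integral>\<^sup>+u. ennreal (major u) \<partial>lborel) = ennreal major_mass"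
proof -
  have 1: "(\<integral>\<^sup>+u. ennreal (u powr (\<alpha>-1)) * indicator {0..1} u \<partial>lborel) = ennreal (1/\<alpha>)"
    using nn_integral_has_integral_lebesgue'[OF _ has_integral_powr_from_0[of "\<alpha>-1" 1]] alpha by simp
  have 2: "(\<integral>\<^sup>+u. ennreal (u powr (\<alpha>-2)) * indicator {1..} u \<partial>lborel) = ennreal (1/(1-\<alpha>))"
  proof -
    have "-(1 powr (\<alpha>-2+1)) / (\<alpha>-2+1) = 1/(1-\<alpha>)"
      using alpha by (simp add: field_simps)
    then show ?thesis
      using nn_integral_has_integral_lebesgue'[OF _ has_integral_powr_to_inf[of "\<alpha>-2" 1]] alpha by simp
  qed
  have "(\<integral>\<^sup>+u. ennreal (major u) \<partial>lborel)
    = (\<integral>\<^sup>+u. ennreal (u powr (\<alpha>-1)) * indicator {0..1} u + ennreal (u powr (\<alpha>-2)) * indicator {1..} u \<partial>lborel)"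
  proof (rule nn_integral_cong_AE)
    show "AE u in lborel. ennreal (major u)
      = ennreal (u powr (\<alpha>-1)) * indicator {0..1} u + ennreal (u powr (\<alpha>-2)) * indicator {1..} u"
      using AE_lborel_singleton[of 0] AE_lborel_singleton[of 1]
    proof eventually_elim
      case (elim u)
      have "u powr (\<alpha>-1) \<le> u powr (\<alpha>-2)" if "0 < u" "u < 1"
        using that by (intro powr_mono') auto
      moreover have "u powr (\<alpha>-2) \<le> u powr (\<alpha>-1)" if "1 < u"
        using that by (intro powr_mono) auto
      ultimately show ?case
        using elim by (auto simp: major_def indicator_def min_def)
    qed
  qed
  also have "\<dots> = ennreal (1/\<alpha>) + ennreal (1/(1-\<alpha>))"
    by (subst nn_integral_add) (auto simp: 1 2)
  also have "\<dots> = ennreal major_mass"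
    using alpha by (simp add: major_mass_def ennreal_plus[symmetric] del: ennreal_plus)
  finally show ?thesis .
qed

text \<open>For fixed s > 0 the shells of radius t*e that contain s are those with t in (s/(2e),
  s/e), an interval of length s/(2e). There \<open>major t\<close> is at least
  \<open>major (s/e)\<close> and 1/(t*e) is at least 1/s, so the integral over t recovers at least
  half of \<open>major (s/e) / e\<close>.\<close>

lemma major_avg_le_shell_avg:
  assumes e: "0 < e" and [measurable]: "g \<in> borel_measurable borel"
  shows "major_avg g e x \<le> 2 * (\<integral>\<^sup>+t. ennreal (major t) * shell_avg g (t*e) x \<partial>lborel)"
proof -
  have inner: "ennreal (major (s/e) / (2*e)) * g (x+s)
     \<le> (\<integral>\<^sup>+t. (if t*e < s \<and> s < 2*(t*e) then ennreal (major t) * ennreal (1/(t*e)) * g (x+s) else 0) \<partial>lborel)" for s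
  proof (cases "0 < s")
    case True
    have "ennreal (major (s/e) / (2*e)) * g (x+s)
       = (\<integral>\<^sup>+t. (ennreal (major (s/e) / s) * g (x+s)) * indicator {s/(2*e)<..<s/e} t \<partial>lborel)"
    proof -
      have "s/(2*e) \<le> s/e" using True e by (simp add: field_simps)
      then have "(\<integral>\<^sup>+t. (ennreal (major (s/e) / s) * g (x+s)) * indicator {s/(2*e)<..<s/e} t \<partial>lborel)
          = (ennreal (major (s/e) / s) * g (x+s)) * ennreal (s/e - s/(2*e))"
        by (subst nn_integral_cmult_indicator) auto
      also have "\<dots> = (ennreal (major (s/e) / s) * ennreal (s/e - s/(2*e))) * g (x+s)"
        by (simp add: mult_ac)
      also have "ennreal (major (s/e) / s) * ennreal (s/e - s/(2*e)) = ennreal (major (s/e) / (2*e))"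
        using True e \<open>s/(2*e) \<le> s/e\<close> by (subst ennreal_mult[symmetric]) (auto simp: field_simps)
      finally show ?thesis by simp
    qed
    also have "\<dots> \<le> (\<integral>\<^sup>+t. (if t*e < s \<and> s < 2*(t*e) then ennreal (major t) * ennreal (1/(t*e)) * g (x+s) else 0) \<partial>lborel)"
    proof (rule nn_integral_mono)
      fix t
      show "(ennreal (major (s/e) / s) * g (x+s)) * indicator {s/(2*e)<..<s/e} t
         \<le> (if t*e < s \<and> s < 2*(t*e) then ennreal (major t) * ennreal (1/(t*e)) * g (x+s) else 0)"
      proof (cases "t \<in> {s/(2*e)<..<s/e}")
        case t: True
        then have "t*e < s" "s < 2*(t*e)"
          using e by (auto simp: field_simps)
        moreover have "0 < s/(2*e)" using True e by simp
        then have "0 < t" "t \<le> s/e" using t by auto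
        ultimately have t': "t*e < s" "s < 2*(t*e)" "0 < t" "t \<le> s/e" by auto
        have "major (s/e) / s \<le> major t * (1/(t*e))"
          using t' True e major_antimono[of t "s/e"]
          by (simp add: divide_inverse) (intro mult_mono, auto simp: field_simps)
        then have "ennreal (major (s/e) / s) \<le> ennreal (major t) * ennreal (1/(t*e))"
          using t' e by (simp add: ennreal_mult[symmetric] ennreal_leI)
        then show ?thesis using t t' by (auto intro: mult_right_mono)
      qed auto
    qed
    finally show ?thesis .
  next
    case False
    then have "major (s/e) = 0" using e by (auto simp: major_def zero_less_divide_iff)
    then show ?thesis by simp
  qed
  have "major_avg g e x = (\<integral>\<^sup>+s. 2 * (ennreal (major (s/e) / (2*e)) * g (x+s)) \<partial>lborel)"
    unfolding major_avg_def
  proof (intro nn_integral_cong)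
    fix s
    have "ennreal (major (s/e) / e) = 2 * ennreal (major (s/e) / (2*e))"
      using e by (subst ennreal_numeral[symmetric], subst ennreal_mult[symmetric]) auto
    then show "ennreal (major (s/e) / e) * g (x+s) = 2 * (ennreal (major (s/e) / (2*e)) * g (x+s))"
      by (simp add: mult.assoc)
  qed
  also have "\<dots> = 2 * (\<integral>\<^sup>+s. ennreal (major (s/e) / (2*e)) * g (x+s) \<partial>lborel)"
    by (rule nn_integral_cmult) auto
  also have "\<dots> \<le> 2 * (\<integral>\<^sup>+s. (\<integral>\<^sup>+t. (if t*e < s \<and> s < 2*(t*e) then ennreal (major t) * ennreal (1/(t*e)) * g (x+s) else 0) \<partial>lborel) \<partial>lborel)"
    by (intro mult_left_mono nn_integral_mono inner) auto
  also have "(\<integral>\<^sup>+s. (\<integral>\<^sup>+t. (if t*e < s \<and> s < 2*(t*e) then ennreal (major t) * ennreal (1/(t*e)) * g (x+s) else 0) \<partial>lborel) \<partial>lborel)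
    = (\<integral>\<^sup>+t. (\<integral>\<^sup>+s. (if t*e < s \<and> s < 2*(t*e) then ennreal (major t) * ennreal (1/(t*e)) * g (x+s) else 0) \<partial>lborel) \<partial>lborel)"
    by (rule lborel_pair.Fubini') measurable
  also have "\<dots> = (\<integral>\<^sup>+t. ennreal (major t) * shell_avg g (t*e) x \<partial>lborel)"
    unfolding shell_avg_def
    by (intro nn_integral_cong, subst mult.assoc[symmetric], subst nn_integral_cmult[symmetric])
       (auto intro!: nn_integral_cong)
  finally show ?thesis .
qed

text \<open>The first factor comes from the 2 in \<open>major_avg_le_shell_avg\<close>. Of the
  powers of \<open>major_mass\<close>, p-1 come from Hoelder's inequality and one from the final
  integration over t. The rest is the constant of \<open>shell_avg_bound\<close>.\<close>

definition major_const :: real where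
  "major_const = 2 powr p * major_mass powr p * (2 powr p * D powr (p/q))"

text \<open>Jensen's inequality for the finite measure \<open>major t\<close> dt, obtained from
  Hoelder's by splitting \<open>major\<close> into its powers 1/p and (p-1)/p. The shell averages
  are bounded uniformly in their radius, so integrating over t costs only the total mass.\<close>

lemma major_avg_bound:
  assumes e: "0 < e" and [measurable]: "g \<in> borel_measurable borel"
  shows "wnorm (major_avg g e) \<le> ennreal major_const * wnorm g"
proof -
  define K where "K = ennreal (2 powr p * major_mass powr (p-1))"
  have pw: "epowr (major_avg g e x) p
      \<le> K * (\<integral>\<^sup>+t. ennreal (major t) * epowr (shell_avg g (t*e) x) p \<partial>lborel)" for x
  proof -
    have "epowr (major_avg g e x) p \<le> epowr (2 * (\<integral>\<^sup>+t. ennreal (major t) * shell_avg g (t*e) x \<partial>lborel)) p"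
      using p by (intro epowr_mono major_avg_le_shell_avg e) auto
    also have "\<dots> = ennreal (2 powr p) * epowr (\<integral>\<^sup>+t. ennreal (major t) * shell_avg g (t*e) x \<partial>lborel) p"
      using p epowr_ennreal[of 2 p] by (simp add: epowr_mult)
    also have "epowr (\<integral>\<^sup>+t. ennreal (major t) * shell_avg g (t*e) x \<partial>lborel) p
      = epowr (\<integral>\<^sup>+t. (ennreal (major t powr (1/p)) * shell_avg g (t*e) x) * ennreal (major t powr ((p-1)/p)) \<partial>lborel) p"
    proof (intro arg_cong2[where f=epowr] nn_integral_cong refl)
      fix t
      have "1/p + (p-1)/p = 1" using p by (simp add: field_simps)
      then have "major t powr (1/p) * major t powr ((p-1)/p) = major t"
        by (simp add: powr_add[symmetric])
      then have "ennreal (major t) = ennreal (major t powr (1/p)) * ennreal (major t powr ((p-1)/p))"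
        by (simp add: ennreal_mult[symmetric])
      then show "ennreal (major t) * shell_avg g (t*e) x
        = (ennreal (major t powr (1/p)) * shell_avg g (t*e) x) * ennreal (major t powr ((p-1)/p))"
        by (simp add: mult_ac)
    qed
    also have "\<dots> \<le> (\<integral>\<^sup>+t. epowr (ennreal (major t powr (1/p)) * shell_avg g (t*e) x) p \<partial>lborel)
       * epowr (\<integral>\<^sup>+t. epowr (ennreal (major t powr ((p-1)/p))) (p/(p-1)) \<partial>lborel) (p-1)"
      by (rule nn_integral_Hoelder[OF p]) auto
    also have "(\<integral>\<^sup>+t. epowr (ennreal (major t powr (1/p)) * shell_avg g (t*e) x) p \<partial>lborel)
       = (\<integral>\<^sup>+t. ennreal (major t) * epowr (shell_avg g (t*e) x) p \<partial>lborel)"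
      using p by (intro nn_integral_cong) (simp add: epowr_mult powr_powr)
    also have "(\<integral>\<^sup>+t. epowr (ennreal (major t powr ((p-1)/p))) (p/(p-1)) \<partial>lborel) = ennreal major_mass"
      using p by (simp add: powr_powr nn_integral_major)
    finally show ?thesis
      using major_mass_pos by (simp add: K_def ennreal_mult mult_ac mult_right_mono)
  qed
  have "wnorm (major_avg g e)
    \<le> (\<integral>\<^sup>+x. (K * (\<integral>\<^sup>+t. ennreal (major t) * epowr (shell_avg g (t*e) x) p \<partial>lborel)) * ennreal (w x powr p) \<partial>lborel)"
    unfolding wnorm_def by (intro nn_integral_mono mult_right_mono pw) auto
  also have "\<dots> = K * (\<integral>\<^sup>+x. (\<integral>\<^sup>+t. ennreal (major t) * (epowr (shell_avg g (t*e) x) p * ennreal (w x powr p)) \<partial>lborel) \<partial>lborel)"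
  proof -
    have "(\<integral>\<^sup>+t. ennreal (major t) * (epowr (shell_avg g (t*e) x) p * ennreal (w x powr p)) \<partial>lborel)
      = (\<integral>\<^sup>+t. ennreal (major t) * epowr (shell_avg g (t*e) x) p \<partial>lborel) * ennreal (w x powr p)" for x
      by (subst nn_integral_multc[symmetric]) (auto simp: mult.assoc)
    then show ?thesis
      by (subst nn_integral_cmult[symmetric]) (auto simp: mult.assoc)
  qed
  also have "(\<integral>\<^sup>+x. (\<integral>\<^sup>+t. ennreal (major t) * (epowr (shell_avg g (t*e) x) p * ennreal (w x powr p)) \<partial>lborel) \<partial>lborel)
    = (\<integral>\<^sup>+t. (\<integral>\<^sup>+x. ennreal (major t) * (epowr (shell_avg g (t*e) x) p * ennreal (w x powr p)) \<partial>lborel) \<partial>lborel)"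
    by (rule lborel_pair.Fubini') measurable
  also have "\<dots> \<le> (\<integral>\<^sup>+t. ennreal (major t) * (ennreal (2 powr p * D powr (p/q)) * wnorm g) \<partial>lborel)"
  proof (rule nn_integral_mono)
    fix t
    show "(\<integral>\<^sup>+x. ennreal (major t) * (epowr (shell_avg g (t*e) x) p * ennreal (w x powr p)) \<partial>lborel)
       \<le> ennreal (major t) * (ennreal (2 powr p * D powr (p/q)) * wnorm g)"
    proof (cases "0 < t")
      case True
      have "(\<integral>\<^sup>+x. ennreal (major t) * (epowr (shell_avg g (t*e) x) p * ennreal (w x powr p)) \<partial>lborel)
        = ennreal (major t) * wnorm (shell_avg g (t*e))"
        unfolding wnorm_def by (rule nn_integral_cmult) auto
      also have "\<dots> \<le> ennreal (major t) * (ennreal (2 powr p * D powr (p/q)) * wnorm g)"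
        using True e by (intro mult_left_mono shell_avg_bound) auto
      finally show ?thesis .
    qed (simp add: major_def)
  qed
  also have "\<dots> = ennreal major_mass * (ennreal (2 powr p * D powr (p/q)) * wnorm g)"
    by (subst nn_integral_multc) (auto simp: nn_integral_major)
  also have "K * (ennreal major_mass * (ennreal (2 powr p * D powr (p/q)) * wnorm g)) = ennreal major_const * wnorm g"
  proof -
    have "major_mass powr p = major_mass powr (p-1) * major_mass"
      using major_mass_pos powr_add[of major_mass "p-1" 1] by simp
    then have "major_const = (2 powr p * major_mass powr (p-1)) * (major_mass * (2 powr p * D powr (p/q)))"
      by (simp add: major_const_def mult_ac)
    then have "ennreal major_const = K * (ennreal major_mass * ennreal (2 powr p * D powr (p/q)))"
      using major_mass_pos by (simp only: K_def) (simp add: ennreal_mult)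
    then show ?thesis by (simp add: mult.assoc)
  qed
  finally show ?thesis by (simp add: mult_left_mono)
qed

end

section \<open>Almost everywhere existence of the fractional integral\<close>

lemma ex_dyadic: "1 \<le> s \<Longrightarrow> \<exists>k::nat. 2^k \<le> s \<and> s \<le> 2^Suc k" for s :: real
proof -
  assume s: "1 \<le> s"
  define n where "n = (LEAST n. s < 2^n)"
  have ex: "\<exists>n. s < 2^n" using real_arch_pow[of 2 s] by auto
  have n: "s < 2^n" unfolding n_def by (rule LeastI_ex[OF ex])
  then obtain k where k: "n = Suc k" using s by (cases n) auto
  have "\<not> s < 2^k" using not_less_Least[of k "\<lambda>n. s < 2^n"] k by (simp add: n_def)
  then show ?thesis using n k by (intro exI[of _ k]) auto
qed

context one_sided_weight
begin

text \<open>The fractional integral without its Gamma factor, in the variable s = t - x. For g = |f|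
  a finite value means absolute convergence of the defining integral.\<close>

definition nn_frac_int :: "(real \<Rightarrow> ennreal) \<Rightarrow> real \<Rightarrow> ennreal" where
  "nn_frac_int g x = (\<integral>\<^sup>+s. (if 0 < s then ennreal (s powr (\<alpha>-1)) * g (x+s) else 0) \<partial>lborel)"

lemma interval_Hoelder_closed:
  assumes [measurable]: "g \<in> borel_measurable borel"
  shows "(\<integral>\<^sup>+y. (if a \<le> y \<and> y \<le> b then g y else 0) \<partial>lborel)
    \<le> epowr (wnorm g) (1/p) * epowr (mass (- (p/(p-1))) a b) ((p-1)/p)"
proof (rule epowr_le_D)
  have e: "1/p*p = 1" "(p-1)/p*p = p-1" using p by auto
  have "(\<integral>\<^sup>+y. (if a \<le> y \<and> y \<le> b then g y else 0) \<partial>lborel)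
     = (\<integral>\<^sup>+y. (if a < y \<and> y < b then g y else 0) \<partial>lborel)"
  proof (rule nn_integral_cong_AE)
    show "AE y in lborel. (if a \<le> y \<and> y \<le> b then g y else 0) = (if a < y \<and> y < b then g y else 0)"
      using AE_lborel_singleton[of a] AE_lborel_singleton[of b] by eventually_elim auto
  qed
  then have "epowr (\<integral>\<^sup>+y. (if a \<le> y \<and> y \<le> b then g y else 0) \<partial>lborel) p
     \<le> (\<integral>\<^sup>+y. (if a < y \<and> y < b then epowr (g y) p * ennreal (w y powr p) else 0) \<partial>lborel)
      * epowr (mass (- (p/(p-1))) a b) (p-1)"
    by (simp add: interval_Hoelder)
  also have "\<dots> \<le> wnorm g * epowr (mass (- (p/(p-1))) a b) (p-1)"
    unfolding wnorm_def by (intro mult_right_mono nn_integral_mono) auto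
  also have "\<dots> = epowr (epowr (wnorm g) (1/p) * epowr (mass (- (p/(p-1))) a b) ((p-1)/p)) p"
    using p by (simp add: epowr_mult epowr_epowr e)
  finally show "epowr (\<integral>\<^sup>+y. (if a \<le> y \<and> y \<le> b then g y else 0) \<partial>lborel) p \<le> \<dots>" .
qed (use p in auto)

text \<open>Local integrability serves both the fractional integral near its base point and the
  existence of Lebesgue points.\<close>

lemma wnorm_finite_locally:
  assumes [measurable]: "g \<in> borel_measurable borel" and fin: "wnorm g < top"
  shows "(\<integral>\<^sup>+y. (if a \<le> y \<and> y \<le> b then g y else 0) \<partial>lborel) < top"
proof -
  have "epowr (wnorm g) (1/p) * epowr (mass (- (p/(p-1))) a b) ((p-1)/p) < top"
    using fin mass_dual_finite[of a b] by (auto simp: ennreal_mult_less_top)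
  then show ?thesis
    using interval_Hoelder_closed[of g a b] by (auto intro: le_less_trans)
qed

text \<open>Integrate over x in [-N, N] and interchange: x+s stays in [-N, N+1], where g is
  integrable, and s^(\<alpha>-1) is integrable on (0,1]. Countably many N exhaust the line.\<close>

lemma frac_int_near:
  assumes [measurable]: "g \<in> borel_measurable borel" and fin: "wnorm g < top"
  shows "AE x in lborel. (\<integral>\<^sup>+s. (if 0 < s \<and> s \<le> 1 then ennreal (s powr (\<alpha>-1)) * g (x+s) else 0) \<partial>lborel) < top"
proof -
  define I where "I x = (\<integral>\<^sup>+s. (if 0 < s \<and> s \<le> 1 then ennreal (s powr (\<alpha>-1)) * g (x+s) else 0) \<partial>lborel)" for x
  have [measurable]: "I \<in> borel_measurable borel"
    unfolding I_def by measurable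
  have "AE x in lborel. \<forall>N::nat. - real N \<le> x \<and> x \<le> real N \<longrightarrow> I x < top"
    unfolding AE_all_countable
  proof
    fix N :: nat
    define L where "L = (\<integral>\<^sup>+y. (if - real N \<le> y \<and> y \<le> real N + 1 then g y else 0) \<partial>lborel)"
    have "(\<integral>\<^sup>+x. (if - real N \<le> x \<and> x \<le> real N then I x else 0) \<partial>lborel)
      = (\<integral>\<^sup>+x. (\<integral>\<^sup>+s. (if - real N \<le> x \<and> x \<le> real N \<and> 0 < s \<and> s \<le> 1 then ennreal (s powr (\<alpha>-1)) * g (x+s) else 0) \<partial>lborel) \<partial>lborel)"
      unfolding I_def by (intro nn_integral_cong) auto
    also have "\<dots> = (\<integral>\<^sup>+s. (\<integral>\<^sup>+x. (if - real N \<le> x \<and> x \<le> real N \<and> 0 < s \<and> s \<le> 1 then ennreal (s powr (\<alpha>-1)) * g (x+s) else 0) \<partial>lborel) \<partial>lborel)"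
      by (rule lborel_pair.Fubini') measurable
    also have "\<dots> \<le> (\<integral>\<^sup>+s. ennreal (s powr (\<alpha>-1)) * indicator {0..1} s * L \<partial>lborel)"
    proof (rule nn_integral_mono)
      fix s
      show "(\<integral>\<^sup>+x. (if - real N \<le> x \<and> x \<le> real N \<and> 0 < s \<and> s \<le> 1 then ennreal (s powr (\<alpha>-1)) * g (x+s) else 0) \<partial>lborel)
        \<le> ennreal (s powr (\<alpha>-1)) * indicator {0..1} s * L"
      proof (cases "0 < s \<and> s \<le> 1")
        case True
        then have "(\<integral>\<^sup>+x. (if - real N \<le> x \<and> x \<le> real N \<and> 0 < s \<and> s \<le> 1 then ennreal (s powr (\<alpha>-1)) * g (x+s) else 0) \<partial>lborel)
          \<le> (\<integral>\<^sup>+x. ennreal (s powr (\<alpha>-1)) * (if - real N \<le> s+x \<and> s+x \<le> real N + 1 then g (s+x) else 0) \<partial>lborel)"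
          by (intro nn_integral_mono) (auto simp: add.commute)
        also have "\<dots> = ennreal (s powr (\<alpha>-1)) * (\<integral>\<^sup>+x. (if - real N \<le> s+x \<and> s+x \<le> real N + 1 then g (s+x) else 0) \<partial>lborel)"
          by (rule nn_integral_cmult) auto
        also have "(\<integral>\<^sup>+x. (if - real N \<le> s+x \<and> s+x \<le> real N + 1 then g (s+x) else 0) \<partial>lborel) = L"
          unfolding L_def by (rule nn_integral_shift) auto
        finally show ?thesis using True by simp
      qed (auto simp: if_distrib cong: if_cong)
    qed
    also have "\<dots> = (\<integral>\<^sup>+s. ennreal (s powr (\<alpha>-1)) * indicator {0..1} s \<partial>lborel) * L"
      by (rule nn_integral_multc) auto
    also have "\<dots> < top"
      using wnorm_finite_locally[OF _ fin] alpha
        nn_integral_has_integral_lebesgue'[OF _ has_integral_powr_from_0[of "\<alpha>-1" 1]]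
      by (auto simp: L_def ennreal_mult_less_top)
    finally have "AE x in lborel. (if - real N \<le> x \<and> x \<le> real N then I x else 0) \<noteq> \<infinity>"
      by (intro nn_integral_noteq_infinite) (auto simp: less_top[symmetric])
    then show "AE x in lborel. - real N \<le> x \<and> x \<le> real N \<longrightarrow> I x < top"
      by eventually_elim (auto simp: less_top split: if_splits)
  qed
  then show ?thesis
  proof eventually_elim
    case (elim x)
    obtain N :: nat where "\<bar>x\<bar> \<le> real N" using real_arch_simple by blast
    then show ?case using elim by (auto simp: I_def abs_le_iff)
  qed
qed

text \<open>On the \<open>k\<close>-th dyadic shell the powers of \<open>2^k\<close> cancel exactly since \<open>1/q = 1/p - \<alpha>\<close>; what remains is summable by
  \<open>mass_growth\<close>.\<close>

lemma frac_int_far: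
  assumes [measurable]: "g \<in> borel_measurable borel" and fin: "wnorm g < top"
  shows "(\<integral>\<^sup>+s. (if 1 \<le> s then ennreal (s powr (\<alpha>-1)) * g (x+s) else 0) \<partial>lborel) < top"
proof -
  define f where "f k s = (if 2^k \<le> s \<and> s \<le> 2^Suc k then ennreal (s powr (\<alpha>-1)) * g (x+s) else 0)" for k :: nat and s
  define A where "A k = (\<integral>\<^sup>+s. f k s \<partial>lborel)" for k
  have [measurable]: "f k \<in> borel_measurable borel" for k
    unfolding f_def by measurable
  obtain v where v: "mass q x (x+1) = ennreal v" "0 < v"
    using mass_q_finite[of x "x+1"] mass_pos[of x "x+1" q] by (cases "mass q x (x+1)" rule: ennreal_cases) auto
  obtain N where N: "epowr (wnorm g) (1/p) = ennreal N" "0 \<le> N"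
    using fin by (cases "epowr (wnorm g) (1/p)" rule: ennreal_cases) auto
  \<comment> \<open>By \<open>mass_growth\<close> the mass over [x, x + 2^k] is at least (1 + 1/D)^k
    * v; its power -1/q is therefore at most \<open>v powr (-1/q) * \<sigma>^k\<close>.\<close>
  define \<sigma> where "\<sigma> = (1 + 1/D) powr (-1/q)"
  have \<sigma>: "0 < \<sigma>" "\<sigma> < 1"
  proof -
    have "1 < 1 + 1/D" using D by simp
    moreover from this have "1 + 1/D \<noteq> 0" by linarith
    ultimately show "0 < \<sigma>" "\<sigma> < 1" using q(1) unfolding \<sigma>_def by (auto simp: powr_less_one)
  qed
  have A: "A k \<le> ennreal (N * D powr (1/q) * v powr (-1/q) * \<sigma>^k)" for k
  proof -
    define h where "h = (2::real)^k"
    have h: "0 < h" "2^Suc k = h + h" by (auto simp: h_def)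
    have "A k \<le> (\<integral>\<^sup>+s. ennreal (h powr (\<alpha>-1)) * (if x+h \<le> x+s \<and> x+s \<le> x+h+h then g (x+s) else 0) \<partial>lborel)"
      unfolding A_def f_def h(2) h_def[symmetric] using alpha h(1)
      by (intro nn_integral_mono) (auto intro!: mult_right_mono ennreal_leI powr_mono2')
    also have "\<dots> = ennreal (h powr (\<alpha>-1)) * (\<integral>\<^sup>+s. (if x+h \<le> x+s \<and> x+s \<le> x+h+h then g (x+s) else 0) \<partial>lborel)"
      by (rule nn_integral_cmult) auto
    also have "(\<integral>\<^sup>+s. (if x+h \<le> x+s \<and> x+s \<le> x+h+h then g (x+s) else 0) \<partial>lborel)
      = (\<integral>\<^sup>+y. (if x+h \<le> y \<and> y \<le> x+h+h then g y else 0) \<partial>lborel)"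
      by (rule nn_integral_shift) auto
    also have "ennreal (h powr (\<alpha>-1)) * (\<integral>\<^sup>+y. (if x+h \<le> y \<and> y \<le> x+h+h then g y else 0) \<partial>lborel)
      \<le> ennreal (h powr (\<alpha>-1)) * (ennreal N * epowr (mass (- (p/(p-1))) (x+h) (x+h+h)) ((p-1)/p))"
      using interval_Hoelder_closed[of g "x+h" "x+h+h"] N by (intro mult_left_mono) auto
    finally have 1: "A k \<le> ennreal (h powr (\<alpha>-1)) * (ennreal N * epowr (mass (- (p/(p-1))) (x+h) (x+h+h)) ((p-1)/p))" .
    have "ennreal ((1 + 1/D)^k * v) \<le> mass q x (x+h)"
      using mass_growth[of k x] v D by (simp add: h_def ennreal_mult)
    then have "epowr (ennreal ((1 + 1/D)^k * v)) (1/q) \<le> epowr (mass q x (x+h)) (1/q)"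
      using q(1) by (intro epowr_mono) auto
    also have "epowr (ennreal ((1 + 1/D)^k * v)) (1/q) = ennreal (1 / (\<sigma>^k * v powr (-1/q)))"
    proof -
      have "((1 + 1/D)^k) powr (1/q) = 1 / \<sigma>^k"
      proof -
        have "0 < 1 + 1/D" using D by (simp add: add_pos_pos)
        then have "((1 + 1/D)^k) powr (1/q) = ((1 + 1/D) powr (1/q))^k"
          by (simp only: powr_realpow[symmetric] powr_powr powr_gt_zero mult.commute)
        moreover have "\<sigma>^k = 1 / ((1 + 1/D) powr (1/q))^k"
          by (simp add: \<sigma>_def powr_minus_divide power_one_over)
        ultimately show ?thesis by simp
      qed
      then have "((1 + 1/D)^k * v) powr (1/q) = 1 / (\<sigma>^k * v powr (-1/q))"
        using D v by (simp add: powr_mult powr_minus divide_inverse)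
      then show ?thesis using D v by simp
    qed
    finally have 2: "ennreal (1 / (\<sigma>^k * v powr (-1/q))) \<le> epowr (mass q x (x+h)) (1/q)" .
    \<comment> \<open>Multiplying by the lower bound for the power 1/q of the mass creates the
      product in \<open>dual_mass_bound\<close>; afterwards a positive real factor is divided
      out.\<close>
    have "A k * ennreal (1 / (\<sigma>^k * v powr (-1/q)))
       \<le> (ennreal (h powr (\<alpha>-1)) * (ennreal N * epowr (mass (- (p/(p-1))) (x+h) (x+h+h)) ((p-1)/p)))
         * epowr (mass q x (x+h)) (1/q)"
      by (intro mult_mono 1 2) auto
    also have "\<dots> = ennreal (h powr (\<alpha>-1)) * (ennreal N *
       (epowr (mass (- (p/(p-1))) (x+h) (x+h+h)) ((p-1)/p) * epowr (mass q x (x+h)) (1/q)))"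
      by (simp add: mult_ac)
    also have "\<dots> \<le> ennreal (h powr (\<alpha>-1)) * (ennreal N * ennreal (D powr (1/q) * h powr (1-\<alpha>)))"
      by (intro mult_left_mono dual_mass_bound h) auto
    also have "\<dots> = ennreal (N * D powr (1/q))"
    proof -
      have "h powr (\<alpha>-1) * h powr (1-\<alpha>) = 1"
        using h by (simp add: powr_add[symmetric])
      then have "h powr (\<alpha>-1) * (N * (D powr (1/q) * h powr (1-\<alpha>))) = N * D powr (1/q)"
        by (metis mult.assoc mult.commute mult.right_neutral)
      then show ?thesis using N by (simp add: ennreal_mult[symmetric])
    qed
    finally have "A k * ennreal (1 / (\<sigma>^k * v powr (-1/q))) \<le> ennreal (N * D powr (1/q))" .
    then have "A k * ennreal (1 / (\<sigma>^k * v powr (-1/q))) * ennreal (\<sigma>^k * v powr (-1/q))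
      \<le> ennreal (N * D powr (1/q)) * ennreal (\<sigma>^k * v powr (-1/q))"
      by (rule mult_right_mono) auto
    also have "A k * ennreal (1 / (\<sigma>^k * v powr (-1/q))) * ennreal (\<sigma>^k * v powr (-1/q)) = A k"
      using \<sigma> v by (simp add: mult.assoc ennreal_mult[symmetric])
    also have "ennreal (N * D powr (1/q)) * ennreal (\<sigma>^k * v powr (-1/q)) = ennreal (N * D powr (1/q) * v powr (-1/q) * \<sigma>^k)"
      using N \<sigma> v by (subst ennreal_mult[symmetric]) (auto simp: mult_ac)
    finally show ?thesis .
  qed
  \<comment> \<open>Consecutive shells share an endpoint. One shell that contains s is enough for an
    upper bound.\<close>
  have "(\<integral>\<^sup>+s. (if 1 \<le> s then ennreal (s powr (\<alpha>-1)) * g (x+s) else 0) \<partial>lborel) \<le> (\<integral>\<^sup>+s. (\<Sum>k. f k s) \<partial>lborel)"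
  proof (rule nn_integral_mono)
    fix s
    show "(if 1 \<le> s then ennreal (s powr (\<alpha>-1)) * g (x+s) else 0) \<le> (\<Sum>k. f k s)"
    proof (cases "1 \<le> s")
      case True
      then obtain k where k: "2^k \<le> s \<and> s \<le> 2^Suc k" using ex_dyadic by blast
      have "sum (\<lambda>k. f k s) {k} \<le> (\<Sum>k. f k s)"
        by (intro sum_le_suminf) auto
      then show ?thesis using True k by (simp add: f_def)
    qed auto
  qed
  also have "\<dots> = (\<Sum>k. A k)"
    unfolding A_def by (rule nn_integral_suminf) auto
  also have "\<dots> \<le> (\<Sum>k. ennreal (N * D powr (1/q) * v powr (-1/q) * \<sigma>^k))"
    by (intro suminf_le A) auto
  also have "\<dots> = ennreal (\<Sum>k. N * D powr (1/q) * v powr (-1/q) * \<sigma>^k)"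
    using \<sigma> N v by (intro suminf_ennreal2) (auto intro!: summable_mult summable_geometric)
  also have "\<dots> < top" by simp
  finally show ?thesis .
qed

lemma nn_frac_int_finite:
  assumes [measurable]: "g \<in> borel_measurable borel" and fin: "wnorm g < top"
  shows "AE x in lborel. nn_frac_int g x < top"
  using frac_int_near[OF assms]
proof eventually_elim
  case (elim x)
  have "nn_frac_int g x \<le> (\<integral>\<^sup>+s. (if 0 < s \<and> s \<le> 1 then ennreal (s powr (\<alpha>-1)) * g (x+s) else 0)
      + (if 1 \<le> s then ennreal (s powr (\<alpha>-1)) * g (x+s) else 0) \<partial>lborel)"
    unfolding nn_frac_int_def by (intro nn_integral_mono) auto
  also have "\<dots> = (\<integral>\<^sup>+s. (if 0 < s \<and> s \<le> 1 then ennreal (s powr (\<alpha>-1)) * g (x+s) else 0) \<partial>lborel)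
      + (\<integral>\<^sup>+s. (if 1 \<le> s then ennreal (s powr (\<alpha>-1)) * g (x+s) else 0) \<partial>lborel)"
    by (rule nn_integral_add) auto
  also have "\<dots> < top"
    using elim frac_int_far[OF assms, of x] by (simp add: less_top)
  finally show ?case .
qed

end

section \<open>The kernel of the truncated derivative\<close>

context one_sided_weight
begin

text \<open>Equal to sin(\<pi> \<alpha>)/\<pi> by the reflection formula; the value normalizes the
  kernel in \<open>nn_integral_kern_1\<close>.\<close>

definition kern_const :: real where
  "kern_const = 1 / (Gamma \<alpha> * Gamma (1-\<alpha>))"

definition kern :: "real \<Rightarrow> real \<Rightarrow> real" where
  "kern e s = (if 0 < s then kern_const / s * ((s/e) powr \<alpha> - max 0 (s/e-1) powr \<alpha>) else 0)"

lemma kern_const_pos: "0 < kern_const"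
  using alpha by (simp add: kern_const_def Gamma_real_pos)

lemma kern_measurable [measurable]: "kern e \<in> borel_measurable borel"
  unfolding kern_def by measurable

lemma kern_nonneg: "0 < e \<Longrightarrow> 0 \<le> kern e s"
  using alpha kern_const_pos by (auto simp: kern_def intro!: mult_nonneg_nonneg divide_nonneg_nonneg powr_mono2)

text \<open>With u = s/e \<ge> 1, the difference u^\<alpha> - (u-1)^\<alpha> equals u^\<alpha> * (1
  - (1 - 1/u)^\<alpha>), and z \<le> z^\<alpha> on [0,1] bounds the last factor by 1/u. For u < 1
  the second power vanishes and there is equality.\<close>

lemma kern_le:
  assumes e: "0 < e"
  shows "kern e s \<le> kern_const * (major (s/e) / e)"
proof (cases "0 < s")
  case True
  define u where "u = s/e"
  have u: "0 < u" using True e by (simp add: u_def)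
  have "u powr \<alpha> - max 0 (u-1) powr \<alpha> \<le> u * major u"
  proof (cases "1 \<le> u")
    case True
    have "1 - 1/u \<le> (1 - 1/u) powr \<alpha>"
      using True alpha powr_mono'[of \<alpha> 1 "1 - 1/u"] by (cases "u = 1") auto
    then have "u powr \<alpha> * (1 - 1/u) \<le> u powr \<alpha> * (1 - 1/u) powr \<alpha>"
      by (rule mult_left_mono) auto
    also have "\<dots> = (u * (1 - 1/u)) powr \<alpha>"
      using True by (simp add: powr_mult)
    also have "u * (1 - 1/u) = u - 1"
      using u by (simp add: field_simps)
    finally have "u powr \<alpha> - (u-1) powr \<alpha> \<le> u powr \<alpha> * (1/u)"
      by (simp add: algebra_simps)
    also have "\<dots> = u * u powr (\<alpha>-2)"
      using u by (simp add: powr_diff power2_eq_square)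
    also have "\<dots> = u * major u"
    proof -
      have "u powr (\<alpha>-2) \<le> u powr (\<alpha>-1)" using True by (intro powr_mono) auto
      then show ?thesis using u by (simp add: major_def min_def)
    qed
    finally show ?thesis using True by simp
  next
    case False
    have "u powr (\<alpha>-1) \<le> u powr (\<alpha>-2)"
      using u False by (intro powr_mono') auto
    then have "u * major u = u * u powr (\<alpha>-1)"
      using u by (simp add: major_def)
    also have "\<dots> = u powr \<alpha>"
      using u by (simp add: powr_diff)
    finally show ?thesis using False by simp
  qed
  then have "kern e s \<le> kern_const / s * (u * major u)"
    using True kern_const_pos unfolding kern_def u_def[symmetric] by (simp add: mult_left_mono divide_right_mono)
  also have "\<dots> = kern_const * (major (s/e) / e)"
    using True e by (simp add: u_def)
  finally show ?thesis .
qed (use e kern_const_pos in \<open>auto simp: kern_def\<close>)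

text \<open>This is the integral of \<open>(u\<^sup>\<alpha> - (u-1)\<^sup>\<alpha>)/u\<close> over \<open>(1,\<infinity>)\<close> after the substitution \<open>u = 1/t\<close>; integration by parts, with the
  boundary term \<open>J\<close>, turns it into a Beta integral.\<close>

lemma has_integral_kern_unit:
  "((\<lambda>t. t powr (-\<alpha>-1) * (1 - (1-t) powr \<alpha>)) has_integral Beta (1-\<alpha>) \<alpha> - 1/\<alpha>) {0..1}"
proof -
  define J where "J t = - (t powr (-\<alpha>)) / \<alpha> * (1 - (1-t) powr \<alpha>)" for t
  have cont: "continuous_on {0..1} J"
  proof (rule continuous_on_eq_continuous_within[THEN iffD2], rule ballI)
    fix t :: real assume t: "t \<in> {0..1}"
    show "continuous (at t within {0..1}) J"
    proof (cases "t = 0")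
      case True
      \<comment> \<open>The convention 0 powr r = 0 gives J 0 = 0, which is also the limit: 1 -
        (1-t)^\<alpha> \<le> t on [0,1] outweighs t^(-\<alpha>).\<close>
      have "(J \<longlongrightarrow> 0) (at 0 within {0..1})"
      proof (rule Lim_null_comparison)
        show "\<forall>\<^sub>F t in at 0 within {0..1}. norm (J t) \<le> t powr (1-\<alpha>) / \<alpha>"
          unfolding eventually_at_filter
        proof (rule always_eventually, intro allI impI)
          fix t :: real assume "t \<noteq> 0" "t \<in> {0..1}"
          then have t: "0 < t" "t \<le> 1" by auto
          have "1 - t \<le> (1-t) powr \<alpha>" "(1-t) powr \<alpha> \<le> 1"
            using t alpha powr_mono'[of \<alpha> 1 "1 - t"] powr_le1[of \<alpha> "1-t"] by (cases "t = 1"; simp)+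
          then have "\<bar>1 - (1-t) powr \<alpha>\<bar> \<le> t" by simp
          then have "norm (J t) \<le> t powr (-\<alpha>) / \<alpha> * t"
            using alpha by (simp add: J_def abs_mult mult_left_mono divide_right_mono)
          also have "\<dots> = t powr (1-\<alpha>) / \<alpha>"
            using t by (simp add: powr_diff powr_minus divide_inverse)
          finally show "norm (J t) \<le> t powr (1-\<alpha>) / \<alpha>" .
        qed
        have "((\<lambda>t::real. t powr (1-\<alpha>) / \<alpha>) \<longlongrightarrow> 0 powr (1-\<alpha>) / \<alpha>) (at 0 within {0..1})"
          using alpha by (intro tendsto_intros tendsto_powr2) (auto simp: eventually_at_filter)
        then show "((\<lambda>t::real. t powr (1-\<alpha>) / \<alpha>) \<longlongrightarrow> 0) (at 0 within {0..1})" by simp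
      qed
      then show ?thesis using True by (simp add: continuous_within J_def)
    next
      case False
      then have "0 < t" using t by simp
      have "((\<lambda>t. (1-t) powr \<alpha>) \<longlongrightarrow> (1-t) powr \<alpha>) (at t within {0..1})"
        using alpha by (intro tendsto_powr2 tendsto_intros) (auto simp: eventually_at_filter)
      moreover have "((\<lambda>t. t powr (-\<alpha>)) \<longlongrightarrow> t powr (-\<alpha>)) (at t within {0..1})"
        using \<open>0 < t\<close> by (intro tendsto_intros) auto
      ultimately show ?thesis
        unfolding continuous_within J_def using alpha
        by (intro tendsto_mult tendsto_divide tendsto_minus tendsto_diff tendsto_const) auto
    qed
  qed
  \<comment> \<open>The derivative of J is the integrand in question minus that of the Beta
    integral. The derivative is singular at the ends, so only interior points are differentiated.
    The term -1/\<alpha> of the result is J 1.\<close>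
  have "((\<lambda>t. t powr (-\<alpha>-1) * (1 - (1-t) powr \<alpha>) - t powr (-\<alpha>) * (1-t) powr (\<alpha>-1)) has_integral (J 1 - J 0)) {0..1}"
  proof (rule fundamental_theorem_of_calculus_interior[OF _ cont])
    fix t :: real assume t: "t \<in> {0<..<1}"
    have "(J has_real_derivative
       - (-\<alpha> * t powr (-\<alpha>-1)) / \<alpha> * (1 - (1-t) powr \<alpha>) + - (t powr (-\<alpha>)) / \<alpha> * (- (\<alpha> * (1-t) powr (\<alpha>-1) * (-1)))) (at t)"
      unfolding J_def using t alpha by (auto intro!: derivative_eq_intros simp: field_simps)
    also have "- (-\<alpha> * t powr (-\<alpha>-1)) / \<alpha> * (1 - (1-t) powr \<alpha>) + - (t powr (-\<alpha>)) / \<alpha> * (- (\<alpha> * (1-t) powr (\<alpha>-1) * (-1)))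
       = t powr (-\<alpha>-1) * (1 - (1-t) powr \<alpha>) - t powr (-\<alpha>) * (1-t) powr (\<alpha>-1)"
      using alpha by simp
    finally show "(J has_vector_derivative t powr (-\<alpha>-1) * (1 - (1-t) powr \<alpha>) - t powr (-\<alpha>) * (1-t) powr (\<alpha>-1)) (at t)"
      by (simp add: has_real_derivative_iff_has_vector_derivative)
  qed simp
  moreover have "((\<lambda>t. t powr (-\<alpha>) * (1-t) powr (\<alpha>-1)) has_integral Beta (1-\<alpha>) \<alpha>) {0..1}"
    using has_integral_Beta_real[of "1-\<alpha>" \<alpha>] alpha by simp
  ultimately have "((\<lambda>t. t powr (-\<alpha>-1) * (1 - (1-t) powr \<alpha>) - t powr (-\<alpha>) * (1-t) powr (\<alpha>-1)
      + t powr (-\<alpha>) * (1-t) powr (\<alpha>-1)) has_integral (J 1 - J 0 + Beta (1-\<alpha>) \<alpha>)) {0..1}"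
    by (rule has_integral_add)
  then show ?thesis using alpha by (simp add: J_def)
qed

lemma has_integral_kern_tail:
  "((\<lambda>u. (u powr \<alpha> - (u-1) powr \<alpha>) / u) has_integral Beta (1-\<alpha>) \<alpha> - 1/\<alpha>) {1<..}"
proof -
  let ?F = "\<lambda>t. t powr (-\<alpha>-1) * (1 - (1-t) powr \<alpha>)"
  let ?f = "\<lambda>u. (u powr \<alpha> - (u-1) powr \<alpha>) / u"
  have F: "(?F has_integral Beta (1-\<alpha>) \<alpha> - 1/\<alpha>) {0<..<1}"
    using has_integral_kern_unit by (simp add: has_integral_Icc_iff_Ioo)
  have eq: "\<bar>- 1 / t^2\<bar> * ?f (1/t) = ?F t" if "t \<in> {0<..<1}" for t :: real
  proof -
    have t: "0 < t" "t < 1" using that by auto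
    have "1/t - 1 = (1-t)/t" using t by (simp add: field_simps)
    then have "(1/t) powr \<alpha> - (1/t-1) powr \<alpha> = t powr (-\<alpha>) * (1 - (1-t) powr \<alpha>)"
      using t by (simp add: powr_divide powr_minus field_simps)
    then have "\<bar>- 1 / t^2\<bar> * ?f (1/t) = (t powr (-\<alpha>) / t) * (1 - (1-t) powr \<alpha>)"
      using t by (simp add: power2_eq_square)
    also have "t powr (-\<alpha>) / t = t powr (-\<alpha>-1)"
      using t by (simp add: powr_diff)
    finally show ?thesis .
  qed
  \<comment> \<open>The sign turns Henstock integrability into the absolute integrability that the
    change of variables requires.\<close>
  have pos: "0 \<le> ?F t" if "t \<in> {0<..<1}" for t :: real
    using that alpha powr_le1[of \<alpha> "1-t"] by auto
  have "?F absolutely_integrable_on {0<..<1}"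
    using F pos by (intro nonnegative_absolutely_integrable_1) (auto simp: integrable_on_def)
  then have "(\<lambda>t. \<bar>- 1 / t^2\<bar> * ?f (1/t)) absolutely_integrable_on {0<..<1}"
    by (subst set_integrable_cong[OF refl refl eq]) auto
  moreover have "integral {0<..<1} (\<lambda>t. \<bar>- 1 / t^2\<bar> * ?f (1/t)) = integral {0<..<1} ?F"
    by (rule Henstock_Kurzweil_Integration.integral_cong) (rule eq)
  ultimately have "(\<lambda>t. \<bar>- 1 / t^2\<bar> * ?f (1/t)) absolutely_integrable_on {0<..<1} \<and>
     integral {0<..<1} (\<lambda>t. \<bar>- 1 / t^2\<bar> * ?f (1/t)) = Beta (1-\<alpha>) \<alpha> - 1/\<alpha>"
    using F by (simp add: integral_unique)
  then have "?f absolutely_integrable_on ((\<lambda>t. 1/t) ` {0<..<1}) \<and>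
     integral ((\<lambda>t. 1/t) ` {0<..<1}) ?f = Beta (1-\<alpha>) \<alpha> - 1/\<alpha>"
    by (subst (asm) has_absolute_integral_change_of_variables_1')
       (auto intro!: derivative_eq_intros inj_onI simp: power2_eq_square)
  moreover have "(\<lambda>t. 1/t) ` {0<..<1} = {1::real<..}"
  proof (intro set_eqI iffI)
    fix u :: real assume "u \<in> {1<..}"
    then show "u \<in> (\<lambda>t. 1/t) ` {0<..<1}" by (intro image_eqI[of _ _ "1/u"]) auto
  qed (auto simp: field_simps)
  ultimately show ?thesis
    using set_lebesgue_integral_eq_integral(1)[of "{1<..}" ?f] by (simp add: has_integral_iff)
qed

text \<open>On (0,1] the kernel is a multiple of u^(\<alpha>-1) with integral 1/\<alpha>, which
  cancels the -1/\<alpha> of \<open>has_integral_kern_tail\<close>. What remains is Beta(1-\<alpha>,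
  \<alpha>) = Gamma(1-\<alpha>) * Gamma(\<alpha>), the reciprocal of
  \<open>kern_const\<close>.\<close>

lemma nn_integral_kern_1: "(\<integral>\<^sup>+s. ennreal (kern 1 s) \<partial>lborel) = 1"
proof -
  have 1: "(\<integral>\<^sup>+u. ennreal (u powr (\<alpha>-1)) * indicator {0..1} u \<partial>lborel) = ennreal (1/\<alpha>)"
    using nn_integral_has_integral_lebesgue'[OF _ has_integral_powr_from_0[of "\<alpha>-1" 1]] alpha by simp
  have 2: "(\<integral>\<^sup>+u. ennreal ((u powr \<alpha> - (u-1) powr \<alpha>) / u) * indicator {1<..} u \<partial>lborel) = ennreal (Beta (1-\<alpha>) \<alpha> - 1/\<alpha>)"
    by (rule nn_integral_has_integral_lebesgue'[OF _ has_integral_kern_tail])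
       (use alpha in \<open>auto intro!: divide_nonneg_nonneg powr_mono2\<close>)
  have G: "Gamma \<alpha> \<noteq> 0" "Gamma (1-\<alpha>) \<noteq> 0"
    using alpha Gamma_real_pos[of \<alpha>] Gamma_real_pos[of "1-\<alpha>"] by linarith+
  have nn: "0 \<le> Beta (1-\<alpha>) \<alpha> - 1/\<alpha>"
    by (rule has_integral_nonneg[OF has_integral_kern_tail])
       (use alpha in \<open>auto intro!: divide_nonneg_nonneg powr_mono2\<close>)
  have "(\<integral>\<^sup>+s. ennreal (kern 1 s) \<partial>lborel)
    = (\<integral>\<^sup>+u. ennreal kern_const * (ennreal (u powr (\<alpha>-1)) * indicator {0..1} u
        + ennreal ((u powr \<alpha> - (u-1) powr \<alpha>) / u) * indicator {1<..} u) \<partial>lborel)"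
  proof (rule nn_integral_cong_AE)
    show "AE u in lborel. ennreal (kern 1 u) = ennreal kern_const * (ennreal (u powr (\<alpha>-1)) * indicator {0..1} u
        + ennreal ((u powr \<alpha> - (u-1) powr \<alpha>) / u) * indicator {1<..} u)"
      using AE_lborel_singleton[of 0]
    proof eventually_elim
      case (elim u)
      show ?case
        using elim kern_const_pos alpha
        by (auto simp: kern_def indicator_def max_def powr_diff ennreal_mult[symmetric] powr_mono2)
    qed
  qed
  also have "\<dots> = ennreal kern_const * (ennreal (1/\<alpha>) + ennreal (Beta (1-\<alpha>) \<alpha> - 1/\<alpha>))"
    by (subst nn_integral_cmult, measurable, subst nn_integral_add) (auto simp: 1 2)
  also have "\<dots> = ennreal (kern_const * Beta (1-\<alpha>) \<alpha>)"
  proof -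
    have "0 \<le> Beta (1-\<alpha>) \<alpha>" using alpha nn by (simp add: order_trans[of 0 "1/\<alpha>"])
    then show ?thesis
      using alpha nn kern_const_pos by (simp add: ennreal_plus[symmetric] ennreal_mult[symmetric] del: ennreal_plus)
  qed
  also have "kern_const * Beta (1-\<alpha>) \<alpha> = 1"
    using G by (simp add: kern_const_def Beta_def)
  finally show ?thesis by simp
qed

lemma nn_integral_kern:
  assumes e: "0 < e"
  shows "(\<integral>\<^sup>+s. ennreal (kern e s) \<partial>lborel) = 1"
proof -
  have "ennreal (kern e (0 + e * s)) = ennreal (1/e) * ennreal (kern 1 s)" for s
  proof -
    have "kern e (0 + e * s) = 1/e * kern 1 s"
      using e by (simp add: kern_def zero_less_mult_iff)
    then show ?thesis
      using e by (subst ennreal_mult[symmetric]) (auto simp: kern_nonneg)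
  qed
  then have "(\<integral>\<^sup>+s. ennreal (kern e s) \<partial>lborel) = ennreal \<bar>e\<bar> * (\<integral>\<^sup>+s. ennreal (1/e) * ennreal (kern 1 s) \<partial>lborel)"
    using e by (subst nn_integral_real_affine[of _ e 0]) auto
  also have "\<dots> = ennreal \<bar>e\<bar> * (ennreal (1/e) * 1)"
    by (subst nn_integral_cmult) (auto simp: nn_integral_kern_1)
  also have "\<dots> = 1"
    using e by (simp add: ennreal_mult[symmetric])
  finally show ?thesis .
qed

lemma has_bochner_integral_kern: "0 < e \<Longrightarrow> has_bochner_integral lborel (kern e) 1"
  by (rule has_bochner_integral_nn_integral) (auto simp: kern_nonneg nn_integral_kern)

end

section \<open>The truncated derivative of the fractional integral as a convolution\<close>

text \<open>The passage from the set integrals of the definitions to integrals in s = t - x over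
  \<open>lborel\<close>; e = 0 serves the fractional integral and e > 0 the truncated
  derivative.\<close>

lemma set_lebesgue_integral_Ioi_shift:
  fixes h :: "real \<Rightarrow> real"
  assumes [measurable]: "h \<in> borel_measurable borel"
  shows "(LINT t:{x+e<..}|lebesgue. h t) = (LINT s|lborel. (if e < s then h (x+s) else 0))"
    and "set_integrable lebesgue {x+e<..} h \<longleftrightarrow> integrable lborel (\<lambda>s. if e < s then h (x+s) else 0)"
proof -
  have eq: "(\<lambda>s. indicator {x+e<..} (x+1 * s) *\<^sub>R h (x+1 * s)) = (\<lambda>s. if e < s then h (x+s) else 0)"
    by (auto simp: indicator_def)
  have [measurable]: "(\<lambda>t. indicator {x+e<..} t *\<^sub>R h t) \<in> borel_measurable borel"
    by measurable
  show "(LINT t:{x+e<..}|lebesgue. h t) = (LINT s|lborel. (if e < s then h (x+s) else 0))"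
    unfolding set_lebesgue_integral_def eq[symmetric]
    using lborel_integral_real_affine[of 1 "\<lambda>t. indicator {x+e<..} t *\<^sub>R h t" x]
    by (simp add: integral_completion)
  show "set_integrable lebesgue {x+e<..} h \<longleftrightarrow> integrable lborel (\<lambda>s. if e < s then h (x+s) else 0)"
    unfolding set_integrable_def eq[symmetric]
    using lborel_integrable_real_affine_iff[of 1 "\<lambda>t. indicator {x+e<..} t *\<^sub>R h t" x]
    by (simp add: integrable_completion)
qed

context one_sided_weight
begin

lemma inverse_powr_eq: "0 < s \<Longrightarrow> c / s powr (1-\<alpha>) = s powr (\<alpha>-1) * c" for s c :: real
  by (simp add: powr_diff)

lemma frac_int_eq:
  assumes [measurable]: "f \<in> borel_measurable borel"
  shows "frac_int \<alpha> f x = 1 / Gamma \<alpha> * (LINT s|lborel. (if 0 < s then s powr (\<alpha>-1) * f (x+s) else 0))"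
proof -
  have "(LINT t:{x+0<..}|lebesgue. f t / (t-x) powr (1-\<alpha>))
    = (LINT s|lborel. (if 0 < s then f (x+s) / (x+s-x) powr (1-\<alpha>) else 0))"
    by (rule set_lebesgue_integral_Ioi_shift) measurable
  also have "\<dots> = (LINT s|lborel. (if 0 < s then s powr (\<alpha>-1) * f (x+s) else 0))"
    by (rule Bochner_Integration.integral_cong) (auto simp: inverse_powr_eq)
  finally show ?thesis by (simp add: frac_int_def)
qed

lemma frac_int_measurable [measurable]:
  assumes [measurable]: "f \<in> borel_measurable borel"
  shows "frac_int \<alpha> f \<in> borel_measurable borel"
  unfolding frac_int_eq[OF assms, abs_def] by measurable

lemma integrable_frac_int:
  assumes [measurable]: "f \<in> borel_measurable borel"
    and fin: "nn_frac_int (\<lambda>y. ennreal \<bar>f y\<bar>) x < top"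
  shows "integrable lborel (\<lambda>s. if 0 < s then s powr (\<alpha>-1) * f (x+s) else 0)"
proof (rule integrableI_bounded)
  have "(\<integral>\<^sup>+s. ennreal (norm (if 0 < s then s powr (\<alpha>-1) * f (x+s) else 0)) \<partial>lborel)
     = nn_frac_int (\<lambda>y. ennreal \<bar>f y\<bar>) x"
    unfolding nn_frac_int_def by (intro nn_integral_cong) (auto simp: abs_mult ennreal_mult)
  then show "(\<integral>\<^sup>+s. ennreal (norm (if 0 < s then s powr (\<alpha>-1) * f (x+s) else 0)) \<partial>lborel) < \<infinity>"
    using fin by simp
qed measurable

lemma frac_int_existsI:
  assumes [measurable]: "f \<in> borel_measurable borel"
    and fin: "nn_frac_int (\<lambda>y. ennreal \<bar>f y\<bar>) x < top"
  shows "frac_int_exists \<alpha> f x"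
proof -
  have "set_integrable lebesgue {x+0<..} (\<lambda>t. f t / (t-x) powr (1-\<alpha>))
    \<longleftrightarrow> integrable lborel (\<lambda>s. if 0 < s then f (x+s) / (x+s-x) powr (1-\<alpha>) else 0)"
    by (rule set_lebesgue_integral_Ioi_shift) measurable
  also have "(\<lambda>s. if 0 < s then f (x+s) / (x+s-x) powr (1-\<alpha>) else 0) = (\<lambda>s. if 0 < s then s powr (\<alpha>-1) * f (x+s) else 0)"
    by (auto simp: inverse_powr_eq)
  finally show ?thesis
    using integrable_frac_int[OF assms] by (simp add: frac_int_exists_def)
qed

definition kern_avg :: "real \<Rightarrow> (real \<Rightarrow> real) \<Rightarrow> real \<Rightarrow> real" where
  "kern_avg e f x = (LINT s|lborel. kern e s * f (x+s))"

lemma kern_avg_measurable [measurable]: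
  assumes [measurable]: "f \<in> borel_measurable borel"
  shows "kern_avg e f \<in> borel_measurable borel"
  unfolding kern_avg_def by measurable

text \<open>The inner integral of Fubini's theorem, with r = t - x. It is elementary because (s-r)/r
  has derivative -s/r^2. The integrand is singular at r = s, while the antiderivative is continuous
  there.\<close>

lemma has_integral_inner_kernel:
  assumes e: "0 < e" "e < s"
  shows "((\<lambda>r. r powr (-1-\<alpha>) * (s-r) powr (\<alpha>-1)) has_integral (((s-e)/e) powr \<alpha> / (\<alpha> * s))) {e..s}"
proof -
  define J where "J r = - (((s-r)/r) powr \<alpha>) / (\<alpha> * s)" for r
  have "((\<lambda>r. r powr (-1-\<alpha>) * (s-r) powr (\<alpha>-1)) has_integral (J s - J e)) {e..s}"
  proof (rule fundamental_theorem_of_calculus_interior)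
    show "continuous_on {e..s} J"
      unfolding J_def using e alpha by (intro continuous_intros continuous_on_powr') auto
    fix r assume r: "r \<in> {e<..<s}"
    then have r': "0 < r" "r < s" "0 < s" using e by auto
    have "((\<lambda>r. (s-r)/r) has_real_derivative - s / r^2) (at r)"
      using r' by (auto intro!: derivative_eq_intros simp: field_simps power2_eq_square)
    then have "((\<lambda>r. ((s-r)/r) powr \<alpha>) has_real_derivative \<alpha> * ((s-r)/r) powr (\<alpha>-1) * (- s / r^2)) (at r)"
      using r' by (intro DERIV_chain2[OF has_real_derivative_powr]) auto
    then have "((\<lambda>r. - (((s-r)/r) powr \<alpha>) / (\<alpha> * s)) has_real_derivative - (\<alpha> * ((s-r)/r) powr (\<alpha>-1) * (- s / r^2)) / (\<alpha> * s)) (at r)"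
      by (rule DERIV_cdivide[OF DERIV_minus])
    also have "- (\<alpha> * ((s-r)/r) powr (\<alpha>-1) * (- s / r^2)) / (\<alpha> * s) = ((s-r)/r) powr (\<alpha>-1) / r^2"
      using r' alpha by simp
    also have "\<dots> = r powr (-1-\<alpha>) * (s-r) powr (\<alpha>-1)"
    proof -
      have "r powr (\<alpha>-1) * r^2 = r powr (1+\<alpha>)"
        using r' by (simp add: powr_diff powr_add power2_eq_square)
      moreover have "r powr (-1-\<alpha>) = 1 / r powr (1+\<alpha>)"
        using powr_minus_divide[of r "1+\<alpha>"] by simp
      ultimately show ?thesis
        using r' by (simp add: powr_divide)
    qed
    finally show "(J has_vector_derivative r powr (-1-\<alpha>) * (s-r) powr (\<alpha>-1)) (at r)"
      unfolding J_def by (simp add: has_real_derivative_iff_has_vector_derivative)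
  qed (use e in auto)
  then show ?thesis by (simp add: J_def)
qed

lemma nn_integral_inner_kernel:
  assumes e: "0 < e"
  shows "(\<integral>\<^sup>+r. ennreal (if e < r \<and> r < s then r powr (-1-\<alpha>) * (s-r) powr (\<alpha>-1) else 0) \<partial>lborel)
    = ennreal (if e < s then ((s-e)/e) powr \<alpha> / (\<alpha> * s) else 0)"
proof (cases "e < s")
  case True
  have "(\<integral>\<^sup>+r. ennreal (if e < r \<and> r < s then r powr (-1-\<alpha>) * (s-r) powr (\<alpha>-1) else 0) \<partial>lborel)
    = (\<integral>\<^sup>+r. ennreal (r powr (-1-\<alpha>) * (s-r) powr (\<alpha>-1)) * indicator {e..s} r \<partial>lborel)"
  proof (rule nn_integral_cong_AE)
    show "AE r in lborel. ennreal (if e < r \<and> r < s then r powr (-1-\<alpha>) * (s-r) powr (\<alpha>-1) else 0)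
      = ennreal (r powr (-1-\<alpha>) * (s-r) powr (\<alpha>-1)) * indicator {e..s} r"
      using AE_lborel_singleton[of e] AE_lborel_singleton[of s]
      by eventually_elim (auto simp: indicator_def)
  qed
  also have "\<dots> = ennreal (((s-e)/e) powr \<alpha> / (\<alpha> * s))"
    by (rule nn_integral_has_integral_lebesgue'[OF _ has_integral_inner_kernel[OF e True]]) auto
  finally show ?thesis using True by simp
next
  case False
  then have "(\<integral>\<^sup>+r. ennreal (if e < r \<and> r < s then r powr (-1-\<alpha>) * (s-r) powr (\<alpha>-1) else 0) \<partial>lborel)
    = (\<integral>\<^sup>+(r::real). 0 \<partial>lborel)"
    by (intro nn_integral_cong) auto
  then show ?thesis using False by simp
qed

lemma has_bochner_integral_inner_kernel:
  assumes e: "0 < e"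
  shows "has_bochner_integral lborel (\<lambda>r. if e < r \<and> r < s then r powr (-1-\<alpha>) * (s-r) powr (\<alpha>-1) else 0)
    (if e < s then ((s-e)/e) powr \<alpha> / (\<alpha> * s) else 0)"
  by (rule has_bochner_integral_nn_integral)
     (use e alpha nn_integral_inner_kernel[OF e] in \<open>auto intro!: divide_nonneg_nonneg mult_nonneg_nonneg\<close>)

lemma has_bochner_integral_tail:
  assumes e: "0 < e"
  shows "has_bochner_integral lborel (\<lambda>r. if e < r then r powr (-1-\<alpha>) else 0) (e powr (-\<alpha>) / \<alpha>)"
proof (rule has_bochner_integral_nn_integral)
  have "((\<lambda>r. r powr (-1-\<alpha>)) has_integral (e powr (-\<alpha>) / \<alpha>)) {e..}"
    using has_integral_powr_to_inf[of "-1-\<alpha>" e] alpha e by simp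
  then have "(\<integral>\<^sup>+r. ennreal (r powr (-1-\<alpha>)) * indicator {e..} r \<partial>lborel) = ennreal (e powr (-\<alpha>) / \<alpha>)"
    by (intro nn_integral_has_integral_lebesgue') auto
  moreover have "(\<integral>\<^sup>+r. ennreal (if e < r then r powr (-1-\<alpha>) else 0) \<partial>lborel)
    = (\<integral>\<^sup>+r. ennreal (r powr (-1-\<alpha>)) * indicator {e..} r \<partial>lborel)"
  proof (rule nn_integral_cong_AE)
    show "AE r in lborel. ennreal (if e < r then r powr (-1-\<alpha>) else 0) = ennreal (r powr (-1-\<alpha>)) * indicator {e..} r"
      using AE_lborel_singleton[of e] by eventually_elim (auto simp: indicator_def)
  qed
  ultimately show "(\<integral>\<^sup>+r. ennreal (if e < r then r powr (-1-\<alpha>) else 0) \<partial>lborel) = ennreal (e powr (-\<alpha>) / \<alpha>)"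
    by simp
qed (use alpha in auto)

text \<open>It makes the double integral converge absolutely as soon as the fractional integral of
  |f| is finite at the single point x.\<close>

lemma inner_kernel_le:
  assumes e: "0 < e"
  shows "(if e < s then ((s-e)/e) powr \<alpha> / (\<alpha> * s) else 0) \<le> (if 0 < s then (e powr (-\<alpha>) / \<alpha>) * s powr (\<alpha>-1) else 0)"
proof (cases "e < s")
  case True
  have "((s-e)/e) powr \<alpha> \<le> (s/e) powr \<alpha>"
    using True e alpha by (intro powr_mono2) (auto simp: divide_right_mono)
  then have "((s-e)/e) powr \<alpha> / (\<alpha> * s) \<le> (s/e) powr \<alpha> / (\<alpha> * s)"
    using True e alpha by (intro divide_right_mono) auto
  also have "\<dots> = (e powr (-\<alpha>) / \<alpha>) * s powr (\<alpha>-1)"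
    using True e by (simp add: powr_divide powr_minus powr_diff field_simps)
  finally show ?thesis using True e by simp
qed (use alpha in auto)

text \<open>From Gamma(1-\<alpha>) = -\<alpha> * Gamma(-\<alpha>). The sign cancels the one with
  which \<open>kern_avg\<close> appears in \<open>trunc_frac_deriv_frac_int\<close>.\<close>

lemma Gamma_kern_const: "Gamma (-\<alpha>) * Gamma \<alpha> * (\<alpha> * kern_const) = -1"
proof -
  have "-\<alpha> \<notin> \<int>\<^sub>\<le>\<^sub>0"
  proof
    assume "-\<alpha> \<in> \<int>\<^sub>\<le>\<^sub>0"
    then obtain n :: int where "-\<alpha> = of_int n" by (auto elim!: nonpos_Ints_cases)
    with alpha have "-1 < n" "n < 0" by linarith+
    then show False by simp
  qed
  then have "Gamma (1-\<alpha>) = -\<alpha> * Gamma (-\<alpha>)"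
    using Gamma_plus1[of "-\<alpha>"] by simp
  moreover have "Gamma \<alpha> > 0" "Gamma (1-\<alpha>) > 0"
    using alpha by (auto intro: Gamma_real_pos)
  ultimately show ?thesis
    by (auto simp: kern_const_def field_simps)
qed

text \<open>The truncation keeps r = t - x away from 0, so the terms u(t) and u(x) can be integrated
  separately. Up to Gamma factors, Fubini's theorem turns the first into the integral of
  \<open>B s * f (x+s)\<close>, and the second is e^(-\<alpha>)/\<alpha> times the integral of
  \<open>R\<close>. The difference of the two kernels is a negative multiple of
  \<open>kern e s\<close>.\<close>

lemma trunc_frac_deriv_frac_int:
  assumes e: "0 < e" and f [measurable]: "f \<in> borel_measurable borel"
    and fin: "nn_frac_int (\<lambda>y. ennreal \<bar>f y\<bar>) x < top"
  shows "trunc_frac_deriv_exists \<alpha> e (frac_int \<alpha> f) x"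
    and "trunc_frac_deriv \<alpha> e (frac_int \<alpha> f) x = kern_avg e f x"
proof -
  define u where "u = frac_int \<alpha> f"
  define R where "R s = (if 0 < s then s powr (\<alpha>-1) * f (x+s) else 0)" for s
  define B where "B s = (if e < s then ((s-e)/e) powr \<alpha> / (\<alpha> * s) else 0)" for s
  define F where "F r s = (if e < r \<and> r < s then r powr (-1-\<alpha>) * (s-r) powr (\<alpha>-1) else 0) * f (x+s)" for r s
  have Ga: "Gamma \<alpha> > 0" using alpha by (auto intro: Gamma_real_pos)
  have [measurable]: "u \<in> borel_measurable borel" "case_prod F \<in> borel_measurable (lborel \<Otimes>\<^sub>M lborel)"
    unfolding u_def F_def by measurable
  have R: "integrable lborel R"
    unfolding R_def by (rule integrable_frac_int[OF f fin])
  have int2: "integrable (lborel \<Otimes>\<^sub>M lborel) (case_prod F)"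
  proof (rule integrableI_bounded)
    have "(\<integral>\<^sup>+z. ennreal (norm (case_prod F z)) \<partial>(lborel \<Otimes>\<^sub>M lborel)) = (\<integral>\<^sup>+s. (\<integral>\<^sup>+r. ennreal (norm (F r s)) \<partial>lborel) \<partial>lborel)"
      by (subst lborel_pair.nn_integral_snd[symmetric]) auto
    also have "\<dots> = (\<integral>\<^sup>+s. ennreal (B s) * ennreal \<bar>f (x+s)\<bar> \<partial>lborel)"
    proof (rule nn_integral_cong)
      fix s
      have "(\<integral>\<^sup>+r. ennreal (norm (F r s)) \<partial>lborel)
        = (\<integral>\<^sup>+r. ennreal (if e < r \<and> r < s then r powr (-1-\<alpha>) * (s-r) powr (\<alpha>-1) else 0) * ennreal \<bar>f (x+s)\<bar> \<partial>lborel)"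
        by (intro nn_integral_cong) (auto simp: F_def abs_mult ennreal_mult)
      then show "(\<integral>\<^sup>+r. ennreal (norm (F r s)) \<partial>lborel) = ennreal (B s) * ennreal \<bar>f (x+s)\<bar>"
        by (simp add: nn_integral_multc nn_integral_inner_kernel[OF e] B_def)
    qed
    also have "\<dots> \<le> (\<integral>\<^sup>+s. ennreal (e powr (-\<alpha>) / \<alpha>) * (if 0 < s then ennreal (s powr (\<alpha>-1)) * ennreal \<bar>f (x+s)\<bar> else 0) \<partial>lborel)"
    proof (rule nn_integral_mono)
      fix s
      have "ennreal (B s) \<le> ennreal (if 0 < s then (e powr (-\<alpha>) / \<alpha>) * s powr (\<alpha>-1) else 0)"
        unfolding B_def by (intro ennreal_leI inner_kernel_le e)
      also have "\<dots> = ennreal (e powr (-\<alpha>) / \<alpha>) * (if 0 < s then ennreal (s powr (\<alpha>-1)) else 0)"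
        using alpha by (auto simp: ennreal_mult[symmetric])
      finally have "ennreal (B s) * ennreal \<bar>f (x+s)\<bar>
        \<le> ennreal (e powr (-\<alpha>) / \<alpha>) * (if 0 < s then ennreal (s powr (\<alpha>-1)) else 0) * ennreal \<bar>f (x+s)\<bar>"
        by (rule mult_right_mono) auto
      then show "ennreal (B s) * ennreal \<bar>f (x+s)\<bar>
        \<le> ennreal (e powr (-\<alpha>) / \<alpha>) * (if 0 < s then ennreal (s powr (\<alpha>-1)) * ennreal \<bar>f (x+s)\<bar> else 0)"
        by (auto simp: mult.assoc split: if_splits)
    qed
    also have "\<dots> = ennreal (e powr (-\<alpha>) / \<alpha>) * nn_frac_int (\<lambda>y. ennreal \<bar>f y\<bar>) x"
      unfolding nn_frac_int_def by (rule nn_integral_cmult) auto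
    also have "\<dots> < \<infinity>"
      using fin by (simp add: ennreal_mult_less_top)
    finally show "(\<integral>\<^sup>+z. ennreal (norm (case_prod F z)) \<partial>(lborel \<Otimes>\<^sub>M lborel)) < \<infinity>" .
  qed measurable
  \<comment> \<open>Where the integral defining u(x+r) diverges, both sides take the default value
    0, so the identity has no exceptional r.\<close>
  have inner_s: "(LINT s|lborel. F r s) = (if e < r then r powr (-1-\<alpha>) * (Gamma \<alpha> * u (x+r)) else 0)" for r
  proof (cases "e < r")
    case True
    have "u (x+r) = 1 / Gamma \<alpha> * (LINT s|lborel. (if 0 < s then s powr (\<alpha>-1) * f (x+r+s) else 0))"
      unfolding u_def by (rule frac_int_eq) fact
    also have "(LINT s|lborel. (if 0 < s then s powr (\<alpha>-1) * f (x+r+s) else 0))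
      = (LINT s|lborel. (if r < s then (s-r) powr (\<alpha>-1) * f (x+s) else 0))"
      by (subst lborel_integral_real_affine[of 1 _ "-r"])
         (auto intro!: Bochner_Integration.integral_cong simp: algebra_simps)
    finally have "r powr (-1-\<alpha>) * (Gamma \<alpha> * u (x+r)) = (LINT s|lborel. r powr (-1-\<alpha>) * (if r < s then (s-r) powr (\<alpha>-1) * f (x+s) else 0))"
      using Ga by simp
    also have "\<dots> = (LINT s|lborel. F r s)"
      using True by (intro Bochner_Integration.integral_cong) (auto simp: F_def)
    finally show ?thesis using True by simp
  qed (simp add: F_def)
  have inner_r: "(LINT r|lborel. F r s) = B s * f (x+s)" for s
    using has_bochner_integral_inner_kernel[OF e, of s, THEN has_bochner_integral_integral_eq]
    by (simp add: F_def B_def)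
  have I1: "integrable lborel (\<lambda>r. if e < r then r powr (-1-\<alpha>) * (Gamma \<alpha> * u (x+r)) else 0)"
    using lborel_pair.integrable_fst[OF int2] by (simp add: inner_s)
  have I2: "(LINT r|lborel. (if e < r then r powr (-1-\<alpha>) * (Gamma \<alpha> * u (x+r)) else 0)) = (LINT s|lborel. B s * f (x+s))"
    using lborel_pair.Fubini_integral[OF int2] by (simp add: inner_s inner_r)
  have I3: "integrable lborel (\<lambda>s. B s * f (x+s))"
    using lborel_pair.integrable_snd[OF int2] by (simp add: inner_r)
  note T = has_bochner_integral_tail[OF e]
  have heq: "(\<lambda>r. if e < r then (u (x+r) - u x) / (x+r-x) powr (1+\<alpha>) else 0)
    = (\<lambda>r. 1 / Gamma \<alpha> * (if e < r then r powr (-1-\<alpha>) * (Gamma \<alpha> * u (x+r)) else 0)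
        - u x * (if e < r then r powr (-1-\<alpha>) else 0))"
  proof
    fix r
    have "1 / r powr (1+\<alpha>) = r powr (-1-\<alpha>)"
      using powr_minus_divide[of r "1+\<alpha>"] by simp
    then have "(u (x+r) - u x) / r powr (1+\<alpha>) = (u (x+r) - u x) * r powr (-1-\<alpha>)"
      by (metis divide_inverse inverse_eq_divide)
    then show "(if e < r then (u (x+r) - u x) / (x+r-x) powr (1+\<alpha>) else 0)
      = 1 / Gamma \<alpha> * (if e < r then r powr (-1-\<alpha>) * (Gamma \<alpha> * u (x+r)) else 0)
        - u x * (if e < r then r powr (-1-\<alpha>) else 0)"
      using Ga by (simp add: algebra_simps)
  qed
  have [measurable]: "(\<lambda>t. (u t - u x) / (t-x) powr (1+\<alpha>)) \<in> borel_measurable borel"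
    by measurable
  have "integrable lborel (\<lambda>r. if e < r then (u (x+r) - u x) / (x+r-x) powr (1+\<alpha>) else 0)"
    unfolding heq using I1 T by (intro Bochner_Integration.integrable_diff integrable_mult_right) (auto simp: has_bochner_integral_iff)
  then show "trunc_frac_deriv_exists \<alpha> e (frac_int \<alpha> f) x"
    unfolding trunc_frac_deriv_exists_def u_def[symmetric]
    by (subst set_lebesgue_integral_Ioi_shift(2)) auto
  have "(LINT t:{x+e<..}|lebesgue. (u t - u x) / (t-x) powr (1+\<alpha>))
    = 1 / Gamma \<alpha> * (LINT s|lborel. B s * f (x+s)) - u x * (e powr (-\<alpha>) / \<alpha>)"
    apply (subst set_lebesgue_integral_Ioi_shift(1), measurable)
    unfolding heq
    apply (subst Bochner_Integration.integral_diff)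
    using I1 T by (auto simp: I2 has_bochner_integral_iff)
  also have "1 / Gamma \<alpha> * (LINT s|lborel. B s * f (x+s)) - u x * (e powr (-\<alpha>) / \<alpha>)
    = 1 / Gamma \<alpha> * (LINT s|lborel. B s * f (x+s)) - 1 / Gamma \<alpha> * (LINT s|lborel. R s) * (e powr (-\<alpha>) / \<alpha>)"
    unfolding u_def R_def frac_int_eq[OF f] ..
  also have "1 / Gamma \<alpha> * (LINT s|lborel. B s * f (x+s)) - 1 / Gamma \<alpha> * (LINT s|lborel. R s) * (e powr (-\<alpha>) / \<alpha>)
    = 1 / Gamma \<alpha> * (LINT s|lborel. B s * f (x+s) - (e powr (-\<alpha>) / \<alpha>) * R s)"
    using I3 R by (subst Bochner_Integration.integral_diff) (auto simp: algebra_simps)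
  also have "(LINT s|lborel. B s * f (x+s) - (e powr (-\<alpha>) / \<alpha>) * R s) = (LINT s|lborel. - 1 / (\<alpha> * kern_const) * (kern e s * f (x+s)))"
  proof (rule Bochner_Integration.integral_cong[OF refl])
    fix s
    show "B s * f (x+s) - (e powr (-\<alpha>) / \<alpha>) * R s = - 1 / (\<alpha> * kern_const) * (kern e s * f (x+s))"
    proof (cases "0 < s")
      case True
      have 1: "B s = max 0 (s/e-1) powr \<alpha> / (\<alpha> * s)"
      proof (cases "e < s")
        case True
        then have "max 0 (s/e-1) = (s-e)/e" using e by (auto simp: max_def field_simps)
        then show ?thesis using True by (simp add: B_def)
      next
        case False
        then have "max 0 (s/e-1) = 0" using e by (auto simp: max_def field_simps)
        then show ?thesis using False by (simp add: B_def)
      qed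
      have 2: "(e powr (-\<alpha>) / \<alpha>) * R s = (s/e) powr \<alpha> / (\<alpha> * s) * f (x+s)"
        using True e by (simp add: R_def powr_divide powr_minus powr_diff field_simps)
      have "kern e s = kern_const / s * ((s/e) powr \<alpha> - max 0 (s/e-1) powr \<alpha>)"
        using True by (simp add: kern_def)
      then have "- 1 / (\<alpha> * kern_const) * (kern e s * f (x+s)) = - 1 / (\<alpha> * s) * ((s/e) powr \<alpha> - max 0 (s/e-1) powr \<alpha>) * f (x+s)"
        using kern_const_pos by simp
      then show ?thesis unfolding 1 2 using True alpha by (simp add: field_simps)
    qed (use e in \<open>auto simp: B_def R_def kern_def\<close>)
  qed
  also have "\<dots> = - 1 / (\<alpha> * kern_const) * kern_avg e f x"
    unfolding kern_avg_def by (rule integral_mult_right_zero)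
  finally have "trunc_frac_deriv \<alpha> e u x = 1 / Gamma (-\<alpha>) * (1 / Gamma \<alpha> * (- 1 / (\<alpha> * kern_const) * kern_avg e f x))"
    by (simp add: trunc_frac_deriv_def)
  also have "\<dots> = - 1 / (Gamma (-\<alpha>) * Gamma \<alpha> * (\<alpha> * kern_const)) * kern_avg e f x"
    by simp
  also have "\<dots> = kern_avg e f x"
    unfolding Gamma_kern_const by simp
  finally show "trunc_frac_deriv \<alpha> e (frac_int \<alpha> f) x = kern_avg e f x"
    by (simp add: u_def)
qed

end

section \<open>Pointwise convergence\<close>

text \<open>One-sided, because \<open>kern e\<close> lives on s > 0. In ennreal the bound includes
  integrability to the right of x.\<close>

definition right_lebesgue_point :: "(real \<Rightarrow> real) \<Rightarrow> real \<Rightarrow> bool" where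
  "right_lebesgue_point f x \<longleftrightarrow> (\<forall>\<eta>>0. \<exists>d>0. \<forall>h. 0 < h \<and> h < d \<longrightarrow>
     (\<integral>\<^sup>+s. (if 0 < s \<and> s < h then ennreal \<bar>f (x+s) - f x\<bar> else 0) \<partial>lborel) \<le> ennreal (\<eta> * h))"

text \<open>Outside one null set the right averages of |f - r| converge to |f x - r| for every
  rational r. A rational r close to f x then controls the averages of |f - f x|.\<close>

lemma AE_right_lebesgue_point:
  fixes f :: "real \<Rightarrow> real"
  assumes [measurable]: "f \<in> borel_measurable borel"
    and loc: "\<And>a b. (\<integral>\<^sup>+y. (if a \<le> y \<and> y \<le> b then ennreal \<bar>f y\<bar> else 0) \<partial>lborel) < top"
  shows "AE x in lborel. right_lebesgue_point f x"
proof -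
  define \<phi> where "\<phi> r y = \<bar>f y - real_of_rat r\<bar>" for r y
  have [measurable]: "\<phi> r \<in> borel_measurable borel" for r
    unfolding \<phi>_def by measurable
  have \<phi>_nonneg: "0 \<le> \<phi> r y" for r y
    by (simp add: \<phi>_def)
  have tri: "\<bar>f y - real_of_rat r\<bar> \<le> \<bar>f y\<bar> + real_of_rat \<bar>r\<bar>" for y r
    using abs_triangle_ineq4[of "f y" "real_of_rat r"] by simp
  have int: "set_integrable lborel {a..b} (\<phi> r)" for a b r
    unfolding set_integrable_def
  proof (rule integrableI_bounded)
    have "(\<integral>\<^sup>+y. ennreal (norm (indicator {a..b} y *\<^sub>R \<phi> r y)) \<partial>lborel)
      \<le> (\<integral>\<^sup>+y. (if a \<le> y \<and> y \<le> b then ennreal \<bar>f y\<bar> else 0) + ennreal \<bar>real_of_rat r\<bar> * indicator {a..b} y \<partial>lborel)"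
      by (intro nn_integral_mono) (auto simp: indicator_def \<phi>_def ennreal_plus[symmetric] simp del: ennreal_plus intro!: ennreal_leI tri)
    also have "\<dots> = (\<integral>\<^sup>+y. (if a \<le> y \<and> y \<le> b then ennreal \<bar>f y\<bar> else 0) \<partial>lborel) + ennreal \<bar>real_of_rat r\<bar> * emeasure lborel {a..b}"
      by (subst nn_integral_add) (auto simp: nn_integral_cmult_indicator)
    also have "\<dots> < \<infinity>"
      using loc[of a b] by (auto simp: ennreal_mult_less_top emeasure_lborel_Icc_eq)
    finally show "(\<integral>\<^sup>+y. ennreal (norm (indicator {a..b} y *\<^sub>R \<phi> r y)) \<partial>lborel) < \<infinity>" .
  qed measurable
  have "\<exists>N. negligible N \<and> (\<forall>x e. x \<notin> N \<and> 0 < e \<longrightarrow>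
     (\<exists>d>0. \<forall>h. 0 < h \<and> h < d \<longrightarrow> \<bar>integral {x..x+h} (\<phi> r) / h - \<phi> r x\<bar> < e))" for r
  proof -
    have "\<phi> r integrable_on cbox a b" for a b
      using set_borel_integral_eq_integral(1)[OF int] by simp
    from integrable_ccontinuous_explicit[OF this] show ?thesis
      by (simp add: divide_inverse mult.commute) metis
  qed
  then obtain N where N: "\<And>r. negligible (N r)"
    and conv: "\<And>r x e. x \<notin> N r \<Longrightarrow> 0 < e \<Longrightarrow>
      \<exists>d>0. \<forall>h. 0 < h \<and> h < d \<longrightarrow> \<bar>integral {x..x+h} (\<phi> r) / h - \<phi> r x\<bar> < e"
    by metis
  have "negligible (\<Union>r. N r)"
    using N by (intro negligible_countable_Union) (auto intro: countable_image)
  then have "AE x in lebesgue. x \<notin> (\<Union>r. N r)"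
    unfolding negligible_iff_null_sets by (rule AE_not_in)
  then have "AE x in lborel. x \<notin> (\<Union>r. N r)"
    by (simp only: AE_completion_iff)
  then show ?thesis
  proof eventually_elim
    case (elim x)
    show ?case
      unfolding right_lebesgue_point_def
    proof (intro allI impI)
      fix \<eta> :: real assume \<eta>: "0 < \<eta>"
      obtain r where r: "\<bar>f x - real_of_rat r\<bar> < \<eta>/4"
      proof -
        obtain r where "f x - \<eta>/4 < real_of_rat r" "real_of_rat r < f x + \<eta>/4"
          using of_rat_dense[of "f x - \<eta>/4" "f x + \<eta>/4"] \<eta> by auto
        then show ?thesis by (intro that[of r]) linarith
      qed
      obtain d where d: "0 < d" "\<And>h. 0 < h \<Longrightarrow> h < d \<Longrightarrow> \<bar>integral {x..x+h} (\<phi> r) / h - \<phi> r x\<bar> < \<eta>/4"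
        using conv[of x r "\<eta>/4"] elim \<eta> by auto
      show "\<exists>d>0. \<forall>h. 0 < h \<and> h < d \<longrightarrow>
         (\<integral>\<^sup>+s. (if 0 < s \<and> s < h then ennreal \<bar>f (x+s) - f x\<bar> else 0) \<partial>lborel) \<le> ennreal (\<eta> * h)"
      proof (intro exI[of _ d] conjI allI impI)
        fix h assume h: "0 < h \<and> h < d"
        then have "integral {x..x+h} (\<phi> r) / h < \<phi> r x + \<eta>/4"
          using d(2)[of h] by linarith
        then have I: "integral {x..x+h} (\<phi> r) \<le> (\<phi> r x + \<eta>/4) * h"
          using h by (simp add: field_simps)
        have "(\<phi> r has_integral integral {x..x+h} (\<phi> r)) {x..x+h}"
          using set_borel_integral_eq_integral(1)[OF int] by blast
        then have nnI: "(\<integral>\<^sup>+y. ennreal (\<phi> r y) * indicator {x..x+h} y \<partial>lborel) = ennreal (integral {x..x+h} (\<phi> r))"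
          by (intro nn_integral_has_integral_lebesgue' \<phi>_nonneg)
        have "(\<integral>\<^sup>+s. (if 0 < s \<and> s < h then ennreal \<bar>f (x+s) - f x\<bar> else 0) \<partial>lborel)
          \<le> (\<integral>\<^sup>+s. ennreal (\<phi> r (x+s)) * indicator {x..x+h} (x+s) + ennreal (\<eta>/4) * indicator {x..x+h} (x+s) \<partial>lborel)"
        proof (rule nn_integral_mono)
          fix s
          have "\<bar>f (x+s) - f x\<bar> \<le> \<phi> r (x+s) + \<eta>/4"
            using r unfolding \<phi>_def by linarith
          then have "ennreal \<bar>f (x+s) - f x\<bar> \<le> ennreal (\<phi> r (x+s)) + ennreal (\<eta>/4)"
            using \<eta> by (subst ennreal_plus[symmetric]) (auto simp: \<phi>_nonneg simp del: ennreal_plus intro: ennreal_leI)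
          then show "(if 0 < s \<and> s < h then ennreal \<bar>f (x+s) - f x\<bar> else 0)
            \<le> ennreal (\<phi> r (x+s)) * indicator {x..x+h} (x+s) + ennreal (\<eta>/4) * indicator {x..x+h} (x+s)"
            by (auto simp: indicator_def)
        qed
        also have "\<dots> = (\<integral>\<^sup>+y. ennreal (\<phi> r y) * indicator {x..x+h} y + ennreal (\<eta>/4) * indicator {x..x+h} y \<partial>lborel)"
          by (rule nn_integral_shift[of "\<lambda>y. ennreal (\<phi> r y) * indicator {x..x+h} y + ennreal (\<eta>/4) * indicator {x..x+h} y"]) measurable
        also have "\<dots> = (\<integral>\<^sup>+y. ennreal (\<phi> r y) * indicator {x..x+h} y \<partial>lborel) + ennreal (\<eta>/4) * emeasure lborel {x..x+h}"
          by (subst nn_integral_add) (auto simp: nn_integral_cmult_indicator)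
        also have "\<dots> = ennreal (integral {x..x+h} (\<phi> r)) + ennreal (\<eta>/4 * h)"
          using h \<eta> by (simp add: nnI ennreal_mult[symmetric])
        also have "\<dots> = ennreal (integral {x..x+h} (\<phi> r) + \<eta>/4 * h)"
          using h \<eta> by (intro ennreal_plus[symmetric] Henstock_Kurzweil_Integration.integral_nonneg)
            (auto simp: \<phi>_nonneg intro: set_borel_integral_eq_integral(1)[OF int])
        also have "\<dots> \<le> ennreal (\<eta> * h)"
        proof (rule ennreal_leI)
          have "(\<phi> r x + \<eta>/4) * h \<le> (\<eta>/2) * h"
            using r h by (intro mult_right_mono) (auto simp: \<phi>_def)
          moreover have "(\<eta>/2) * h + \<eta>/4 * h \<le> \<eta> * h"
            using h \<eta> by simp
          ultimately show "integral {x..x+h} (\<phi> r) + \<eta>/4 * h \<le> \<eta> * h"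
            using I by linarith
        qed
        finally show "(\<integral>\<^sup>+s. (if 0 < s \<and> s < h then ennreal \<bar>f (x+s) - f x\<bar> else 0) \<partial>lborel) \<le> ennreal (\<eta> * h)" .
      qed (use d in auto)
    qed
  qed
qed

context one_sided_weight
begin

lemma major_avg_add:
  assumes [measurable]: "g \<in> borel_measurable borel" "h \<in> borel_measurable borel"
  shows "major_avg (\<lambda>y. g y + h y) e x = major_avg g e x + major_avg h e x"
  unfolding major_avg_def by (subst nn_integral_add[symmetric]) (auto simp: distrib_left)

text \<open>The cutoff at x + \<delta> confines the shell to (0, min (2l) \<delta>), where
  \<open>H\<close> applies. The bound is therefore uniform over all radii l, including large
  ones.\<close>

lemma shell_avg_truncated_le:
  assumes [measurable]: "g \<in> borel_measurable borel"
    and l: "0 < l" and d: "0 < \<delta>" and \<eta>: "0 < \<eta>"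
    and H: "\<And>h. 0 < h \<Longrightarrow> h \<le> \<delta> \<Longrightarrow> (\<integral>\<^sup>+s. (if 0 < s \<and> s < h then g (x+s) else 0) \<partial>lborel) \<le> ennreal (\<eta> * h)"
  shows "shell_avg (\<lambda>y. if y < x + \<delta> then g y else 0) l x \<le> ennreal (2 * \<eta>)"
proof -
  have "(\<integral>\<^sup>+s. (if l < s \<and> s < 2*l then (if x+s < x+\<delta> then g (x+s) else 0) else 0) \<partial>lborel)
    \<le> (\<integral>\<^sup>+s. (if 0 < s \<and> s < min (2*l) \<delta> then g (x+s) else 0) \<partial>lborel)"
    using l by (intro nn_integral_mono) auto
  also have "\<dots> \<le> ennreal (\<eta> * min (2*l) \<delta>)"
    using l d by (intro H) auto
  also have "\<dots> \<le> ennreal (\<eta> * (2*l))"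
    using \<eta> by (intro ennreal_leI mult_left_mono) auto
  finally have "shell_avg (\<lambda>y. if y < x + \<delta> then g y else 0) l x \<le> ennreal (1/l) * ennreal (\<eta> * (2*l))"
    unfolding shell_avg_def by (intro mult_left_mono) auto
  also have "\<dots> = ennreal (2 * \<eta>)"
    using l \<eta> by (simp add: ennreal_mult[symmetric])
  finally show ?thesis .
qed

text \<open>Uses the branch u^(\<alpha>-2) of \<open>major\<close>; scaling leaves e^(2-\<alpha>)/e
  = e^(1-\<alpha>), which tends to 0 with e.\<close>

lemma major_avg_far_le:
  assumes [measurable]: "g \<in> borel_measurable borel" and e: "0 < e" and d: "0 < \<delta>"
  shows "major_avg (\<lambda>y. if y < x + \<delta> then 0 else g y) e x
    \<le> ennreal (e powr (1-\<alpha>)) * (\<integral>\<^sup>+s. (if \<delta> \<le> s then ennreal (s powr (\<alpha>-2)) * g (x+s) else 0) \<partial>lborel)"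
proof -
  have "major_avg (\<lambda>y. if y < x + \<delta> then 0 else g y) e x
    \<le> (\<integral>\<^sup>+s. ennreal (e powr (1-\<alpha>)) * (if \<delta> \<le> s then ennreal (s powr (\<alpha>-2)) * g (x+s) else 0) \<partial>lborel)"
    unfolding major_avg_def
  proof (rule nn_integral_mono)
    fix s
    show "ennreal (major (s/e) / e) * (if x+s < x+\<delta> then 0 else g (x+s))
      \<le> ennreal (e powr (1-\<alpha>)) * (if \<delta> \<le> s then ennreal (s powr (\<alpha>-2)) * g (x+s) else 0)"
    proof (cases "\<delta> \<le> s")
      case True
      then have s: "0 < s" using d by simp
      have "major (s/e) / e \<le> (s/e) powr (\<alpha>-2) / e"
        using s e by (intro divide_right_mono) (auto simp: major_def)
      also have "\<dots> = e powr (1-\<alpha>) * s powr (\<alpha>-2)"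
      proof -
        have "e powr (\<alpha>-2) * e = e powr (\<alpha>-1)"
          using e powr_add[of e "\<alpha>-2" 1] by simp
        moreover have "e powr (1-\<alpha>) = 1 / e powr (\<alpha>-1)"
          using powr_minus_divide[of e "\<alpha>-1"] by simp
        ultimately show ?thesis using s e by (simp add: powr_divide)
      qed
      finally have "ennreal (major (s/e) / e) \<le> ennreal (e powr (1-\<alpha>)) * ennreal (s powr (\<alpha>-2))"
        by (subst ennreal_mult[symmetric]) (auto intro: ennreal_leI)
      then show ?thesis using True by (auto simp: mult.assoc[symmetric] intro: mult_right_mono)
    qed auto
  qed
  also have "\<dots> = ennreal (e powr (1-\<alpha>)) * (\<integral>\<^sup>+s. (if \<delta> \<le> s then ennreal (s powr (\<alpha>-2)) * g (x+s) else 0) \<partial>lborel)"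
    by (rule nn_integral_cmult) auto
  finally show ?thesis .
qed

text \<open>For s \<ge> \<delta> the weight s^(\<alpha>-2) is at most s^(\<alpha>-1)/\<delta>, so f
  is controlled by its fractional integral; the constant c is controlled by the integrability of
  s^(\<alpha>-2) at infinity.\<close>

lemma nn_integral_far_finite:
  assumes [measurable]: "f \<in> borel_measurable borel" and d: "0 < \<delta>"
    and fin: "nn_frac_int (\<lambda>y. ennreal \<bar>f y\<bar>) x < top"
  shows "(\<integral>\<^sup>+s. (if \<delta> \<le> s then ennreal (s powr (\<alpha>-2)) * ennreal \<bar>f (x+s) - c\<bar> else 0) \<partial>lborel) < top"
proof -
  have P: "(\<integral>\<^sup>+s. ennreal (s powr (\<alpha>-2)) * indicator {\<delta>..} s \<partial>lborel) < top"
    using nn_integral_has_integral_lebesgue'[OF _ has_integral_powr_to_inf[of "\<alpha>-2" \<delta>]] alpha d by simp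
  have "(\<integral>\<^sup>+s. (if \<delta> \<le> s then ennreal (s powr (\<alpha>-2)) * ennreal \<bar>f (x+s) - c\<bar> else 0) \<partial>lborel)
    \<le> (\<integral>\<^sup>+s. ennreal (1/\<delta>) * (if 0 < s then ennreal (s powr (\<alpha>-1)) * ennreal \<bar>f (x+s)\<bar> else 0)
        + ennreal \<bar>c\<bar> * (ennreal (s powr (\<alpha>-2)) * indicator {\<delta>..} s) \<partial>lborel)"
  proof (rule nn_integral_mono)
    fix s
    show "(if \<delta> \<le> s then ennreal (s powr (\<alpha>-2)) * ennreal \<bar>f (x+s) - c\<bar> else 0)
      \<le> ennreal (1/\<delta>) * (if 0 < s then ennreal (s powr (\<alpha>-1)) * ennreal \<bar>f (x+s)\<bar> else 0)
        + ennreal \<bar>c\<bar> * (ennreal (s powr (\<alpha>-2)) * indicator {\<delta>..} s)"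
    proof (cases "\<delta> \<le> s")
      case True
      then have s: "0 < s" using d by simp
      have "s powr (\<alpha>-2) = 1/s * s powr (\<alpha>-1)"
        using s by (simp add: powr_diff power2_eq_square)
      also have "\<dots> \<le> 1/\<delta> * s powr (\<alpha>-1)"
        using True d by (intro mult_right_mono) (auto simp: frac_le)
      finally have "s powr (\<alpha>-2) * \<bar>f (x+s)\<bar> \<le> 1/\<delta> * s powr (\<alpha>-1) * \<bar>f (x+s)\<bar>"
        by (rule mult_right_mono) auto
      moreover have "s powr (\<alpha>-2) * \<bar>f (x+s) - c\<bar> \<le> s powr (\<alpha>-2) * (\<bar>f (x+s)\<bar> + \<bar>c\<bar>)"
        by (intro mult_left_mono) auto
      ultimately have "s powr (\<alpha>-2) * \<bar>f (x+s) - c\<bar> \<le> 1/\<delta> * (s powr (\<alpha>-1) * \<bar>f (x+s)\<bar>) + \<bar>c\<bar> * s powr (\<alpha>-2)"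
        by (simp add: algebra_simps)
      then have "ennreal (s powr (\<alpha>-2) * \<bar>f (x+s) - c\<bar>) \<le> ennreal (1/\<delta> * (s powr (\<alpha>-1) * \<bar>f (x+s)\<bar>) + \<bar>c\<bar> * s powr (\<alpha>-2))"
        by (rule ennreal_leI)
      then show ?thesis using True s d
        by (simp add: ennreal_mult ennreal_plus indicator_def del: times_divide_eq_left)
    qed auto
  qed
  also have "\<dots> = ennreal (1/\<delta>) * nn_frac_int (\<lambda>y. ennreal \<bar>f y\<bar>) x
     + ennreal \<bar>c\<bar> * (\<integral>\<^sup>+s. ennreal (s powr (\<alpha>-2)) * indicator {\<delta>..} s \<partial>lborel)"
    unfolding nn_frac_int_def
    by (subst nn_integral_add, measurable, subst nn_integral_cmult, measurable, subst nn_integral_cmult) auto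
  also have "\<dots> < top"
    using fin P by (simp add: ennreal_mult_less_top)
  finally show ?thesis .
qed

lemma major_avg_small:
  assumes [measurable]: "f \<in> borel_measurable borel"
    and fin: "nn_frac_int (\<lambda>y. ennreal \<bar>f y\<bar>) x < top"
    and leb: "right_lebesgue_point f x" and \<eta>: "0 < \<eta>"
  shows "\<forall>\<^sub>F e in at_right 0. major_avg (\<lambda>y. ennreal \<bar>f y - f x\<bar>) e x \<le> ennreal \<eta>"
proof -
  define g where "g y = ennreal \<bar>f y - f x\<bar>" for y
  have [measurable]: "g \<in> borel_measurable borel" unfolding g_def by measurable
  \<comment> \<open>The near part will be at most 2 * major_mass * (2 * \<eta>') = \<eta>/2.\<close>
  define \<eta>' where "\<eta>' = \<eta> / (8 * major_mass)"
  have \<eta>': "0 < \<eta>'" using \<eta> major_mass_pos by (simp add: \<eta>'_def)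
  obtain d where d: "0 < d" "\<And>h. 0 < h \<Longrightarrow> h < d \<Longrightarrow>
      (\<integral>\<^sup>+s. (if 0 < s \<and> s < h then g (x+s) else 0) \<partial>lborel) \<le> ennreal (\<eta>' * h)"
    using leb \<eta>' unfolding right_lebesgue_point_def g_def by meson
  \<comment> \<open>The estimate at the Lebesgue point holds for h < d, whereas
    \<open>shell_avg_truncated_le\<close> asks for h \<le> \<delta>.\<close>
  define \<delta> where "\<delta> = d/2"
  have \<delta>: "0 < \<delta>" using d by (simp add: \<delta>_def)
  define A where "A = (\<integral>\<^sup>+s. (if \<delta> \<le> s then ennreal (s powr (\<alpha>-2)) * g (x+s) else 0) \<partial>lborel)"
  have "A < top"
    unfolding A_def g_def by (rule nn_integral_far_finite) (use \<delta> fin in auto)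
  then obtain a where a: "A = ennreal a" "0 \<le> a"
    by (cases A rule: ennreal_cases) auto
  have near: "major_avg (\<lambda>y. if y < x + \<delta> then g y else 0) e x \<le> ennreal (\<eta>/2)" if e: "0 < e" for e
  proof -
    have "major_avg (\<lambda>y. if y < x + \<delta> then g y else 0) e x
      \<le> 2 * (\<integral>\<^sup>+t. ennreal (major t) * shell_avg (\<lambda>y. if y < x + \<delta> then g y else 0) (t*e) x \<partial>lborel)"
      by (rule major_avg_le_shell_avg[OF e]) measurable
    also have "\<dots> \<le> 2 * (\<integral>\<^sup>+t. ennreal (major t) * ennreal (2 * \<eta>') \<partial>lborel)"
    proof (rule mult_left_mono, rule nn_integral_mono)
      fix t
      show "ennreal (major t) * shell_avg (\<lambda>y. if y < x + \<delta> then g y else 0) (t*e) x \<le> ennreal (major t) * ennreal (2 * \<eta>')"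
      proof (cases "0 < t")
        case True
        have "shell_avg (\<lambda>y. if y < x + \<delta> then g y else 0) (t*e) x \<le> ennreal (2 * \<eta>')"
          by (rule shell_avg_truncated_le) (use True e \<delta> \<eta>' d in \<open>auto simp: \<delta>_def\<close>)
        then show ?thesis by (rule mult_left_mono) auto
      qed (auto simp: major_def)
    qed auto
    also have "(\<integral>\<^sup>+t. ennreal (major t) * ennreal (2 * \<eta>') \<partial>lborel) = ennreal (major_mass * (2 * \<eta>'))"
      using \<eta>' major_mass_pos by (subst nn_integral_multc) (auto simp: nn_integral_major ennreal_mult)
    also have "2 * \<dots> = ennreal (2 * (major_mass * (2 * \<eta>')))"
      using \<eta>' major_mass_pos by (subst ennreal_mult) auto
    also have "2 * (major_mass * (2 * \<eta>')) = \<eta>/2"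
      using major_mass_pos by (simp add: \<eta>'_def)
    finally show ?thesis .
  qed
  have "((\<lambda>e::real. e powr (1-\<alpha>) * a) \<longlongrightarrow> 0 powr (1-\<alpha>) * a) (at_right 0)"
    using alpha by (intro tendsto_intros tendsto_powr2) (auto simp: eventually_at_right_less eventually_at_filter)
  then have "\<forall>\<^sub>F e in at_right 0. e powr (1-\<alpha>) * a < \<eta>/2"
    using \<eta> by (intro order_tendstoD(2)[where y=0]) auto
  then show ?thesis
    using eventually_at_right_less[of 0]
  proof eventually_elim
    case (elim e)
    have "major_avg g e x = major_avg (\<lambda>y. (if y < x + \<delta> then g y else 0) + (if y < x + \<delta> then 0 else g y)) e x"
      by (intro arg_cong[where f="\<lambda>g. major_avg g e x"]) auto
    also have "\<dots> = major_avg (\<lambda>y. if y < x + \<delta> then g y else 0) e x + major_avg (\<lambda>y. if y < x + \<delta> then 0 else g y) e x"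
      by (rule major_avg_add) auto
    also have "\<dots> \<le> ennreal (\<eta>/2) + ennreal (e powr (1-\<alpha>)) * A"
      unfolding A_def using elim \<delta> by (intro add_mono near major_avg_far_le) auto
    also have "\<dots> = ennreal (\<eta>/2 + e powr (1-\<alpha>) * a)"
      using a \<eta> by (simp add: ennreal_mult ennreal_plus)
    also have "\<dots> \<le> ennreal \<eta>"
      using elim by (intro ennreal_leI) simp
    finally show ?case by (simp add: g_def[abs_def])
  qed
qed

text \<open>Dropping the subtracted power gives a bound that is not uniform in e but transfers
  integrability from the fractional integral at x.\<close>

lemma kern_le_powr:
  assumes e: "0 < e"
  shows "kern e s \<le> kern_const * e powr (-\<alpha>) * (if 0 < s then s powr (\<alpha>-1) else 0)"
proof (cases "0 < s")
  case True
  have "kern e s \<le> kern_const / s * (s/e) powr \<alpha>"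
    using True kern_const_pos by (simp add: kern_def mult_left_mono divide_right_mono)
  also have "\<dots> = kern_const * e powr (-\<alpha>) * s powr (\<alpha>-1)"
    using True e by (simp add: powr_divide powr_minus powr_diff field_simps)
  finally show ?thesis using True by simp
qed (simp add: kern_def)

lemma integrable_kern_avg:
  assumes e: "0 < e" and f [measurable]: "f \<in> borel_measurable borel"
    and fin: "nn_frac_int (\<lambda>y. ennreal \<bar>f y\<bar>) x < top"
  shows "integrable lborel (\<lambda>s. kern e s * f (x+s))"
proof (rule Bochner_Integration.integrable_bound)
  show "integrable lborel (\<lambda>s. kern_const * e powr (-\<alpha>) * (if 0 < s then s powr (\<alpha>-1) * f (x+s) else 0))"
    by (intro integrable_mult_right integrable_frac_int f fin)
  have "norm (kern e s * f (x+s)) \<le> norm (kern_const * e powr (-\<alpha>) * (if 0 < s then s powr (\<alpha>-1) * f (x+s) else 0))" for s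
    using mult_right_mono[OF kern_le_powr[OF e, of s], of "\<bar>f (x+s)\<bar>"] kern_nonneg[OF e, of s] kern_const_pos
    by (auto simp: abs_mult mult.assoc)
  then show "AE s in lborel. norm (kern e s * f (x+s)) \<le> norm (kern_const * e powr (-\<alpha>) * (if 0 < s then s powr (\<alpha>-1) * f (x+s) else 0))"
    by simp
qed measurable

lemma kern_avg_abs_le:
  assumes e: "0 < e" and f [measurable]: "f \<in> borel_measurable borel"
  shows "ennreal \<bar>kern_avg e f x\<bar> \<le> ennreal kern_const * major_avg (\<lambda>y. ennreal \<bar>f y\<bar>) e x"
proof -
  \<comment> \<open>If the integrand is not integrable, \<open>kern_avg\<close> takes the value 0
    and the bound persists.\<close>
  have "ennreal \<bar>kern_avg e f x\<bar> \<le> (\<integral>\<^sup>+s. ennreal (norm (kern e s * f (x+s))) \<partial>lborel)"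
    unfolding kern_avg_def using integral_norm_bound_ennreal[of lborel "\<lambda>s. kern e s * f (x+s)"]
    by (cases "integrable lborel (\<lambda>s. kern e s * f (x+s))") (auto simp: not_integrable_integral_eq)
  also have "\<dots> \<le> (\<integral>\<^sup>+s. ennreal kern_const * (ennreal (major (s/e) / e) * ennreal \<bar>f (x+s)\<bar>) \<partial>lborel)"
  proof (rule nn_integral_mono)
    fix s
    have "norm (kern e s * f (x+s)) \<le> kern_const * (major (s/e) / e) * \<bar>f (x+s)\<bar>"
      using mult_right_mono[OF kern_le[OF e, of s], of "\<bar>f (x+s)\<bar>"] kern_nonneg[OF e, of s] by (simp add: abs_mult)
    then have "ennreal (norm (kern e s * f (x+s))) \<le> ennreal (kern_const * (major (s/e) / e) * \<bar>f (x+s)\<bar>)"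
      by (rule ennreal_leI)
    also have "\<dots> = ennreal kern_const * (ennreal (major (s/e) / e) * ennreal \<bar>f (x+s)\<bar>)"
      using kern_const_pos e by (simp only: ennreal_mult mult_nonneg_nonneg less_imp_le divide_nonneg_nonneg major_nonneg abs_ge_zero mult.assoc)
    finally show "ennreal (norm (kern e s * f (x+s))) \<le> ennreal kern_const * (ennreal (major (s/e) / e) * ennreal \<bar>f (x+s)\<bar>)" .
  qed
  also have "\<dots> = ennreal kern_const * major_avg (\<lambda>y. ennreal \<bar>f y\<bar>) e x"
    unfolding major_avg_def by (rule nn_integral_cmult) auto
  finally show ?thesis .
qed

text \<open>As the kernel has integral 1, the error is the average of f - f x, to which
  \<open>major_avg_small\<close> applies.\<close>

lemma kern_avg_tendsto:
  assumes f [measurable]: "f \<in> borel_measurable borel"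
    and fin: "nn_frac_int (\<lambda>y. ennreal \<bar>f y\<bar>) x < top"
    and leb: "right_lebesgue_point f x"
  shows "((\<lambda>e. kern_avg e f x) \<longlongrightarrow> f x) (at_right 0)"
proof (rule tendstoI)
  fix \<eta> :: real assume \<eta>: "0 < \<eta>"
  define \<eta>' where "\<eta>' = \<eta> / (2 * kern_const)"
  have \<eta>': "0 < \<eta>'" using \<eta> kern_const_pos by (simp add: \<eta>'_def)
  show "\<forall>\<^sub>F e in at_right 0. dist (kern_avg e f x) (f x) < \<eta>"
    using major_avg_small[OF f fin leb \<eta>'] eventually_at_right_less[of 0]
  proof eventually_elim
    case (elim e)
    note k = has_bochner_integral_kern[OF elim(2)]
    have "kern_avg e (\<lambda>y. f y - f x) x = (LINT s|lborel. kern e s * f (x+s) - kern e s * f x)"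
      unfolding kern_avg_def by (simp add: right_diff_distrib)
    also have "\<dots> = kern_avg e f x - f x"
      unfolding kern_avg_def using k integrable_kern_avg[OF elim(2) f fin]
      by (subst Bochner_Integration.integral_diff) (auto simp: has_bochner_integral_iff)
    finally have "ennreal \<bar>kern_avg e f x - f x\<bar> \<le> ennreal kern_const * major_avg (\<lambda>y. ennreal \<bar>f y - f x\<bar>) e x"
      using kern_avg_abs_le[OF elim(2), of "\<lambda>y. f y - f x" x] by simp
    also have "\<dots> \<le> ennreal kern_const * ennreal \<eta>'"
      by (intro mult_left_mono elim) auto
    also have "\<dots> = ennreal (\<eta>/2)"
      using kern_const_pos \<eta>' by (simp add: ennreal_mult[symmetric] \<eta>'_def)
    finally have "\<bar>kern_avg e f x - f x\<bar> \<le> \<eta>/2"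
      using \<eta> by simp
    then show ?case using \<eta> by (simp add: dist_real_def)
  qed
qed

end

section \<open>Convergence in norm\<close>

lemma epowr_add_le:
  assumes "0 < r"
  shows "epowr (a + b) r \<le> ennreal (2 powr r) * (epowr a r + epowr b r)"
proof -
  have two: "epowr 2 r = ennreal (2 powr r)"
    using epowr_ennreal[of 2 r] by simp
  have "epowr (a + b) r \<le> epowr (2 * max a b) r"
    using assms by (intro epowr_mono) (auto simp: mult_2 intro: add_mono)
  also have "\<dots> = ennreal (2 powr r) * epowr (max a b) r"
    using assms by (simp add: epowr_mult two)
  also have "\<dots> \<le> ennreal (2 powr r) * (epowr a r + epowr b r)"
    by (intro mult_left_mono) (auto simp: max_def)
  finally show ?thesis .
qed

text \<open>Lets the sequential criterion range over sequences in (0,1], where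
  \<open>kern_avg_dominated\<close> holds.\<close>

lemma at_right_0_eq: "at_right 0 = at (0::real) within {0<..1}"
  by (rule at_within_nhd[of _ "{..<1}"]) auto

context one_sided_weight
begin

lemma wnorm_mono_AE:
  assumes "AE x in lborel. g x \<le> h x"
  shows "wnorm g \<le> wnorm h"
  unfolding wnorm_def
proof (rule nn_integral_mono_AE)
  show "AE x in lborel. epowr (g x) p * ennreal (w x powr p) \<le> epowr (h x) p * ennreal (w x powr p)"
    using assms by eventually_elim (use p in \<open>auto intro!: mult_right_mono epowr_mono\<close>)
qed

text \<open>\<open>wnorm\<close> is the p-th power of a norm, so the triangle inequality costs a
  constant, harmless for limits equal to 0.\<close>

lemma wnorm_add_le:
  assumes [measurable]: "g \<in> borel_measurable borel" "h \<in> borel_measurable borel"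
  shows "wnorm (\<lambda>x. g x + h x) \<le> ennreal (2 powr p) * (wnorm g + wnorm h)"
proof -
  have "wnorm (\<lambda>x. g x + h x) \<le> (\<integral>\<^sup>+x. ennreal (2 powr p) * (epowr (g x) p * ennreal (w x powr p) + epowr (h x) p * ennreal (w x powr p)) \<partial>lborel)"
    unfolding wnorm_def
  proof (rule nn_integral_mono)
    fix x
    have "epowr (g x + h x) p * ennreal (w x powr p) \<le> ennreal (2 powr p) * (epowr (g x) p + epowr (h x) p) * ennreal (w x powr p)"
      using p by (intro mult_right_mono epowr_add_le) auto
    then show "epowr (g x + h x) p * ennreal (w x powr p)
      \<le> ennreal (2 powr p) * (epowr (g x) p * ennreal (w x powr p) + epowr (h x) p * ennreal (w x powr p))"
      by (simp add: distrib_right mult.assoc)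
  qed
  also have "\<dots> = ennreal (2 powr p) * (wnorm g + wnorm h)"
    unfolding wnorm_def by (subst nn_integral_cmult, measurable, subst nn_integral_add) auto
  finally show ?thesis .
qed

lemma wnorm_cmult:
  assumes [measurable]: "g \<in> borel_measurable borel"
  shows "wnorm (\<lambda>x. c * g x) = epowr c p * wnorm g"
  unfolding wnorm_def using p
  by (subst nn_integral_cmult[symmetric]) (auto simp: epowr_mult mult.assoc)

text \<open>It puts indicators of bounded intervals into L^p(w^p), as the majorant in
  \<open>wnorm_tendsto_bounded\<close> requires.\<close>

lemma mass_p_finite: "mass p a b < top"
proof (cases "a \<le> b")
  case True
  have "mass q a b * ennreal ((b-a) powr (q/p-1)) < top"
    using mass_q_finite[of a b] by (simp add: ennreal_mult_less_top)
  then have "epowr (mass p a b) (q/p) < top"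
    using mass_Jensen[OF True] by (rule le_less_trans[rotated])
  then show ?thesis by simp
qed (simp add: mass_def)

lemma kern_avg_bound:
  assumes e: "0 < e" and [measurable]: "f \<in> borel_measurable borel"
  shows "wnorm (\<lambda>x. ennreal \<bar>kern_avg e f x\<bar>) \<le> ennreal (kern_const powr p * major_const) * wnorm (\<lambda>x. ennreal \<bar>f x\<bar>)"
proof -
  have "wnorm (\<lambda>x. ennreal \<bar>kern_avg e f x\<bar>) \<le> wnorm (\<lambda>x. ennreal kern_const * major_avg (\<lambda>y. ennreal \<bar>f y\<bar>) e x)"
    by (intro wnorm_mono_AE always_eventually allI kern_avg_abs_le e) measurable
  also have "\<dots> = ennreal (kern_const powr p) * wnorm (major_avg (\<lambda>y. ennreal \<bar>f y\<bar>) e)"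
    using kern_const_pos by (subst wnorm_cmult) auto
  also have "\<dots> \<le> ennreal (kern_const powr p) * (ennreal major_const * wnorm (\<lambda>x. ennreal \<bar>f x\<bar>))"
    by (intro mult_left_mono major_avg_bound e) auto
  also have "\<dots> = ennreal (kern_const powr p * major_const) * wnorm (\<lambda>x. ennreal \<bar>f x\<bar>)"
    using major_mass_pos D by (simp add: ennreal_mult major_const_def mult.assoc)
  finally show ?thesis .
qed

lemma kern_avg_bounded:
  assumes e: "0 < e" and N: "\<And>y. \<bar>g y\<bar> \<le> N"
  shows "\<bar>kern_avg e g x\<bar> \<le> N"
proof -
  note k = has_bochner_integral_kern[OF e]
  have "0 \<le> N" using N[of 0] by simp
  have "\<bar>LINT s|lborel. kern e s * g (x+s)\<bar> \<le> (LINT s|lborel. kern e s * N)"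
  proof (cases "integrable lborel (\<lambda>s. kern e s * g (x+s))")
    case True
    have "\<bar>LINT s|lborel. kern e s * g (x+s)\<bar> \<le> (LINT s|lborel. \<bar>kern e s * g (x+s)\<bar>)"
      by (rule integral_abs_bound)
    also have "\<dots> \<le> (LINT s|lborel. kern e s * N)"
      using k True N kern_nonneg[OF e]
      by (intro integral_mono integrable_abs integrable_mult_left)
         (auto simp: has_bochner_integral_iff abs_mult intro: mult_left_mono)
    finally show ?thesis .
  next
    case False
    then show ?thesis using k \<open>0 \<le> N\<close>
      by (simp add: not_integrable_integral_eq has_bochner_integral_iff)
  qed
  also have "\<dots> = N" using k by (simp add: has_bochner_integral_iff)
  finally show ?thesis by (simp add: kern_avg_def)
qed

text \<open>For s \<ge> 1 the branch u^(\<alpha>-2) of \<open>major\<close> is in force, and scaling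
  produces e^(1-\<alpha>) \<le> 1.\<close>

lemma kern_le_major:
  assumes e: "0 < e" "e \<le> 1" and s: "1 \<le> s"
  shows "kern e s \<le> kern_const * major s"
proof -
  have "major (s/e) / e \<le> (s/e) powr (\<alpha>-2) / e"
    using s e by (intro divide_right_mono) (auto simp: major_def)
  also have "\<dots> = e powr (1-\<alpha>) * s powr (\<alpha>-2)"
  proof -
    have "e powr (\<alpha>-2) * e = e powr (\<alpha>-1)"
      using e powr_add[of e "\<alpha>-2" 1] by simp
    moreover have "e powr (1-\<alpha>) = 1 / e powr (\<alpha>-1)"
      using powr_minus_divide[of e "\<alpha>-1"] by simp
    ultimately show ?thesis using s e by (simp add: powr_divide)
  qed
  also have "\<dots> \<le> 1 * s powr (\<alpha>-2)"
    using e alpha by (intro mult_right_mono powr_le1) auto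
  also have "\<dots> = major s"
  proof -
    have "s powr (\<alpha>-2) \<le> s powr (\<alpha>-1)" using s by (intro powr_mono) auto
    then show ?thesis using s by (simp add: major_def min_def)
  qed
  finally have m: "major (s/e) / e \<le> major s" .
  have "kern e s \<le> kern_const * (major (s/e) / e)"
    by (rule kern_le[OF e(1)])
  also have "\<dots> \<le> kern_const * major s"
    using kern_const_pos by (intro mult_left_mono m) auto
  finally show ?thesis .
qed

text \<open>A majorant independent of \<open>e\<close>: if \<open>x < -N-1\<close>, then only \<open>s \<ge> 1\<close> contributes, where \<open>kern e s\<close> is at most
  \<open>kern_const * major s\<close>.\<close>

lemma kern_avg_dominated:
  assumes e: "0 < e" "e \<le> 1" and [measurable]: "g \<in> borel_measurable borel"
    and N: "\<And>y. \<bar>g y\<bar> \<le> N" and supp: "\<And>y. N < \<bar>y\<bar> \<Longrightarrow> g y = 0"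
  shows "ennreal \<bar>kern_avg e g x\<bar>
    \<le> ennreal N * indicator {-N-1..N} x + ennreal kern_const * major_avg (\<lambda>y. ennreal \<bar>g y\<bar>) 1 x"
proof -
  consider "x > N" | "x \<in> {-N-1..N}" | "x < -N-1" by force
  then show ?thesis
  proof cases
    case 1
    \<comment> \<open>The average looks only to the right, so nothing is seen from beyond the
      support.\<close>
    then have "kern e s * g (x+s) = 0" for s
      using supp[of "x+s"] by (cases "0 < s") (auto simp: kern_def)
    then have "(\<lambda>s. kern e s * g (x+s)) = (\<lambda>_. 0)" by (rule ext)
    then show ?thesis by (simp add: kern_avg_def)
  next
    case 2
    have "ennreal \<bar>kern_avg e g x\<bar> \<le> ennreal N"
      by (intro ennreal_leI kern_avg_bounded e N)
    then show ?thesis using 2 by (simp add: add_increasing2)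
  next
    case 3
    have "ennreal \<bar>kern_avg e g x\<bar> \<le> (\<integral>\<^sup>+s. ennreal (norm (kern e s * g (x+s))) \<partial>lborel)"
      unfolding kern_avg_def using integral_norm_bound_ennreal[of lborel "\<lambda>s. kern e s * g (x+s)"]
      by (cases "integrable lborel (\<lambda>s. kern e s * g (x+s))") (auto simp: not_integrable_integral_eq)
    also have "\<dots> \<le> (\<integral>\<^sup>+s. ennreal kern_const * (ennreal (major (s/1) / 1) * ennreal \<bar>g (x+s)\<bar>) \<partial>lborel)"
    proof (rule nn_integral_mono)
      fix s
      have "norm (kern e s * g (x+s)) \<le> kern_const * major s * \<bar>g (x+s)\<bar>"
      proof (cases "1 \<le> s")
        case True
        then show ?thesis
          using mult_right_mono[OF kern_le_major[OF e True], of "\<bar>g (x+s)\<bar>"] kern_nonneg[OF e(1), of s]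
          by (simp add: abs_mult)
      next
        case False
        then have "g (x+s) = 0" using 3 by (intro supp) auto
        then show ?thesis by simp
      qed
      then have "ennreal (norm (kern e s * g (x+s))) \<le> ennreal (kern_const * major s * \<bar>g (x+s)\<bar>)"
        by (rule ennreal_leI)
      also have "\<dots> = ennreal kern_const * (ennreal (major (s/1) / 1) * ennreal \<bar>g (x+s)\<bar>)"
        using kern_const_pos by (simp add: ennreal_mult mult.assoc)
      finally show "ennreal (norm (kern e s * g (x+s))) \<le> ennreal kern_const * (ennreal (major (s/1) / 1) * ennreal \<bar>g (x+s)\<bar>)" .
    qed
    also have "\<dots> = ennreal kern_const * major_avg (\<lambda>y. ennreal \<bar>g y\<bar>) 1 x"
      unfolding major_avg_def by (rule nn_integral_cmult) auto
    finally show ?thesis by (simp add: add_increasing)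
  qed
qed

section \<open>Convergence for bounded functions of bounded support, then for all functions\<close>

lemma AE_kern_avg_tendsto:
  assumes f [measurable]: "f \<in> borel_measurable borel" and fin: "wnorm (\<lambda>x. ennreal \<bar>f x\<bar>) < top"
  shows "AE x in lborel. ((\<lambda>e. kern_avg e f x) \<longlongrightarrow> f x) (at_right 0)"
proof -
  have "AE x in lborel. right_lebesgue_point f x"
    by (rule AE_right_lebesgue_point[OF f], rule wnorm_finite_locally) (use fin in auto)
  moreover have "AE x in lborel. nn_frac_int (\<lambda>y. ennreal \<bar>f y\<bar>) x < top"
    by (rule nn_frac_int_finite) (use fin in auto)
  ultimately show ?thesis
    by eventually_elim (rule kern_avg_tendsto[OF f])
qed

text \<open>Dominated convergence along sequences. The majorant \<open>F\<close> has finite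
  \<open>wnorm\<close>: w^p is locally integrable, \<open>major_avg_bound\<close> with e = 1 covers
  the averaged term, and g itself has finite \<open>wnorm\<close>.\<close>

lemma wnorm_tendsto_bounded:
  assumes g [measurable]: "g \<in> borel_measurable borel" and fin: "wnorm (\<lambda>x. ennreal \<bar>g x\<bar>) < top"
    and N: "\<And>y. \<bar>g y\<bar> \<le> N" and supp: "\<And>y. N < \<bar>y\<bar> \<Longrightarrow> g y = 0"
  shows "((\<lambda>e. wnorm (\<lambda>x. ennreal \<bar>kern_avg e g x - g x\<bar>)) \<longlongrightarrow> 0) (at_right 0)"
  unfolding at_right_0_eq tendsto_at_iff_sequentially
proof (intro allI impI)
  fix X :: "nat \<Rightarrow> real" assume X: "\<forall>i. X i \<in> {0<..1} - {0}" "X \<longlonglongrightarrow> 0"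
  define F where "F x = (ennreal N * indicator {-N-1..N} x + ennreal kern_const * major_avg (\<lambda>y. ennreal \<bar>g y\<bar>) 1 x) + ennreal \<bar>g x\<bar>" for x
  have [measurable]: "F \<in> borel_measurable borel" unfolding F_def by measurable
  have X_right: "filterlim X (at_right 0) sequentially"
  proof -
    have "0 < X i" for i using X(1) by simp
    then have "\<forall>i. X i \<in> {0<..} \<and> X i \<noteq> 0" by (metis greaterThan_iff less_irrefl)
    then show ?thesis using X(2) by (simp add: filterlim_at)
  qed
  have "wnorm (\<lambda>x. ennreal N * indicator {-N-1..N} x) = epowr (ennreal N) p * mass p (-N-1) N"
    using p by (subst wnorm_cmult)
      (auto simp: wnorm_def mass_def epowr_indicator mult.commute)
  then have 1: "wnorm (\<lambda>x. ennreal N * indicator {-N-1..N} x) < top"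
    using mass_p_finite by (simp add: ennreal_mult_less_top)
  have "wnorm (\<lambda>x. ennreal kern_const * major_avg (\<lambda>y. ennreal \<bar>g y\<bar>) 1 x)
    \<le> epowr (ennreal kern_const) p * (ennreal major_const * wnorm (\<lambda>x. ennreal \<bar>g x\<bar>))"
    by (subst wnorm_cmult) (auto intro!: mult_left_mono major_avg_bound)
  also have "\<dots> < top"
    using fin by (simp add: ennreal_mult_less_top)
  finally have 2: "wnorm (\<lambda>x. ennreal kern_const * major_avg (\<lambda>y. ennreal \<bar>g y\<bar>) 1 x) < top" .
  have "wnorm (\<lambda>x. ennreal N * indicator {-N-1..N} x + ennreal kern_const * major_avg (\<lambda>y. ennreal \<bar>g y\<bar>) 1 x)
     \<le> ennreal (2 powr p) * (wnorm (\<lambda>x. ennreal N * indicator {-N-1..N} x) + wnorm (\<lambda>x. ennreal kern_const * major_avg (\<lambda>y. ennreal \<bar>g y\<bar>) 1 x))"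
    by (rule wnorm_add_le) measurable
  also have "\<dots> < top" using 1 2 by (simp add: ennreal_mult_less_top)
  finally have 3: "wnorm (\<lambda>x. ennreal N * indicator {-N-1..N} x + ennreal kern_const * major_avg (\<lambda>y. ennreal \<bar>g y\<bar>) 1 x) < top" .
  have "wnorm F \<le> ennreal (2 powr p) * (wnorm (\<lambda>x. ennreal N * indicator {-N-1..N} x + ennreal kern_const * major_avg (\<lambda>y. ennreal \<bar>g y\<bar>) 1 x) + wnorm (\<lambda>x. ennreal \<bar>g x\<bar>))"
    unfolding F_def by (rule wnorm_add_le) measurable
  also have "\<dots> < top" using 3 fin by (simp add: ennreal_mult_less_top)
  finally have F: "wnorm F < top" .
  have "(\<lambda>i. \<integral>\<^sup>+x. epowr (ennreal \<bar>kern_avg (X i) g x - g x\<bar>) p * ennreal (w x powr p) \<partial>lborel) \<longlonglongrightarrow> (\<integral>\<^sup>+(x::real). 0 \<partial>lborel)"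
  proof (rule nn_integral_dominated_convergence)
    show "(\<integral>\<^sup>+x. epowr (F x) p * ennreal (w x powr p) \<partial>lborel) < \<infinity>"
      using F by (simp add: wnorm_def)
    show "AE x in lborel. epowr (ennreal \<bar>kern_avg (X i) g x - g x\<bar>) p * ennreal (w x powr p) \<le> epowr (F x) p * ennreal (w x powr p)" for i
    proof (intro always_eventually allI mult_right_mono epowr_mono)
      fix x
      have "ennreal \<bar>kern_avg (X i) g x - g x\<bar> \<le> ennreal (\<bar>kern_avg (X i) g x\<bar> + \<bar>g x\<bar>)"
        by (intro ennreal_leI) auto
      also have "\<dots> = ennreal \<bar>kern_avg (X i) g x\<bar> + ennreal \<bar>g x\<bar>"
        by (rule ennreal_plus) auto
      also have "\<dots> \<le> F x"
        unfolding F_def using X by (intro add_right_mono kern_avg_dominated N supp) auto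
      finally show "ennreal \<bar>kern_avg (X i) g x - g x\<bar> \<le> F x" .
    qed (use p in auto)
    show "AE x in lborel. (\<lambda>i. epowr (ennreal \<bar>kern_avg (X i) g x - g x\<bar>) p * ennreal (w x powr p)) \<longlonglongrightarrow> 0"
      using AE_kern_avg_tendsto[OF g fin]
    proof eventually_elim
      case (elim x)
      then have "(\<lambda>i. kern_avg (X i) g x) \<longlonglongrightarrow> g x"
        by (rule filterlim_compose[OF _ X_right])
      then have "(\<lambda>i. \<bar>kern_avg (X i) g x - g x\<bar> powr p * w x powr p) \<longlonglongrightarrow> \<bar>g x - g x\<bar> powr p * w x powr p"
        using p by (intro tendsto_intros tendsto_powr2) auto
      then have "(\<lambda>i. ennreal (\<bar>kern_avg (X i) g x - g x\<bar> powr p * w x powr p)) \<longlonglongrightarrow> ennreal 0"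
        by (intro tendsto_ennrealI) simp
      then show ?case by (simp add: ennreal_mult)
    qed
  qed measurable
  then show "((\<lambda>e. wnorm (\<lambda>x. ennreal \<bar>kern_avg e g x - g x\<bar>)) \<circ> X) \<longlonglongrightarrow> 0"
    by (simp add: wnorm_def comp_def)
qed

lemma wnorm_truncation:
  assumes f [measurable]: "f \<in> borel_measurable borel" and fin: "wnorm (\<lambda>x. ennreal \<bar>f x\<bar>) < top"
  shows "(\<lambda>n::nat. wnorm (\<lambda>x. ennreal \<bar>if \<bar>x\<bar> \<le> real n \<and> \<bar>f x\<bar> \<le> real n then 0 else f x\<bar>)) \<longlonglongrightarrow> 0"
proof -
  have "(\<lambda>n::nat. \<integral>\<^sup>+x. epowr (ennreal \<bar>if \<bar>x\<bar> \<le> real n \<and> \<bar>f x\<bar> \<le> real n then 0 else f x\<bar>) p * ennreal (w x powr p) \<partial>lborel)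
    \<longlonglongrightarrow> (\<integral>\<^sup>+(x::real). 0 \<partial>lborel)"
  proof (rule nn_integral_dominated_convergence)
    show "(\<integral>\<^sup>+x. epowr (ennreal \<bar>f x\<bar>) p * ennreal (w x powr p) \<partial>lborel) < \<infinity>"
      using fin by (simp add: wnorm_def)
    show "AE x in lborel. (\<lambda>n. epowr (ennreal \<bar>if \<bar>x\<bar> \<le> real n \<and> \<bar>f x\<bar> \<le> real n then 0 else f x\<bar>) p * ennreal (w x powr p)) \<longlonglongrightarrow> 0"
    proof (intro always_eventually allI)
      fix x
      obtain n0 :: nat where n0: "max \<bar>x\<bar> \<bar>f x\<bar> \<le> real n0" using real_arch_simple by blast
      have "\<forall>\<^sub>F n in sequentially. epowr (ennreal \<bar>if \<bar>x\<bar> \<le> real n \<and> \<bar>f x\<bar> \<le> real n then 0 else f x\<bar>) p * ennreal (w x powr p) = 0"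
        using eventually_ge_at_top[of n0] by eventually_elim (use n0 in auto)
      then show "(\<lambda>n. epowr (ennreal \<bar>if \<bar>x\<bar> \<le> real n \<and> \<bar>f x\<bar> \<le> real n then 0 else f x\<bar>) p * ennreal (w x powr p)) \<longlonglongrightarrow> 0"
        by (rule tendsto_eventually)
    qed
  qed auto
  then show ?thesis by (simp add: wnorm_def)
qed

lemma kern_avg_tendsto_wnorm:
  assumes f [measurable]: "f \<in> borel_measurable borel" and fin: "wnorm (\<lambda>x. ennreal \<bar>f x\<bar>) < top"
  shows "((\<lambda>e. wnorm (\<lambda>x. ennreal \<bar>kern_avg e f x - f x\<bar>)) \<longlongrightarrow> 0) (at_right 0)"
proof (rule order_tendstoI)
  \<comment> \<open>As \<eta> may be infinite, a positive real number below it is chosen.\<close>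
  fix \<eta> :: ennreal assume "0 < \<eta>"
  then obtain \<eta>' where \<eta>': "0 < \<eta>'" "ennreal \<eta>' < \<eta>"
    using dense[of 0 \<eta>] by (metis ennreal_cases ennreal_less_zero_iff not_top_less)
  define K where "K = kern_const powr p * major_const + 1"
  have mc: "0 \<le> major_const" using major_mass_pos D by (simp add: major_const_def)
  have K: "1 \<le> K" using mc by (simp add: K_def)
  define T where "T = 2 powr p"
  have T: "0 < T" by (simp add: T_def)
  \<comment> \<open>The two uses of \<open>wnorm_add_le\<close> will give at most T * (\<theta> + T
    * K * \<theta>) \<le> 2 * T * T * K * \<theta> = \<eta>'/2; the summand 1 in \<open>K\<close>
    accounts for b itself.\<close>
  define \<theta> where "\<theta> = \<eta>' / (4 * T * T * K)"
  have \<theta>: "0 < \<theta>" using \<eta>' K T by (simp add: \<theta>_def)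
  have "\<forall>\<^sub>F n in sequentially. wnorm (\<lambda>x. ennreal \<bar>if \<bar>x\<bar> \<le> real n \<and> \<bar>f x\<bar> \<le> real n then 0 else f x\<bar>) < ennreal \<theta>"
    using wnorm_truncation[OF f fin] \<theta> by (intro order_tendstoD(2)) auto
  then obtain n :: nat where n: "wnorm (\<lambda>x. ennreal \<bar>if \<bar>x\<bar> \<le> real n \<and> \<bar>f x\<bar> \<le> real n then 0 else f x\<bar>) < ennreal \<theta>"
    by (auto simp: eventually_sequentially)
  define b where "b x = (if \<bar>x\<bar> \<le> real n \<and> \<bar>f x\<bar> \<le> real n then 0 else f x)" for x
  define g where "g x = (if \<bar>x\<bar> \<le> real n \<and> \<bar>f x\<bar> \<le> real n then f x else 0)" for x
  have [measurable]: "b \<in> borel_measurable borel" "g \<in> borel_measurable borel"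
    unfolding b_def g_def by measurable
  have bg: "f x = g x + b x" "\<bar>g x\<bar> \<le> \<bar>f x\<bar>" "\<bar>b x\<bar> \<le> \<bar>f x\<bar>" for x
    by (auto simp: b_def g_def)
  have b: "wnorm (\<lambda>x. ennreal \<bar>b x\<bar>) \<le> ennreal \<theta>"
    using n by (simp add: b_def less_imp_le)
  have gfin: "wnorm (\<lambda>x. ennreal \<bar>g x\<bar>) < top"
    using wnorm_mono_AE[of "\<lambda>x. ennreal \<bar>g x\<bar>" "\<lambda>x. ennreal \<bar>f x\<bar>"] fin bg by (auto simp: ennreal_leI intro: le_less_trans)
  have "((\<lambda>e. wnorm (\<lambda>x. ennreal \<bar>kern_avg e g x - g x\<bar>)) \<longlongrightarrow> 0) (at_right 0)"
    by (rule wnorm_tendsto_bounded[where N="real n"]) (use gfin in \<open>auto simp: g_def\<close>)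
  then have "\<forall>\<^sub>F e in at_right 0. wnorm (\<lambda>x. ennreal \<bar>kern_avg e g x - g x\<bar>) < ennreal \<theta>"
    using \<theta> by (intro order_tendstoD(2)) auto
  then show "\<forall>\<^sub>F e in at_right 0. wnorm (\<lambda>x. ennreal \<bar>kern_avg e f x - f x\<bar>) < \<eta>"
    using eventually_at_right_less[of 0]
  proof eventually_elim
    case (elim e)
    note e = elim(2)
    \<comment> \<open>Additivity of \<open>kern_avg\<close> requires both integrands to be
      integrable, which holds where the fractional integral of |f| is finite.\<close>
    have "AE x in lborel. nn_frac_int (\<lambda>y. ennreal \<bar>f y\<bar>) x < top"
      by (rule nn_frac_int_finite) (use fin in auto)
    then have "AE x in lborel. ennreal \<bar>kern_avg e f x - f x\<bar>
       \<le> ennreal \<bar>kern_avg e g x - g x\<bar> + (ennreal \<bar>kern_avg e b x\<bar> + ennreal \<bar>b x\<bar>)"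
    proof eventually_elim
      case (elim x)
      have "nn_frac_int (\<lambda>y. ennreal \<bar>g y\<bar>) x \<le> nn_frac_int (\<lambda>y. ennreal \<bar>f y\<bar>) x"
        "nn_frac_int (\<lambda>y. ennreal \<bar>b y\<bar>) x \<le> nn_frac_int (\<lambda>y. ennreal \<bar>f y\<bar>) x"
        unfolding nn_frac_int_def using bg by (auto intro!: nn_integral_mono mult_left_mono ennreal_leI)
      then have "nn_frac_int (\<lambda>y. ennreal \<bar>g y\<bar>) x < top" "nn_frac_int (\<lambda>y. ennreal \<bar>b y\<bar>) x < top"
        using elim by (auto intro: le_less_trans)
      then have "integrable lborel (\<lambda>s. kern e s * g (x+s))" "integrable lborel (\<lambda>s. kern e s * b (x+s))"
        by (auto intro!: integrable_kern_avg e)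
      then have "kern_avg e f x = kern_avg e g x + kern_avg e b x"
        unfolding kern_avg_def by (simp add: bg(1) distrib_left)
      then have "\<bar>kern_avg e f x - f x\<bar> \<le> \<bar>kern_avg e g x - g x\<bar> + (\<bar>kern_avg e b x\<bar> + \<bar>b x\<bar>)"
        using bg(1)[of x] by linarith
      then have "ennreal \<bar>kern_avg e f x - f x\<bar> \<le> ennreal (\<bar>kern_avg e g x - g x\<bar> + (\<bar>kern_avg e b x\<bar> + \<bar>b x\<bar>))"
        by (rule ennreal_leI)
      then show ?case by (simp add: ennreal_plus)
    qed
    then have "wnorm (\<lambda>x. ennreal \<bar>kern_avg e f x - f x\<bar>)
      \<le> wnorm (\<lambda>x. ennreal \<bar>kern_avg e g x - g x\<bar> + (ennreal \<bar>kern_avg e b x\<bar> + ennreal \<bar>b x\<bar>))"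
      by (rule wnorm_mono_AE)
    also have "\<dots> \<le> ennreal T * (wnorm (\<lambda>x. ennreal \<bar>kern_avg e g x - g x\<bar>) + wnorm (\<lambda>x. ennreal \<bar>kern_avg e b x\<bar> + ennreal \<bar>b x\<bar>))"
      unfolding T_def by (rule wnorm_add_le) measurable
    also have "\<dots> \<le> ennreal T * (ennreal \<theta> + ennreal T * (ennreal (kern_const powr p * major_const) * ennreal \<theta> + ennreal \<theta>))"
    proof (intro mult_left_mono add_mono)
      show "wnorm (\<lambda>x. ennreal \<bar>kern_avg e g x - g x\<bar>) \<le> ennreal \<theta>" using elim by simp
      have "wnorm (\<lambda>x. ennreal \<bar>kern_avg e b x\<bar> + ennreal \<bar>b x\<bar>) \<le> ennreal T * (wnorm (\<lambda>x. ennreal \<bar>kern_avg e b x\<bar>) + wnorm (\<lambda>x. ennreal \<bar>b x\<bar>))"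
        unfolding T_def by (rule wnorm_add_le) measurable
      also have "\<dots> \<le> ennreal T * (ennreal (kern_const powr p * major_const) * wnorm (\<lambda>x. ennreal \<bar>b x\<bar>) + wnorm (\<lambda>x. ennreal \<bar>b x\<bar>))"
        by (rule mult_left_mono, rule add_right_mono, rule kern_avg_bound) (use e in auto)
      also have "\<dots> \<le> ennreal T * (ennreal (kern_const powr p * major_const) * ennreal \<theta> + ennreal \<theta>)"
        by (rule mult_left_mono, rule add_mono, rule mult_left_mono, rule b) (use b in auto)
      finally show "wnorm (\<lambda>x. ennreal \<bar>kern_avg e b x\<bar> + ennreal \<bar>b x\<bar>) \<le> ennreal T * (ennreal (kern_const powr p * major_const) * ennreal \<theta> + ennreal \<theta>)" .
    qed auto
    also have "\<dots> = ennreal (T * (\<theta> + T * (kern_const powr p * major_const * \<theta> + \<theta>)))"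
      using T \<theta> mc by (simp add: ennreal_mult ennreal_plus)
    also have "\<dots> \<le> ennreal \<eta>'"
    proof (rule ennreal_leI)
      have "1 \<le> T" using p by (simp add: T_def ge_one_powr_ge_zero)
      then have "1 \<le> T * K" using K mult_mono[of 1 T 1 K] by simp
      then have "\<theta> \<le> T * K * \<theta>" using \<theta> by simp
      then have "T * (\<theta> + T * (kern_const powr p * major_const * \<theta> + \<theta>)) \<le> T * (2 * (T * K * \<theta>))"
        using T by (intro mult_left_mono) (auto simp: K_def algebra_simps)
      also have "\<dots> = \<eta>' / 2"
        using T K by (simp add: \<theta>_def)
      finally show "T * (\<theta> + T * (kern_const powr p * major_const * \<theta> + \<theta>)) \<le> \<eta>'"
        using \<eta>' by simp
    qed
    finally show ?case using \<eta>'(2) by (rule le_less_trans)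
  qed
qed simp

end

section \<open>Passing from Lebesgue to Borel measurable representatives\<close>

text \<open>Completeness of Lebesgue measure. It makes the truncated derivative measurable, which is
  known only to agree almost everywhere with a Borel function.\<close>

lemma borel_measurable_lebesgue_AE:
  fixes f g :: "real \<Rightarrow> real"
  assumes g: "g \<in> borel_measurable lebesgue" and eq: "AE x in lebesgue. g x = f x"
  shows "f \<in> borel_measurable lebesgue"
proof (rule measurableI)
  fix A :: "real set" assume A: "A \<in> sets borel"
  have "g -` A \<inter> space lebesgue \<in> sets lebesgue"
    using g A by (rule measurable_sets)
  moreover have "AE x in lebesgue. x \<in> g -` A \<inter> space lebesgue \<longleftrightarrow> x \<in> f -` A \<inter> space lebesgue"
    using eq by eventually_elim auto
  ultimately show "f -` A \<inter> space lebesgue \<in> sets lebesgue"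
    by (intro completion.in_sets_AE[of "g -` A \<inter> space lebesgue" "f -` A \<inter> space lebesgue"]) auto
qed simp

lemma Borel_in_lebesgue: "f \<in> borel_measurable borel \<Longrightarrow> f \<in> borel_measurable lebesgue"
  for f :: "real \<Rightarrow> real"
  by (rule measurable_completion) simp

lemma positive_borel_version:
  fixes w :: "real \<Rightarrow> real"
  assumes "w \<in> borel_measurable lebesgue" "\<And>x. 0 < w x"
  obtains v where "v \<in> borel_measurable borel" "\<And>x. 0 < v x" "AE x in lebesgue. w x = v x"
proof -
  obtain w' where w': "w' \<in> borel_measurable lborel" "AE x in lborel. w x = w' x"
    using completion_ex_borel_measurable_real[OF assms(1)] by auto
  then have [measurable]: "w' \<in> borel_measurable borel" by simp
  \<comment> \<open>The Borel version can fail to be positive only on a null set; the value 1 there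
    makes it positive everywhere.\<close>
  show ?thesis
  proof (rule that[of "\<lambda>x. if 0 < w' x then w' x else 1"])
    show "(\<lambda>x. if 0 < w' x then w' x else 1) \<in> borel_measurable borel" by measurable
    show "AE x in lebesgue. w x = (if 0 < w' x then w' x else 1)"
      using AE_completion[OF w'(2)] by eventually_elim (metis assms(2))
  qed simp
qed

section \<open>The weight condition for a Borel representative, and the conclusion\<close>

lemma nn_integral_powr_borel_version:
  fixes w v :: "real \<Rightarrow> real"
  assumes "AE x in lebesgue. w x = v x" and int: "set_integrable lebesgue {a..b} (\<lambda>x. w x powr s)"
  shows "(\<integral>\<^sup>+x. ennreal (v x powr s) * indicator {a..b} x \<partial>lborel) = ennreal (LINT x:{a..b}|lebesgue. w x powr s)"
proof -
  have "(\<integral>\<^sup>+x. ennreal (v x powr s) * indicator {a..b} x \<partial>lborel) = (\<integral>\<^sup>+x. ennreal (v x powr s) * indicator {a..b} x \<partial>lebesgue)"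
    by (rule nn_integral_completion[symmetric])
  also have "\<dots> = (\<integral>\<^sup>+x. ennreal (indicator {a..b} x *\<^sub>R (w x powr s)) \<partial>lebesgue)"
    by (rule nn_integral_cong_AE, use assms(1) in eventually_elim) (auto simp: indicator_def)
  also have "\<dots> = ennreal (LINT x:{a..b}|lebesgue. w x powr s)"
    unfolding set_lebesgue_integral_def
    by (rule nn_integral_eq_integral) (use int in \<open>auto simp: set_integrable_def\<close>)
  finally show ?thesis .
qed

lemma A_plus_imp_one_sided_weight:
  assumes a: "0 < \<alpha>" "\<alpha> < 1" "1 < p" "p < 1/\<alpha>" "1/q = 1/p - \<alpha>" and w: "w \<in> A_plus p q"
    and v: "v \<in> borel_measurable borel" "\<And>x. 0 < v x" "AE x in lebesgue. w x = v x"
  shows "\<exists>D. one_sided_weight \<alpha> p q D v"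
proof -
  define p' where "p' = p/(p-1)"
  have p': "conj_exponent p = p'" "0 < p'" using a by (auto simp: conj_exponent_def p'_def)
  \<comment> \<open>The positivity of q is derived from p < 1/\<alpha>.\<close>
  have "\<alpha> < 1/p" using a by (simp add: field_simps)
  then have "0 < 1/q" using a by simp
  then have q: "0 < q" by simp
  obtain C where C: "0 < C" and A: "\<And>c h. 0 < h \<Longrightarrow>
      set_integrable lebesgue {c-h..c} (\<lambda>x. w x powr q) \<and>
      set_integrable lebesgue {c..c+h} (\<lambda>x. w x powr (- p')) \<and>
      (1/h * (LINT x:{c-h..c}|lebesgue. w x powr q)) powr (1/q) *
      (1/h * (LINT x:{c..c+h}|lebesgue. w x powr (- p'))) powr (1 / p') \<le> C"
    using w unfolding A_plus_def p' by auto
  have nnq: "(\<integral>\<^sup>+x. ennreal (v x powr q) * indicator {c-h..c} x \<partial>lborel) = ennreal (LINT x:{c-h..c}|lebesgue. w x powr q)"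
    if "0 < h" for c h
    using A[OF that] by (intro nn_integral_powr_borel_version v) auto
  have nnp: "(\<integral>\<^sup>+x. ennreal (v x powr (- p')) * indicator {c..c+h} x \<partial>lborel) = ennreal (LINT x:{c..c+h}|lebesgue. w x powr (- p'))"
    if "0 < h" for c h
    using A[OF that] by (intro nn_integral_powr_borel_version v) auto
  have "one_sided_weight \<alpha> p q (C powr q) v"
  proof
    fix c b :: real
    \<comment> \<open>The condition speaks of intervals of positive length h; the maximum also
      covers short and empty intervals.\<close>
    define h where "h = max 1 (b-c)"
    have h: "0 < h" "b-h \<le> c" "b \<le> c+h" by (auto simp: h_def)
    have "(\<integral>\<^sup>+x. ennreal (v x powr q) * indicator {c..b} x \<partial>lborel) \<le> (\<integral>\<^sup>+x. ennreal (v x powr q) * indicator {b-h..b} x \<partial>lborel)"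
      using h by (intro nn_integral_mono) (auto simp: indicator_def)
    then show "(\<integral>\<^sup>+x. ennreal (v x powr q) * indicator {c..b} x \<partial>lborel) < top"
      unfolding nnq[OF h(1)] by (rule le_less_trans) simp
    have "(\<integral>\<^sup>+x. ennreal (v x powr (- p')) * indicator {c..b} x \<partial>lborel) \<le> (\<integral>\<^sup>+x. ennreal (v x powr (- p')) * indicator {c..c+h} x \<partial>lborel)"
      using h by (intro nn_integral_mono) (auto simp: indicator_def)
    then show "(\<integral>\<^sup>+x. ennreal (v x powr (- (p/(p-1)))) * indicator {c..b} x \<partial>lborel) < top"
      unfolding nnp[OF h(1)] p'_def[symmetric] by (rule le_less_trans) simp
  next
    fix c h :: real assume h: "0 < h"
    define V where "V = (LINT x:{c-h..c}|lebesgue. w x powr q)"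
    define S where "S = (LINT x:{c..c+h}|lebesgue. w x powr (- p'))"
    have nn: "0 \<le> V" "0 \<le> S"
      unfolding V_def S_def set_lebesgue_integral_def by (auto intro!: integral_nonneg_AE)
    have e: "q*(p-1)/p = q / p'" using a by (simp add: p'_def)
    \<comment> \<open>The q-th power of the hypothesis. The averaging factors then move to the right
      as h * h powr (q/p'), the origin of the exponent 1 + q*(p-1)/p.\<close>
    have "((V/h) powr (1/q) * (S/h) powr (1/p')) powr q \<le> C powr q"
      using A[OF h, of c] q by (intro powr_mono2) (auto simp: V_def S_def)
    also have "((V/h) powr (1/q) * (S/h) powr (1/p')) powr q = V/h * (S/h) powr (q/p')"
      using q nn h by (simp add: powr_mult powr_powr)
    also have "\<dots> = V * S powr (q/p') / (h * h powr (q/p'))"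
      using nn h by (simp add: powr_divide)
    finally have "V * S powr (q/p') \<le> C powr q * (h * h powr (q/p'))"
      using h by (simp add: pos_divide_le_eq)
    then have "V * S powr (q/p') \<le> C powr q * h powr (1 + q*(p-1)/p)"
      using h by (simp add: e powr_add)
    then have "ennreal V * epowr (ennreal S) (q*(p-1)/p) \<le> ennreal (C powr q * h powr (1 + q*(p-1)/p))"
      using nn by (simp add: e ennreal_mult[symmetric] ennreal_leI)
    then show "(\<integral>\<^sup>+x. ennreal (v x powr q) * indicator {c-h..c} x \<partial>lborel) *
        epowr (\<integral>\<^sup>+x. ennreal (v x powr (- (p/(p-1)))) * indicator {c..c+h} x \<partial>lborel) (q*(p-1)/p)
        \<le> ennreal (C powr q * h powr (1 + q*(p-1)/p))"
      unfolding p'_def[symmetric] nnq[OF h] nnp[OF h] V_def S_def .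
  qed (use a q C v in auto)
  then show ?thesis ..
qed

text \<open>Integrals ignore null sets, so the two fractional integrals agree at every point and the
  truncated derivatives coincide too.\<close>

lemma frac_int_cong_AE:
  assumes f: "f \<in> borel_measurable lebesgue" "g \<in> borel_measurable lebesgue" and eq: "AE x in lebesgue. f x = g x"
  shows "frac_int \<alpha> f = frac_int \<alpha> g" and "frac_int_exists \<alpha> f = frac_int_exists \<alpha> g"
proof -
  have m: "(\<lambda>t. indicator {x<..} t *\<^sub>R (f t / (t-x) powr (1-\<alpha>))) \<in> borel_measurable lebesgue"
    if f: "f \<in> borel_measurable lebesgue" for f :: "real \<Rightarrow> real" and x
  proof -
    have "(\<lambda>t. indicator {x<..} t *\<^sub>R (1 / (t-x) powr (1-\<alpha>))) \<in> borel_measurable lebesgue"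
      by (rule Borel_in_lebesgue) measurable
    then have "(\<lambda>t. f t * (indicator {x<..} t *\<^sub>R (1 / (t-x) powr (1-\<alpha>)))) \<in> borel_measurable lebesgue"
      using f by (rule borel_measurable_times[rotated])
    then show ?thesis by (simp add: mult_ac)
  qed
  have ae: "AE t in lebesgue. indicator {x<..} t *\<^sub>R (f t / (t-x) powr (1-\<alpha>)) = indicator {x<..} t *\<^sub>R (g t / (t-x) powr (1-\<alpha>))" for x
    using eq by eventually_elim simp
  show "frac_int \<alpha> f = frac_int \<alpha> g"
    unfolding frac_int_def set_lebesgue_integral_def
    by (intro ext arg_cong[where f="\<lambda>z. _ * z"] integral_cong_AE m f ae)
  show "frac_int_exists \<alpha> f = frac_int_exists \<alpha> g"
    unfolding frac_int_exists_def set_integrable_def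
    by (intro ext integrable_cong_AE m f ae)
qed

theorem theorem1p4:
  fixes \<alpha> p q :: real and w :: "real \<Rightarrow> real"
  assumes "0 < \<alpha>" and "\<alpha> < 1" and "1 < p" and "p < 1 / \<alpha>" and "1 / q = 1 / p - \<alpha>"
    and "w \<in> A_plus p q"
  shows "\<forall>f \<in> Lp_weighted p w.
     (AE x in lebesgue.
        frac_int_exists \<alpha> f x \<and>
        (\<forall>\<epsilon>>0. trunc_frac_deriv_exists \<alpha> \<epsilon> (frac_int \<alpha> f) x) \<and>
        ((\<lambda>\<epsilon>. trunc_frac_deriv \<alpha> \<epsilon> (frac_int \<alpha> f) x) \<longlongrightarrow> f x) (at_right 0)) \<and>
     (\<forall>\<epsilon>>0. trunc_frac_deriv \<alpha> \<epsilon> (frac_int \<alpha> f) \<in> Lp_weighted p w) \<and>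
     ((\<lambda>\<epsilon>. Lp_weighted_norm p w
             (\<lambda>x. trunc_frac_deriv \<alpha> \<epsilon> (frac_int \<alpha> f) x - f x)) \<longlongrightarrow> 0) (at_right 0)"
proof
  fix f assume f: "f \<in> Lp_weighted p w"
  have w: "w \<in> borel_measurable lebesgue" "\<And>x. 0 < w x"
    using assms(6) by (auto simp: A_plus_def weight_def)
  obtain v where v: "v \<in> borel_measurable borel" "\<And>x. 0 < v x" "AE x in lebesgue. w x = v x"
    using positive_borel_version[OF w] by blast
  obtain D where "one_sided_weight \<alpha> p q D v"
    using A_plus_imp_one_sided_weight[OF assms v] by blast
  then interpret one_sided_weight \<alpha> p q D v "\<lambda>s a b. \<integral>\<^sup>+x. ennreal (v x powr s) * indicator {a..b} x \<partial>lborel"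
    by simp_all
  have f_meas: "f \<in> borel_measurable lebesgue" and f_int: "integrable lebesgue (\<lambda>x. \<bar>f x\<bar> powr p * w x powr p)"
    using f by (auto simp: Lp_weighted_def)
  obtain g where "g \<in> borel_measurable lborel" and fg: "AE x in lborel. f x = g x"
    using completion_ex_borel_measurable_real[OF f_meas] by auto
  then have g [measurable]: "g \<in> borel_measurable borel" by simp
  have fg': "AE x in lebesgue. f x = g x" by (rule AE_completion[OF fg])
  have wnorm_eq: "wnorm (\<lambda>x. ennreal \<bar>h' x\<bar>) = (\<integral>\<^sup>+x. ennreal (\<bar>h x\<bar> powr p * w x powr p) \<partial>lebesgue)"
    if "AE x in lebesgue. h x = h' x" for h h' :: "real \<Rightarrow> real"
    unfolding wnorm_def nn_integral_completion[of lborel, symmetric]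
    by (rule nn_integral_cong_AE, use that v(3) in eventually_elim) (simp add: ennreal_mult)
  have fin: "wnorm (\<lambda>x. ennreal \<bar>g x\<bar>) < top"
    unfolding wnorm_eq[OF fg'] using f_int by (subst nn_integral_eq_integral) auto
  have fi: "frac_int \<alpha> f = frac_int \<alpha> g" "frac_int_exists \<alpha> f = frac_int_exists \<alpha> g"
    using frac_int_cong_AE[OF f_meas Borel_in_lebesgue[OF g] fg'] by auto
  have nnf: "AE x in lebesgue. nn_frac_int (\<lambda>y. ennreal \<bar>g y\<bar>) x < top"
    by (rule AE_completion, rule nn_frac_int_finite) (use fin in auto)
  \<comment> \<open>The exceptional null set comes from f alone, so it serves all \<epsilon> at
    once.\<close>
  have 1: "AE x in lebesgue.
        frac_int_exists \<alpha> f x \<and>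
        (\<forall>\<epsilon>>0. trunc_frac_deriv_exists \<alpha> \<epsilon> (frac_int \<alpha> f) x) \<and>
        ((\<lambda>\<epsilon>. trunc_frac_deriv \<alpha> \<epsilon> (frac_int \<alpha> f) x) \<longlongrightarrow> f x) (at_right 0)"
    using nnf fg' AE_completion[OF AE_kern_avg_tendsto[OF g fin]]
  proof eventually_elim
    case (elim x)
    have "\<forall>\<^sub>F \<epsilon> in at_right 0. kern_avg \<epsilon> g x = trunc_frac_deriv \<alpha> \<epsilon> (frac_int \<alpha> g) x"
      using eventually_at_right_less[of 0]
      by eventually_elim (simp add: trunc_frac_deriv_frac_int(2) elim)
    then have "((\<lambda>\<epsilon>. trunc_frac_deriv \<alpha> \<epsilon> (frac_int \<alpha> g) x) \<longlongrightarrow> g x) (at_right 0)"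
      using elim(3) by (rule Lim_transform_eventually[rotated])
    then show ?case
      using elim by (auto simp: fi frac_int_existsI trunc_frac_deriv_frac_int(1))
  qed
  have eq: "AE x in lebesgue. trunc_frac_deriv \<alpha> \<epsilon> (frac_int \<alpha> f) x = kern_avg \<epsilon> g x" if "0 < \<epsilon>" for \<epsilon>
    using nnf by eventually_elim (simp add: fi trunc_frac_deriv_frac_int(2) that)
  have tm: "trunc_frac_deriv \<alpha> \<epsilon> (frac_int \<alpha> f) \<in> borel_measurable lebesgue" if "0 < \<epsilon>" for \<epsilon>
  proof (rule borel_measurable_lebesgue_AE)
    show "kern_avg \<epsilon> g \<in> borel_measurable lebesgue" by (rule Borel_in_lebesgue) measurable
    show "AE x in lebesgue. kern_avg \<epsilon> g x = trunc_frac_deriv \<alpha> \<epsilon> (frac_int \<alpha> f) x"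
      using eq[OF that] by eventually_elim simp
  qed
  have 2: "trunc_frac_deriv \<alpha> \<epsilon> (frac_int \<alpha> f) \<in> Lp_weighted p w" if \<epsilon>: "0 < \<epsilon>" for \<epsilon>
    unfolding Lp_weighted_def
  proof (intro CollectI conjI tm[OF \<epsilon>] integrableI_bounded)
    show "(\<lambda>x. \<bar>trunc_frac_deriv \<alpha> \<epsilon> (frac_int \<alpha> f) x\<bar> powr p * w x powr p) \<in> borel_measurable lebesgue"
      using tm[OF \<epsilon>] w(1) by measurable
    have "ennreal (kern_const powr p * major_const) * wnorm (\<lambda>x. ennreal \<bar>g x\<bar>) < top"
      using fin by (simp add: ennreal_mult_less_top)
    then have "wnorm (\<lambda>x. ennreal \<bar>kern_avg \<epsilon> g x\<bar>) < top"
      using kern_avg_bound[OF \<epsilon> g] by (rule le_less_trans[rotated])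
    then show "(\<integral>\<^sup>+x. ennreal (norm (\<bar>trunc_frac_deriv \<alpha> \<epsilon> (frac_int \<alpha> f) x\<bar> powr p * w x powr p)) \<partial>lebesgue) < \<infinity>"
      unfolding wnorm_eq[OF eq[OF \<epsilon>]] by simp
  qed
  \<comment> \<open>An infinite integral would make both sides 0. The limit itself is taken in
    ennreal by \<open>kern_avg_tendsto_wnorm\<close>, where an infinite norm cannot pass for
    0.\<close>
  have norm_eq: "Lp_weighted_norm p w (\<lambda>x. trunc_frac_deriv \<alpha> \<epsilon> (frac_int \<alpha> f) x - f x)
      = enn2real (wnorm (\<lambda>x. ennreal \<bar>kern_avg \<epsilon> g x - g x\<bar>)) powr (1/p)" if \<epsilon>: "0 < \<epsilon>" for \<epsilon>
  proof -
    have "AE x in lebesgue. trunc_frac_deriv \<alpha> \<epsilon> (frac_int \<alpha> f) x - f x = kern_avg \<epsilon> g x - g x"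
      using eq[OF \<epsilon>] fg' by eventually_elim simp
    then show ?thesis
      using tm[OF \<epsilon>] f_meas w(1)
      by (subst wnorm_eq) (auto simp: Lp_weighted_norm_def integral_eq_nn_integral)
  qed
  have "((\<lambda>\<epsilon>. enn2real (wnorm (\<lambda>x. ennreal \<bar>kern_avg \<epsilon> g x - g x\<bar>)) powr (1/p)) \<longlongrightarrow> 0 powr (1/p)) (at_right 0)"
    using assms(3) kern_avg_tendsto_wnorm[OF g fin]
    by (intro tendsto_powr2 tendsto_enn2real tendsto_const) auto
  moreover have "\<forall>\<^sub>F \<epsilon> in at_right 0. enn2real (wnorm (\<lambda>x. ennreal \<bar>kern_avg \<epsilon> g x - g x\<bar>)) powr (1/p)
      = Lp_weighted_norm p w (\<lambda>x. trunc_frac_deriv \<alpha> \<epsilon> (frac_int \<alpha> f) x - f x)"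
    using eventually_at_right_less[of 0] by eventually_elim (simp add: norm_eq)
  ultimately have 3: "((\<lambda>\<epsilon>. Lp_weighted_norm p w (\<lambda>x. trunc_frac_deriv \<alpha> \<epsilon> (frac_int \<alpha> f) x - f x)) \<longlongrightarrow> 0) (at_right 0)"
    by (auto intro: Lim_transform_eventually)
  show "(AE x in lebesgue.
        frac_int_exists \<alpha> f x \<and>
        (\<forall>\<epsilon>>0. trunc_frac_deriv_exists \<alpha> \<epsilon> (frac_int \<alpha> f) x) \<and>
        ((\<lambda>\<epsilon>. trunc_frac_deriv \<alpha> \<epsilon> (frac_int \<alpha> f) x) \<longlongrightarrow> f x) (at_right 0)) \<and>
     (\<forall>\<epsilon>>0. trunc_frac_deriv \<alpha> \<epsilon> (frac_int \<alpha> f) \<in> Lp_weighted p w) \<and>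
     ((\<lambda>\<epsilon>. Lp_weighted_norm p w
             (\<lambda>x. trunc_frac_deriv \<alpha> \<epsilon> (frac_int \<alpha> f) x - f x)) \<longlongrightarrow> 0) (at_right 0)"
    using 1 2 3 by blast
qed

end
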